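(* Let $\mathbf s=(s_0,s_1)\in H_w$ and $u\in\mathcal U$, and let $Z$ be the associated process. For each $n\ge0$ let $(S^n,X^{n,k})_{k=0,\dots,n}$, with $X^{n,0}:=S^n$, be the finite-dimensional Markov diffusion solving $$dS^n_t=b\Big(S^n_t,\sum_{k=1}^n\alpha^kX^{n,k}_t,u_t\Big)dt+\sigma\Big(S^n_t,\sum_{k=1}^n\beta^kX^{n,k}_t,u_t\Big)dW_t,$$ $$dX^{n,k}_t=\Big(\sqrt{2p_0}\,S^n_t-2p_0\sum_{i=1}^{k-1}X^{n,i}_t-\big(p_0-\tfrac p2\big)X^{n,k}_t\Big)dt,\qquad k=1,\dots,n,$$ with initial data $S^n_0=s_0=\langle\mathbf e^0,\mathbf s\rangle_w$ and $X^{n,k}_0=\langle\mathbf e^k,\mathbf s\rangle_w$, $k=1,\dots,n$. Then for every $T>0$ there exists $C=C_{T,\|\mathbf s\|_w,\|\boldsymbol\alpha\|_w,\|\boldsymbol\beta\|_w,\|\boldsymbol\gamma\|_w}<\infty$ such that, uniformly on $u\in\mathcal U$, $$\mathbb E\Big[\sup_{0\le t\le T}\Big|Z_t-\sum_{k=0}^n\gamma^kX^{n,k}_t\Big|^2\Big]\le C\big(\|\boldsymbol\alpha-\boldsymbol\alpha^n\|_w^2+\|\boldsymbol\beta-\boldsymbol\beta^n\|_w^2+\|\boldsymbol\gamma-\boldsymbol\gamma^n\|_w^2\big).$$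
   Context: Setting. $(\Omega,\mathcal F,\mathbb P)$ is a complete probability space carrying a one-dimensional Brownian motion $W$; $\mathbb F=(\mathcal F_t)_{t\ge0}$ is the filtration generated by $W$ and enlarged by the $\mathbb P$-null sets. $\mathbb R^-=(-\infty,0]$. Weight: $w(\xi)=e^{p\xi}$ on $\mathbb R^-$, with $p\in\mathbb R$ fixed; $p_0:=\lambda-p$ for a fixed $\lambda>\max\{p,p/2\}$ (so $p_0>0$). $L^2_w:=L^2(\mathbb R^-,w(\xi)d\xi;\mathbb R)$, $H_w:=\mathbb R\times L^2_w$ with inner product $\langle\mathbf x,\mathbf y\rangle_w=x_0y_0+\int_{\mathbb R^-}x_1y_1w\,d\xi$ and norm $\|\cdot\|_w$. Coefficients: $U\subset\mathbb R^d$; $\mathcal U$ is the set of adapted processes $(u_t)_{t\ge0}$ belonging to $L^2_{loc}(\mathbb R^+;L^2(\Omega;U))$; $b,\sigma:\mathbb R^2\times U\to\mathbb R$ are such that there are constants $C_1,C_2\ge0$ with $|b(x,y,u)-b(x',y',u)|+|\sigma(x,y,u)-\sigma(x',y',u)|\le C_1(|x-x'|+|y-y'|)$ and $|b(x,y,u)|+|\sigma(x,y,u)|\le C_2(1+|x|+|y|)$ for all $x,x',y,y'\in\mathbb R$, $u\in U$. $\alpha_1,\beta_1,\gamma_1\in L^2_w$, $\gamma_0\in\mathbb R$. Put $\boldsymbol\alpha=(0,\alpha_1)$, $\boldsymbol\beta=(0,\beta_1)$, $\boldsymbol\gamma=(\gamma_0,\gamma_1)$ in $H_w$. For $\mathbf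 s=(s_0,s_1)\in H_w$ and $u\in\mathcal U$, $S$ is the unique strong solution (with continuous paths) of $$dS_t=b\Big(S_t,\int_{\mathbb R^-}\alpha_1(\xi)S_{t+\xi}w(\xi)d\xi,u_t\Big)dt+\sigma\Big(S_t,\int_{\mathbb R^-}\beta_1(\xi)S_{t+\xi}w(\xi)d\xi,u_t\Big)dW_t,$$ with $S_0=s_0$, $S_\xi=s_1(\xi)$ for $\xi<0$, and $Z_t=\gamma_0S_t+\int_{\mathbb R^-}\gamma_1(\xi)S_{t+\xi}w(\xi)d\xi$. Laguerre basis: for $k\ge0$ and $\xi\le0$ let $P_k(\xi)=\sum_{i=0}^k\binom ki\frac{\xi^i}{i!}$ (the Laguerre polynomial evaluated at $-\xi$) and $L_{k,p_0,p}(\xi)=\sqrt{2p_0}\,e^{-\frac p2\xi}P_k(2p_0\xi)e^{p_0\xi}$. Set $\mathbf e^0=(1,0)$ and $\mathbf e^k=(0,L_{k-1,p_0,p})$ for $k\ge1$; $(\mathbf e^k)_{k\ge0}$ is an orthonormal basis of $H_w$. Set $\alpha^k=\langle\mathbf e^k,\boldsymbol\alpha\rangle_w$, $\beta^k=\langle\mathbf e^k,\boldsymbol\beta\rangle_w$, $\gamma^k=\langle\mathbf e^k,\boldsymbol\gamma\rangle_w$, and $\boldsymbol\alpha^n=\sum_{k=0}^n\alpha^k\mathbf e^k$, $\boldsymbol\beta^n=\sum_{k=0}^n\beta^k\mathbf e^k$, $\boldsymbol\gamma^n=\sum_{k=0}^n\gamma^k\mathbf e^k$.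
   Formalization: The damping coefficient of X^{n,k} is p_0+p/2 instead of the printed p_0-p/2, with which the claim fails for p≠0 (b=σ=0, α=β=0, s=(1,0), γ=e^1, n=1 makes the right side 0 but the error nonzero); the two agree for p=0. *)

theory Defs
  imports "HOL-Probability.Probability"
begin

section \<open>The weighted space and the Laguerre basis\<close>

text \<open>Elements of \<open>L\<^sup>2\<^sub>w\<close> are given by Borel representatives on \<open>(-\<infinity>, 0]\<close>; values on
  \<open>(0, \<infinity>)\<close> are never used. The vector operations of \<open>H\<^sub>w\<close> are those of \<open>real \<times> (real \<Rightarrow> real)\<close>,
  taken componentwise and pointwise.\<close>

definition L2w :: "real \<Rightarrow> (real \<Rightarrow> real) set" where
  "L2w p = {f. set_borel_measurable lborel {..0} f \<and>
     set_integrable lborel {..0} (\<lambda>\<xi>. (f \<xi>)\<^sup>2 * exp (p * \<xi>))}"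

definition Hw :: "real \<Rightarrow> (real \<times> (real \<Rightarrow> real)) set" where
  "Hw p = UNIV \<times> L2w p"

definition inner_w :: "real \<Rightarrow> real \<times> (real \<Rightarrow> real) \<Rightarrow> real \<times> (real \<Rightarrow> real) \<Rightarrow> real" where
  "inner_w p x y = fst x * fst y + (LINT \<xi>:{..0}|lborel. snd x \<xi> * snd y \<xi> * exp (p * \<xi>))"

definition norm_w :: "real \<Rightarrow> real \<times> (real \<Rightarrow> real) \<Rightarrow> real" where
  "norm_w p x = sqrt (inner_w p x x)"

definition diff_w :: "real \<times> (real \<Rightarrow> real) \<Rightarrow> real \<times> (real \<Rightarrow> real) \<Rightarrow> real \<times> (real \<Rightarrow> real)" where
  "diff_w x y = (fst x - fst y, \<lambda>\<xi>. snd x \<xi> - snd y \<xi>)"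

definition lag_P :: "nat \<Rightarrow> real \<Rightarrow> real" where
  "lag_P k \<xi> = (\<Sum>i\<le>k. real (k choose i) * \<xi> ^ i / fact i)"

definition lag_L :: "real \<Rightarrow> real \<Rightarrow> nat \<Rightarrow> real \<Rightarrow> real" where
  "lag_L p0 p k \<xi> = sqrt (2 * p0) * exp (- (p / 2) * \<xi>) * lag_P k (2 * p0 * \<xi>) * exp (p0 * \<xi>)"

definition basis_w :: "real \<Rightarrow> real \<Rightarrow> nat \<Rightarrow> real \<times> (real \<Rightarrow> real)" where
  "basis_w p0 p k = (case k of 0 \<Rightarrow> (1, \<lambda>\<xi>. 0) | Suc j \<Rightarrow> (0, lag_L p0 p j))"

definition coord_w :: "real \<Rightarrow> real \<Rightarrow> real \<times> (real \<Rightarrow> real) \<Rightarrow> nat \<Rightarrow> real" where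
  "coord_w p0 p x k = inner_w p (basis_w p0 p k) x"

definition trunc_w :: "real \<Rightarrow> real \<Rightarrow> nat \<Rightarrow> real \<times> (real \<Rightarrow> real) \<Rightarrow> real \<times> (real \<Rightarrow> real)" where
  "trunc_w p0 p n x =
     ((\<Sum>k\<le>n. coord_w p0 p x k * fst (basis_w p0 p k)),
      (\<lambda>\<xi>. \<Sum>k\<le>n. coord_w p0 p x k * snd (basis_w p0 p k) \<xi>))"

section \<open>Brownian motion and its augmented filtration\<close>

definition brownian_hist :: "'w measure \<Rightarrow> (real \<Rightarrow> 'w \<Rightarrow> real) \<Rightarrow> real \<Rightarrow> 'w set set" where
  "brownian_hist M W t = (\<Union>s\<in>{0..t}. {W s -` B \<inter> space M | B. B \<in> sets borel})"

definition brownian_motion :: "'w measure \<Rightarrow> (real \<Rightarrow> 'w \<Rightarrow> real) \<Rightarrow> bool" where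
  "brownian_motion M W \<longleftrightarrow>
     (\<forall>t\<ge>0. W t \<in> borel_measurable M) \<and>
     (AE \<omega> in M. W 0 \<omega> = 0) \<and>
     (AE \<omega> in M. continuous_on {0..} (\<lambda>t. W t \<omega>)) \<and>
     (\<forall>s\<ge>0. \<forall>t>s.
        distributed M lborel (\<lambda>\<omega>. W t \<omega> - W s \<omega>) (\<lambda>x. ennreal (normal_density 0 (sqrt (t - s)) x)) \<and>
        prob_space.indep_set M (sigma_sets (space M) (brownian_hist M W s))
          {(\<lambda>\<omega>. W t \<omega> - W s \<omega>) -` B \<inter> space M | B. B \<in> sets borel})"

definition brownian_filtration :: "'w measure \<Rightarrow> (real \<Rightarrow> 'w \<Rightarrow> real) \<Rightarrow> real \<Rightarrow> 'w measure" where
  "brownian_filtration M W t = sigma (space M) (brownian_hist M W t \<union> null_sets M)"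

definition adapted :: "(real \<Rightarrow> 'w measure) \<Rightarrow> (real \<Rightarrow> 'w \<Rightarrow> 'b::topological_space) \<Rightarrow> bool" where
  "adapted F X \<longleftrightarrow> (\<forall>t\<ge>0. X t \<in> borel_measurable (F t))"

definition measurable_process :: "'w measure \<Rightarrow> (real \<Rightarrow> 'w \<Rightarrow> 'b::topological_space) \<Rightarrow> bool" where
  "measurable_process M X \<longleftrightarrow>
     (\<lambda>(t, \<omega>). X t \<omega>) \<in> borel_measurable (restrict_space borel {0..} \<Otimes>\<^sub>M M)"

definition continuous_paths :: "'w measure \<Rightarrow> (real \<Rightarrow> 'w \<Rightarrow> real) \<Rightarrow> bool" where
  "continuous_paths M X \<longleftrightarrow> (\<forall>\<omega>\<in>space M. continuous_on {0..} (\<lambda>t. X t \<omega>))"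

section \<open>The stochastic integral\<close>

text \<open>This is applied only to measurable \<open>Y m\<close>; for the suprema over \<open>t\<close> below, measurability
  follows from almost sure path continuity and completeness of \<open>M\<close>.\<close>

definition tendsto_zero_in_prob :: "'w measure \<Rightarrow> (nat \<Rightarrow> 'w \<Rightarrow> ennreal) \<Rightarrow> bool" where
  "tendsto_zero_in_prob M Y \<longleftrightarrow>
     (\<forall>\<epsilon>>0. (\<lambda>m. measure M {\<omega> \<in> space M. ennreal \<epsilon> < Y m \<omega>}) \<longlonglongrightarrow> 0)"

text \<open>A triple \<open>(N, \<tau>, h)\<close> encodes the elementary process
  \<open>\<Sum>i<N. h\<^sub>i 1\<^bsub>(\<tau>\<^sub>i, \<tau>\<^sub>i\<^sub>+\<^sub>1]\<^esub>\<close>.\<close>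

type_synonym 'w elementary = "nat \<times> (nat \<Rightarrow> real) \<times> (nat \<Rightarrow> 'w \<Rightarrow> real)"

definition elementary_process :: "'w measure \<Rightarrow> (real \<Rightarrow> 'w measure) \<Rightarrow> 'w elementary \<Rightarrow> bool" where
  "elementary_process M F = (\<lambda>(N, \<tau>, h).
     0 \<le> \<tau> 0 \<and>
     (\<forall>i<N. \<tau> i \<le> \<tau> (Suc i) \<and> h i \<in> borel_measurable (F (\<tau> i)) \<and>
        (\<exists>K. \<forall>\<omega>\<in>space M. \<bar>h i \<omega>\<bar> \<le> K)))"

definition elementary_val :: "'w elementary \<Rightarrow> real \<Rightarrow> 'w \<Rightarrow> real" where
  "elementary_val = (\<lambda>(N, \<tau>, h) t \<omega>. \<Sum>i<N. h i \<omega> * indicator {\<tau> i <.. \<tau> (Suc i)} t)"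

definition elementary_int ::
  "(real \<Rightarrow> 'w \<Rightarrow> real) \<Rightarrow> 'w elementary \<Rightarrow> real \<Rightarrow> 'w \<Rightarrow> real" where
  "elementary_int W = (\<lambda>(N, \<tau>, h) t \<omega>.
     \<Sum>i<N. h i \<omega> * (W (min t (\<tau> (Suc i))) \<omega> - W (min t (\<tau> i)) \<omega>))"

text \<open>\<open>I\<close> is (a continuous version of) the process \<open>t \<mapsto> \<integral>\<^sub>0\<^sup>t H\<^sub>s dW\<^sub>s\<close>, for \<open>H\<close> measurable, adapted
  and almost surely locally square integrable in time: on every \<open>[0, T]\<close> it is the uniform limit in
  probability of integrals of elementary processes converging to \<open>H\<close> in \<open>L\<^sup>2([0, T])\<close> in probability.
  The limit does not depend, up to indistinguishability, on the approximating sequence.\<close>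

definition ito_integral ::
  "'w measure \<Rightarrow> (real \<Rightarrow> 'w \<Rightarrow> real) \<Rightarrow> (real \<Rightarrow> 'w \<Rightarrow> real) \<Rightarrow> (real \<Rightarrow> 'w \<Rightarrow> real) \<Rightarrow> bool" where
  "ito_integral M W H I \<longleftrightarrow>
     adapted (brownian_filtration M W) H \<and> measurable_process M H \<and>
     (\<forall>T>0. AE \<omega> in M. set_integrable lborel {0..T} (\<lambda>s. (H s \<omega>)\<^sup>2)) \<and>
     adapted (brownian_filtration M W) I \<and> continuous_paths M I \<and>
     (\<forall>T>0. \<exists>G :: nat \<Rightarrow> 'w elementary.
        (\<forall>m. elementary_process M (brownian_filtration M W) (G m)) \<and>
        tendsto_zero_in_prob M
          (\<lambda>m \<omega>. \<integral>\<^sup>+s\<in>{0..T}. ennreal ((H s \<omega> - elementary_val (G m) s \<omega>)\<^sup>2) \<partial>lborel) \<and>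
        tendsto_zero_in_prob M
          (\<lambda>m \<omega>. SUP t\<in>{0..T}. ennreal \<bar>I t \<omega> - elementary_int W (G m) t \<omega>\<bar>))"

text \<open>\<open>X\<close> is a continuous adapted solution of \<open>dX\<^sub>t = B\<^sub>t dt + A\<^sub>t dW\<^sub>t\<close>, \<open>X\<^sub>0 = x0\<close>.\<close>

definition ito_process ::
  "'w measure \<Rightarrow> (real \<Rightarrow> 'w \<Rightarrow> real) \<Rightarrow> real \<Rightarrow> (real \<Rightarrow> 'w \<Rightarrow> real) \<Rightarrow> (real \<Rightarrow> 'w \<Rightarrow> real)
    \<Rightarrow> (real \<Rightarrow> 'w \<Rightarrow> real) \<Rightarrow> bool" where
  "ito_process M W x0 B A X \<longleftrightarrow>
     adapted (brownian_filtration M W) X \<and> continuous_paths M X \<and>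
     adapted (brownian_filtration M W) B \<and> measurable_process M B \<and>
     (\<forall>T>0. AE \<omega> in M. set_integrable lborel {0..T} (\<lambda>s. B s \<omega>)) \<and>
     (\<exists>I. ito_integral M W A I \<and>
        (AE \<omega> in M. \<forall>t\<ge>0. X t \<omega> = x0 + (LINT s:{0..t}|lborel. B s \<omega>) + I t \<omega>))"

section \<open>The controlled delay equation and the finite-dimensional system\<close>

definition admissible_control ::
  "'w measure \<Rightarrow> (real \<Rightarrow> 'w \<Rightarrow> real) \<Rightarrow> (real ^ 'd) set \<Rightarrow> (real \<Rightarrow> 'w \<Rightarrow> real ^ 'd) \<Rightarrow> bool" where
  "admissible_control M W U u \<longleftrightarrow>
     adapted (brownian_filtration M W) u \<and> measurable_process M u \<and>
     (\<forall>t\<ge>0. \<forall>\<omega>\<in>space M. u t \<omega> \<in> U) \<and>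
     (\<forall>T>0. (\<integral>\<^sup>+t\<in>{0..T}. (\<integral>\<^sup>+\<omega>. ennreal ((norm (u t \<omega>))\<^sup>2) \<partial>M) \<partial>lborel) < \<infinity>)"

definition delay_int :: "real \<Rightarrow> (real \<Rightarrow> real) \<Rightarrow> (real \<Rightarrow> 'w \<Rightarrow> real) \<Rightarrow> real \<Rightarrow> 'w \<Rightarrow> real" where
  "delay_int p f S t \<omega> = (LINT \<xi>:{..0}|lborel. f \<xi> * S (t + \<xi>) \<omega> * exp (p * \<xi>))"

definition delay_solution ::
  "'w measure \<Rightarrow> (real \<Rightarrow> 'w \<Rightarrow> real) \<Rightarrow> real \<Rightarrow>
    (real \<Rightarrow> real \<Rightarrow> real ^ 'd \<Rightarrow> real) \<Rightarrow> (real \<Rightarrow> real \<Rightarrow> real ^ 'd \<Rightarrow> real) \<Rightarrow>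
    (real \<Rightarrow> real) \<Rightarrow> (real \<Rightarrow> real) \<Rightarrow> real \<times> (real \<Rightarrow> real) \<Rightarrow>
    (real \<Rightarrow> 'w \<Rightarrow> real ^ 'd) \<Rightarrow> (real \<Rightarrow> 'w \<Rightarrow> real) \<Rightarrow> bool" where
  "delay_solution M W p b \<sigma> \<alpha>1 \<beta>1 s u S \<longleftrightarrow>
     (\<forall>\<omega>\<in>space M. S 0 \<omega> = fst s \<and> (\<forall>\<xi><0. S \<xi> \<omega> = snd s \<xi>)) \<and>
     ito_process M W (fst s)
       (\<lambda>t \<omega>. b (S t \<omega>) (delay_int p \<alpha>1 S t \<omega>) (u t \<omega>))
       (\<lambda>t \<omega>. \<sigma> (S t \<omega>) (delay_int p \<beta>1 S t \<omega>) (u t \<omega>)) S"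

definition delay_output ::
  "real \<Rightarrow> real \<Rightarrow> (real \<Rightarrow> real) \<Rightarrow> (real \<Rightarrow> 'w \<Rightarrow> real) \<Rightarrow> real \<Rightarrow> 'w \<Rightarrow> real" where
  "delay_output p \<gamma>0 \<gamma>1 S t \<omega> = \<gamma>0 * S t \<omega> + delay_int p \<gamma>1 S t \<omega>"

lemma lag_P_has_derivative:
  "(lag_P k has_real_derivative (\<Sum>i<k. lag_P i x)) (at x)"
proof (induction k)
  case 0
  have "lag_P 0 = (\<lambda>_. 1)"
    by (simp add: lag_P_def fun_eq_iff)
  then show ?case by simp
next
  case (Suc k)
  have split: "lag_P (Suc k) y = lag_P k y + (\<Sum>i\<le>k. real (k choose i) * y ^ Suc i / fact (Suc i))" for y
  proof -
    have "lag_P (Suc k) y = 1 + (\<Sum>i\<le>k. real (Suc k choose Suc i) * y ^ Suc i / fact (Suc i))"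
      unfolding lag_P_def by (subst sum.atMost_Suc_shift) simp
    also have "\<dots> = 1 + (\<Sum>i\<le>k. real (k choose Suc i) * y ^ Suc i / fact (Suc i))
        + (\<Sum>i\<le>k. real (k choose i) * y ^ Suc i / fact (Suc i))"
      by (simp add: sum.distrib[symmetric] algebra_simps add_divide_distrib del: fact_Suc)
    also have "1 + (\<Sum>i\<le>k. real (k choose Suc i) * y ^ Suc i / fact (Suc i))
        = (\<Sum>i\<le>Suc k. real (k choose i) * y ^ i / fact i)"
      by (subst sum.atMost_Suc_shift) simp
    also have "\<dots> = lag_P k y"
      by (simp add: lag_P_def binomial_eq_0)
    finally show ?thesis .
  qed
  have "((\<lambda>y. y ^ Suc i / fact (Suc i)) has_real_derivative x ^ i / fact i) (at x)" for i
    using DERIV_cdivide[OF DERIV_pow[of "Suc i" x UNIV], of "fact (Suc i)"] by simp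
  then have "((\<lambda>y. real (k choose i) * (y ^ Suc i / fact (Suc i)))
      has_real_derivative real (k choose i) * (x ^ i / fact i)) (at x)" for i
    by (rule DERIV_cmult)
  then have "((\<lambda>y. \<Sum>i\<le>k. real (k choose i) * y ^ Suc i / fact (Suc i))
      has_real_derivative lag_P k x) (at x)"
    unfolding lag_P_def by (intro DERIV_sum) (simp del: fact_Suc power_Suc)
  from DERIV_add[OF Suc this] show ?case
    using split by (simp add: fun_eq_iff[symmetric] del: fact_Suc power_Suc)
qed

text \<open>The next identity fixes the coefficients of the finite-dimensional system. If
  \<open>X\<^sup>k\<^sub>t = \<integral>\<^bsub>-\<infinity>\<^esub>\<^sup>0 L\<^sub>k\<^sub>-\<^sub>1(\<xi>) S\<^bsub>t+\<xi>\<^esub> w(\<xi>) d\<xi>\<close>, then \<open>dX\<^sup>k\<^sub>t/dt\<close> is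
  \<open>L\<^sub>k\<^sub>-\<^sub>1(0) w(0) S\<^sub>t - \<integral>\<^bsub>-\<infinity>\<^esub>\<^sup>0 (L\<^sub>k\<^sub>-\<^sub>1 w)'(\<xi>) S\<^bsub>t+\<xi>\<^esub> d\<xi>\<close>. The damping rate is therefore \<open>p0 + p/2\<close>,
  and not the rate \<open>p0 - p/2\<close> that one gets from \<open>L\<^sub>k\<^sub>-\<^sub>1'\<close> when the derivative of the weight
  is left out.\<close>

lemma lag_L_weighted_has_derivative:
  "((\<lambda>\<xi>. lag_L p0 p k \<xi> * exp (p * \<xi>)) has_real_derivative
     (2 * p0 * (\<Sum>i<k. lag_L p0 p i \<xi>) + (p0 + p / 2) * lag_L p0 p k \<xi>) * exp (p * \<xi>)) (at \<xi>)"
proof -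
  have P: "((\<lambda>\<xi>. lag_P k (2 * p0 * \<xi>)) has_real_derivative
      (\<Sum>i<k. lag_P i (2 * p0 * \<xi>)) * (2 * p0)) (at \<xi>)"
    by (rule DERIV_chain2[OF lag_P_has_derivative]) (rule derivative_eq_intros refl | simp)+
  have "((\<lambda>\<xi>. lag_L p0 p k \<xi> * exp (p * \<xi>)) has_real_derivative
      sqrt (2 * p0) * exp (- (p / 2) * \<xi>) * exp (p0 * \<xi>) * exp (p * \<xi>) *
       ((\<Sum>i<k. lag_P i (2 * p0 * \<xi>)) * (2 * p0) + (p0 + p / 2) * lag_P k (2 * p0 * \<xi>))) (at \<xi>)"
    unfolding lag_L_def
    by (rule derivative_eq_intros P refl | simp add: algebra_simps)+
  then show ?thesis
    by (simp add: lag_L_def sum_distrib_left sum_distrib_right algebra_simps)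
qed

lemma lag_L_0: "lag_L p0 p k 0 = sqrt (2 * p0)"
proof -
  have "lag_P k 0 = (\<Sum>i\<le>k. if i = 0 then 1 else 0)"
    unfolding lag_P_def by (intro sum.cong) auto
  then show ?thesis by (simp add: lag_L_def)
qed

definition laguerre_system ::
  "'w measure \<Rightarrow> (real \<Rightarrow> 'w \<Rightarrow> real) \<Rightarrow> real \<Rightarrow> real \<Rightarrow>
    (real \<Rightarrow> real \<Rightarrow> real ^ 'd \<Rightarrow> real) \<Rightarrow> (real \<Rightarrow> real \<Rightarrow> real ^ 'd \<Rightarrow> real) \<Rightarrow>
    (real \<Rightarrow> real) \<Rightarrow> (real \<Rightarrow> real) \<Rightarrow> real \<times> (real \<Rightarrow> real) \<Rightarrow>
    (real \<Rightarrow> 'w \<Rightarrow> real ^ 'd) \<Rightarrow> nat \<Rightarrow> (nat \<Rightarrow> real \<Rightarrow> 'w \<Rightarrow> real) \<Rightarrow> bool" where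
  "laguerre_system M W p0 p b \<sigma> \<alpha>1 \<beta>1 s u n X \<longleftrightarrow>
     ito_process M W (fst s)
       (\<lambda>t \<omega>. b (X 0 t \<omega>) (\<Sum>k=1..n. coord_w p0 p (0, \<alpha>1) k * X k t \<omega>) (u t \<omega>))
       (\<lambda>t \<omega>. \<sigma> (X 0 t \<omega>) (\<Sum>k=1..n. coord_w p0 p (0, \<beta>1) k * X k t \<omega>) (u t \<omega>)) (X 0) \<and>
     (\<forall>k\<in>{1..n}.
        adapted (brownian_filtration M W) (X k) \<and> continuous_paths M (X k) \<and>
        (AE \<omega> in M. \<forall>t\<ge>0. X k t \<omega> = coord_w p0 p s k +
           (LINT r:{0..t}|lborel. sqrt (2 * p0) * X 0 r \<omega> - 2 * p0 * (\<Sum>i=1..<k. X i r \<omega>)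
              - (p0 + p / 2) * X k r \<omega>)))"

end

theory Submission
  imports Defs
begin

text \<open>The coordinates \<open>X\<^sup>n\<^sup>,\<^sup>k\<close> solve the linear equation that is satisfied by the Laguerre
  coordinates of the history segment of \<open>S\<^sup>n\<close>, so they are these coordinates, and \<open>S\<^sup>n\<close> solves the delay
  equation with \<open>\<alpha>\<^sub>1, \<beta>\<^sub>1\<close> replaced by their projections. The Cauchy--Schwarz and Bessel inequalities bound
  the difference of the coefficients by the truncation errors, times the history of \<open>S\<close>, plus the history
  of \<open>S - S\<^sup>n\<close>. Doob's inequality and Gronwall's lemma then give the estimate; the same argument
  with the zero process in place of \<open>S\<^sup>n\<close> bounds the second moment of \<open>\<bar>S\<bar>\<close>. No moment is known to be
  finite in advance, so Doob's inequality is localized: on the level of elementary integrands the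
  coefficients are switched off once \<open>\<bar>S - S\<^sup>n\<bar>\<close> has exceeded a level \<open>K\<close>, and \<open>K\<close> tends to
  infinity at the end.\<close>


section \<open>Brownian increments and the augmented filtration\<close>

text \<open>\<open>ito_integral\<close> describes the stochastic integral only as a limit in
  probability of elementary integrals, so neither an isometry nor a martingale property of the limit
  is at hand. All probabilistic input is an expectation of a finite sum, computed from the
  independence of Brownian increments, and only the resulting inequality passes to the limit.
  Besides the level \<open>K\<close>, which keeps the Gronwall function finite, a bound
  \<open>L\<close> on the accumulated square integral is needed there: it makes the right-hand sides
  uniformly bounded. \<open>L\<close> disappears inside the maximal inequality, \<open>K\<close>
  only after Gronwall's lemma. The checks are made at rational times strictly before the current
  one, so that the cut-off is predictable and determined by countably many values. The truncation
  errors multiply only the history of \<open>S\<close>, so no moment of \<open>S^n\<close> has to be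
  bounded separately. The conditions on \<open>b\<close> and \<open>\<sigma>\<close> are uniform in
  the control value, hence the constant does not see \<open>u\<close>; Bessel's inequality keeps
  \<open>n\<close> out of the Gronwall rate.\<close>

locale brownian_space = prob_space M + complete_measure M
  for M :: "'w measure" +
  fixes W :: "real \<Rightarrow> 'w \<Rightarrow> real"
  assumes brownian: "brownian_motion M W"
begin

abbreviation F :: "real \<Rightarrow> 'w measure"
  where "F \<equiv> brownian_filtration M W"

lemma W_measurable: "0 \<le> t \<Longrightarrow> W t \<in> borel_measurable M"
  using brownian by (simp add: brownian_motion_def)

lemma brownian_hist_subset: "brownian_hist M W t \<subseteq> sets M"
  by (auto simp: brownian_hist_def intro!: measurable_sets[OF W_measurable])

lemma generator_subset: "brownian_hist M W t \<union> null_sets M \<subseteq> Pow (space M)"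
  using brownian_hist_subset[of t] sets.space_closed[of M] by auto

lemma space_F [simp]: "space (F t) = space M"
  by (simp add: brownian_filtration_def space_measure_of[OF generator_subset])

lemma sets_F: "sets (F t) = sigma_sets (space M) (brownian_hist M W t \<union> null_sets M)"
  by (simp add: brownian_filtration_def sets_measure_of[OF generator_subset])

lemma sets_F_subset: "sets (F t) \<subseteq> sets M"
  unfolding sets_F using brownian_hist_subset[of t] by (intro sets.sigma_sets_subset) auto

lemma F_measurable_M: "f \<in> measurable (F t) N \<Longrightarrow> f \<in> measurable M N"
  by (rule measurable_from_subalg[of M "F t"])
     (auto simp: subalgebra_def sets_F_subset)

lemma F_mono:
  assumes "s \<le> t" "f \<in> measurable (F s) N"
  shows "f \<in> measurable (F t) N"
proof -
  have "brownian_hist M W s \<subseteq> brownian_hist M W t"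
    using assms(1) by (force simp: brownian_hist_def)
  then have "sets (F s) \<subseteq> sets (F t)"
    unfolding sets_F by (intro sigma_sets_mono') auto
  then show ?thesis
    by (intro measurable_from_subalg[OF _ assms(2)]) (auto simp: subalgebra_def)
qed

lemma W_measurable_F:
  assumes "0 \<le> s" "s \<le> t"
  shows "W s \<in> borel_measurable (F t)"
proof (rule measurableI)
  fix B :: "real set" assume "B \<in> sets borel"
  then have "W s -` B \<inter> space M \<in> brownian_hist M W t"
    using assms unfolding brownian_hist_def by (intro UN_I[of s]) auto
  then show "W s -` B \<inter> space (F t) \<in> sets (F t)"
    by (auto simp: sets_F intro: sigma_sets.Basic)
qed auto

text \<open>The sets that agree almost surely with some event of the raw history contain the
  generators of \<open>F s\<close> and are closed under complements and countable unions. This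
  reduces the augmented filtration to the raw history, for which \<open>brownian_motion\<close>
  asserts independence.\<close>

lemma sets_F_AE_eq:
  assumes "A \<in> sets (F s)"
  obtains A' where "A' \<in> sigma_sets (space M) (brownian_hist M W s)"
    "AE \<omega> in M. \<omega> \<in> A \<longleftrightarrow> \<omega> \<in> A'"
proof -
  have "\<exists>A'\<in>sigma_sets (space M) (brownian_hist M W s). AE \<omega> in M. \<omega> \<in> A \<longleftrightarrow> \<omega> \<in> A'"
    using assms unfolding sets_F
  proof (induction rule: sigma_sets.induct)
    case (Basic a)
    then show ?case
    proof
      assume "a \<in> null_sets M"
      then show ?thesis
        by (intro bexI[of _ "{}"]) (auto simp: sigma_sets.Empty dest: AE_not_in)
    qed (auto intro: sigma_sets.Basic)
  next
    case Empty
    then show ?case by (auto intro!: bexI[of _ "{}"] sigma_sets.Empty)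
  next
    case (Compl a)
    then obtain a' where "a' \<in> sigma_sets (space M) (brownian_hist M W s)"
        "AE \<omega> in M. \<omega> \<in> a \<longleftrightarrow> \<omega> \<in> a'"
      by auto
    then show ?case
      by (intro bexI[of _ "space M - a'"]) (auto intro: sigma_sets.Compl)
  next
    case (Union a)
    then obtain a' where "\<And>i. a' i \<in> sigma_sets (space M) (brownian_hist M W s)"
        "\<And>i. AE \<omega> in M. \<omega> \<in> a i \<longleftrightarrow> \<omega> \<in> a' i"
      by metis
    from this(2) have "AE \<omega> in M. \<forall>i. \<omega> \<in> a i \<longleftrightarrow> \<omega> \<in> a' i"
      by (simp add: AE_all_countable)
    with \<open>\<And>i. a' i \<in> _\<close> show ?case
      by (intro bexI[of _ "\<Union>i. a' i"] sigma_sets.Union) (auto elim!: eventually_mono)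
  qed
  then show ?thesis using that by blast
qed

text \<open>Replacing an event of \<open>F s\<close> by an almost surely equal event of the raw
  history changes neither its probability nor that of its intersection with an event of the
  increment, so independence survives the augmentation.\<close>

lemma indep_var_increment:
  assumes "0 \<le> s" "s < t" "Y \<in> borel_measurable (F s)"
  shows "indep_var borel Y borel (\<lambda>\<omega>. W t \<omega> - W s \<omega>)"
proof -
  define \<Delta> where "\<Delta> = (\<lambda>\<omega>. W t \<omega> - W s \<omega>)"
  have \<Delta>: "\<Delta> \<in> borel_measurable M"
    unfolding \<Delta>_def using assms by (intro borel_measurable_diff W_measurable) auto
  have ind: "indep_set (sigma_sets (space M) (brownian_hist M W s)) {\<Delta> -` B \<inter> space M | B. B \<in> sets borel}"
    using brownian assms unfolding brownian_motion_def \<Delta>_def by auto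
  \<comment> \<open>The preimages of Borel sets already form a sigma-algebra;
    \<open>indep_var_eq\<close> is phrased with the generated one.\<close>
  have eq: "sigma_sets (space M) {X -` A \<inter> space M |A. A \<in> sets borel} =
      {X -` A \<inter> space M |A. A \<in> sets borel}" for X :: "'w \<Rightarrow> real"
    using sigma_sets_vimage_commute[of X "space M" UNIV "sets borel"]
    by (simp add: sets.sigma_sets_eq[of borel, simplified])
  have "prob (A \<inter> D) = prob A * prob D"
    if A: "A \<in> sets (F s)" and D: "D \<in> {\<Delta> -` B \<inter> space M | B. B \<in> sets borel}" for A D
  proof -
    obtain A' where A': "A' \<in> sigma_sets (space M) (brownian_hist M W s)"
        "AE \<omega> in M. \<omega> \<in> A \<longleftrightarrow> \<omega> \<in> A'"
      using sets_F_AE_eq[OF A] .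
    have m: "A \<in> events" "A' \<in> events" "D \<in> events"
      using A A'(1) D sets_F_subset \<Delta> sets.sigma_sets_subset[OF brownian_hist_subset]
      by (auto intro: measurable_sets)
    have "prob (A \<inter> D) = prob (A' \<inter> D)"
      using A'(2) m by (intro finite_measure_eq_AE) auto
    also have "\<dots> = prob A' * prob D"
      by (rule indep_setD[OF ind A'(1) D])
    also have "prob A' = prob A"
      using A'(2) m by (intro finite_measure_eq_AE) auto
    finally show ?thesis .
  qed
  then have ind': "indep_set (sets (F s)) {\<Delta> -` B \<inter> space M | B. B \<in> sets borel}"
    using sets_F_subset \<Delta> unfolding indep_sets2_eq by (auto intro: measurable_sets)
  have "indep_set {Y -` A \<inter> space M |A. A \<in> sets borel} {\<Delta> -` B \<inter> space M | B. B \<in> sets borel}"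
    unfolding indep_set_def
    by (rule indep_sets_mono_sets[OF ind'[unfolded indep_set_def]])
       (use measurable_sets[OF assms(3)] in \<open>auto split: bool.split\<close>)
  then show ?thesis
    using F_measurable_M[OF assms(3)] \<Delta> unfolding \<Delta>_def[symmetric] indep_var_eq eq by simp
qed

lemma increment_moments:
  assumes "0 \<le> s" "s < t"
  defines "\<Delta> \<equiv> \<lambda>\<omega>. W t \<omega> - W s \<omega>"
  shows increment_measurable: "\<Delta> \<in> borel_measurable M"
    and increment_integrable: "integrable M \<Delta>" "integrable M (\<lambda>\<omega>. (\<Delta> \<omega>)\<^sup>2)"
    and increment_expectation: "expectation \<Delta> = 0" "expectation (\<lambda>\<omega>. (\<Delta> \<omega>)\<^sup>2) = t - s"
proof -
  show m: "\<Delta> \<in> borel_measurable M"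
    unfolding \<Delta>_def using assms by (intro borel_measurable_diff W_measurable) auto
  have \<sigma>: "0 < sqrt (t - s)"
    using assms by simp
  have D: "distributed M lborel \<Delta> (\<lambda>x. ennreal (normal_density 0 (sqrt (t - s)) x))"
    using brownian assms unfolding brownian_motion_def by auto
  show "integrable M \<Delta>"
    using distributed_integrable[OF D, of "\<lambda>x. x"] integrable_normal_moment_nz_1[OF \<sigma>, of 0] by simp
  show "integrable M (\<lambda>\<omega>. (\<Delta> \<omega>)\<^sup>2)"
    using distributed_integrable[OF D, of "\<lambda>x. x\<^sup>2"] integrable_normal_moment[OF \<sigma>, of 0 2] by simp
  show 0: "expectation \<Delta> = 0"
    by (rule normal_distributed_expectation[OF \<sigma> D])
  show "expectation (\<lambda>\<omega>. (\<Delta> \<omega>)\<^sup>2) = t - s"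
    using normal_distributed_variance[OF \<sigma> D] assms(2) unfolding 0 by simp
qed

text \<open>Independence gives the martingale property tested against \<open>Y\<close>, without
  conditional expectations. All later use of the law of \<open>W\<close> goes through this lemma and
  the next.\<close>

lemma expectation_times_increment:
  assumes "0 \<le> s" "s < t" "Y \<in> borel_measurable (F s)" "integrable M Y"
  shows "integrable M (\<lambda>\<omega>. Y \<omega> * (W t \<omega> - W s \<omega>))"
    and "expectation (\<lambda>\<omega>. Y \<omega> * (W t \<omega> - W s \<omega>)) = 0"
  using indep_var_integrable[OF indep_var_increment[OF assms(1-3)] assms(4) increment_integrable(1)[OF assms(1,2)]]
    indep_var_lebesgue_integral[OF indep_var_increment[OF assms(1-3)] assms(4) increment_integrable(1)[OF assms(1,2)]]
    increment_expectation(1)[OF assms(1,2)]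
  by simp_all

lemma expectation_times_increment_square:
  assumes "0 \<le> s" "s < t" "Y \<in> borel_measurable (F s)" "integrable M Y"
  shows "integrable M (\<lambda>\<omega>. Y \<omega> * (W t \<omega> - W s \<omega>)\<^sup>2)"
    and "expectation (\<lambda>\<omega>. Y \<omega> * (W t \<omega> - W s \<omega>)\<^sup>2) = expectation Y * (t - s)"
proof -
  have ind: "indep_var borel Y borel (\<lambda>\<omega>. (W t \<omega> - W s \<omega>)\<^sup>2)"
    using indep_var_compose[OF indep_var_increment[OF assms(1-3)], of "\<lambda>x. x" borel "\<lambda>x. x\<^sup>2" borel]
    by (simp add: comp_def)
  show "integrable M (\<lambda>\<omega>. Y \<omega> * (W t \<omega> - W s \<omega>)\<^sup>2)"
    by (rule indep_var_integrable[OF ind assms(4) increment_integrable(2)[OF assms(1,2)]])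
  show "expectation (\<lambda>\<omega>. Y \<omega> * (W t \<omega> - W s \<omega>)\<^sup>2) = expectation Y * (t - s)"
    using indep_var_lebesgue_integral[OF ind assms(4) increment_integrable(2)[OF assms(1,2)]]
      increment_expectation(2)[OF assms(1,2)] by simp
qed

end

section \<open>A discrete maximal inequality\<close>

text \<open>The induction carries the remainder \<open>s\<^sub>N x\<^sub>N - s\<^sub>N\<^sup>2 / 2\<close>; completing the square at the end
  gives Doob's constant 4.\<close>

lemma pathwise_doob:
  fixes x :: "nat \<Rightarrow> real"
  assumes "\<And>i. 0 \<le> x i"
  defines "s \<equiv> \<lambda>n. Max (x ` {..n})"
  shows "(s n)\<^sup>2 \<le> 4 * (x n)\<^sup>2 - 4 * (\<Sum>i<n. s i * (x (Suc i) - x i))"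
proof -
  have s_Suc: "s (Suc n) = max (x (Suc n)) (s n)" for n
    unfolding s_def atMost_Suc image_insert by (subst Max_insert) auto
  have "(s n)\<^sup>2 / 2 \<le> s n * x n - (\<Sum>i<n. s i * (x (Suc i) - x i))"
  proof (induction n)
    case 0
    then show ?case by (simp add: s_def power2_eq_square)
  next
    case (Suc n)
    \<comment> \<open>The maximum moves only when the new value attains it; then
      \<open>s (Suc n) = x (Suc n)\<close>, and the two sides differ by
      \<open>(x (Suc n) - s n)^2 / 2\<close>.\<close>
    have "((s (Suc n))\<^sup>2 - (s n)\<^sup>2) / 2 \<le> (s (Suc n) - s n) * x (Suc n)"
    proof (cases "x (Suc n) \<le> s n")
      case False
      have "0 \<le> (x (Suc n) - s n)\<^sup>2" by simp
      with False show ?thesis by (simp add: s_Suc power2_eq_square field_simps)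
    qed (simp add: s_Suc)
    then have "(s (Suc n))\<^sup>2 / 2 - (s n)\<^sup>2 / 2 \<le> s (Suc n) * x (Suc n) - s n * x (Suc n)"
      by (simp add: left_diff_distrib diff_divide_distrib)
    with Suc show ?case by (simp add: right_diff_distrib)
  qed
  moreover have "0 \<le> (s n - 2 * x n)\<^sup>2" by simp
  ultimately show ?thesis by (simp add: power2_eq_square algebra_simps)
qed

context brownian_space
begin

text \<open>The pathwise inequality is applied to \<open>\<bar>X j\<bar>\<close>. The sum of
  \<open>S i\<close> times the increments of \<open>\<bar>X\<bar>\<close> is at least a sum of
  increments of \<open>W\<close> with predictable factors \<open>Y i\<close>, whose expectation is
  zero; what remains is four times the isometry for \<open>X N\<close>.\<close>

lemma discrete_doob_ito:
  fixes N :: nat and tt :: "nat \<Rightarrow> real" and a :: "nat \<Rightarrow> 'w \<Rightarrow> real"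
  assumes tt0: "0 \<le> tt 0" and tt: "\<And>i. i < N \<Longrightarrow> tt i < tt (Suc i)"
    and aF: "\<And>i. i < N \<Longrightarrow> a i \<in> borel_measurable (F (tt i))"
    and aK: "\<And>i \<omega>. i < N \<Longrightarrow> \<omega> \<in> space M \<Longrightarrow> \<bar>a i \<omega>\<bar> \<le> K"
  defines "X \<equiv> \<lambda>j \<omega>. \<Sum>i<j. a i \<omega> * (W (tt (Suc i)) \<omega> - W (tt i) \<omega>)"
  shows "(\<integral>\<^sup>+\<omega>. ennreal ((Max ((\<lambda>j. \<bar>X j \<omega>\<bar>) ` {..N}))\<^sup>2) \<partial>M)
    \<le> 4 * (\<integral>\<^sup>+\<omega>. ennreal (\<Sum>i<N. (a i \<omega>)\<^sup>2 * (tt (Suc i) - tt i)) \<partial>M)"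
proof -
  define D where "D i \<omega> = W (tt (Suc i)) \<omega> - W (tt i) \<omega>" for i \<omega>
  have tt_mono: "tt i \<le> tt j" if "i \<le> j" "j \<le> N" for i j
    using that
  proof (induction j)
    case (Suc j)
    then show ?case using tt[of j] by (cases "i = Suc j") force+
  qed simp
  have tt_nonneg: "0 \<le> tt i" if "i \<le> N" for i
    using tt_mono[of 0 i] tt0 that by simp
  have X_Suc: "X (Suc j) \<omega> = X j \<omega> + a j \<omega> * D j \<omega>" for j \<omega>
    by (simp add: X_def D_def)
  have XF: "X i \<in> borel_measurable (F (tt j))" if "i \<le> j" "j \<le> N" for i j
    unfolding X_def
  proof (intro borel_measurable_sum borel_measurable_times borel_measurable_diff)
    fix l assume l: "l \<in> {..<i}"
    then show "a l \<in> borel_measurable (F (tt j))"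
      using that tt_mono[of l j] by (intro F_mono[OF _ aF]) auto
    show "W (tt (Suc l)) \<in> borel_measurable (F (tt j))" "W (tt l) \<in> borel_measurable (F (tt j))"
      using that l tt_mono[of "Suc l" j] tt_mono[of l j] by (auto intro!: W_measurable_F tt_nonneg)
  qed
  have aM: "a i \<in> borel_measurable M" if "i < N" for i
    using F_measurable_M[OF aF[OF that]] .
  have XM: "X i \<in> borel_measurable M" if "i \<le> N" for i
    using F_measurable_M[OF XF[OF order_refl that]] .
  have mult_a: "integrable M (\<lambda>\<omega>. f \<omega> * a i \<omega>)" if "integrable M f" "i < N" for f i
  proof (rule Bochner_Integration.integrable_bound)
    show "integrable M (\<lambda>\<omega>. K * f \<omega>)" using that by simp
    show "AE \<omega> in M. norm (f \<omega> * a i \<omega>) \<le> norm (K * f \<omega>)"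
    proof (rule AE_I2)
      fix \<omega> assume "\<omega> \<in> space M"
      from aK[OF that(2) this] have "\<bar>f \<omega>\<bar> * \<bar>a i \<omega>\<bar> \<le> \<bar>f \<omega>\<bar> * \<bar>K\<bar>"
        by (intro mult_left_mono) auto
      then show "norm (f \<omega> * a i \<omega>) \<le> norm (K * f \<omega>)" by (simp add: abs_mult mult.commute)
    qed
  qed (use that aM in auto)
  have a2: "integrable M (\<lambda>\<omega>. (a i \<omega>)\<^sup>2)" if "i < N" for i
    using mult_a[OF mult_a[of "\<lambda>_. 1", OF _ that] that] by (simp add: power2_eq_square)
  \<comment> \<open>Discrete isometry: in the square of \<open>X (Suc j)\<close> the mixed term is
    an increment times a factor known at \<open>tt j\<close>, so its expectation is zero.\<close>
  have X2: "integrable M (\<lambda>\<omega>. (X j \<omega>)\<^sup>2) \<and>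
      expectation (\<lambda>\<omega>. (X j \<omega>)\<^sup>2) = (\<Sum>i<j. expectation (\<lambda>\<omega>. (a i \<omega>)\<^sup>2) * (tt (Suc i) - tt i))"
    if "j \<le> N" for j
    using that
  proof (induction j)
    case 0
    then show ?case by (simp add: X_def)
  next
    case (Suc j)
    then have j: "j < N" "j \<le> N" by auto
    from Suc j have X2: "integrable M (\<lambda>\<omega>. (X j \<omega>)\<^sup>2)" by auto
    have X1: "integrable M (\<lambda>\<omega>. X j \<omega> * a j \<omega>)"
      by (rule mult_a[OF square_integrable_imp_integrable[OF XM[OF j(2)] X2] j(1)])
    note 1 = expectation_times_increment[OF tt_nonneg[OF j(2)] tt[OF j(1)] _ X1, folded D_def]
    note 2 = expectation_times_increment_square[OF tt_nonneg[OF j(2)] tt[OF j(1)] _ a2[OF j(1)], folded D_def]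
    have eq: "(X (Suc j) \<omega>)\<^sup>2 = (X j \<omega>)\<^sup>2 + 2 * (X j \<omega> * a j \<omega> * D j \<omega>) + (a j \<omega>)\<^sup>2 * (D j \<omega>)\<^sup>2" for \<omega>
      by (simp add: X_Suc power2_eq_square algebra_simps)
    show ?case
      unfolding eq using Suc j X2 1 2 aF XF by simp
  qed
  define S where "S j \<omega> = Max ((\<lambda>j. \<bar>X j \<omega>\<bar>) ` {..j})" for j \<omega>
  \<comment> \<open>The sign of \<open>X i\<close> is a subgradient of the absolute value there,
    which yields the inequality in the required direction; the value \<open>sgn 0 = 0\<close> is
    admissible.\<close>
  define Y where "Y i \<omega> = S i \<omega> * sgn (X i \<omega>) * a i \<omega>" for i \<omega>
  have S_nonneg: "0 \<le> S j \<omega>" for j \<omega>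
    unfolding S_def by (rule Max_ge_iff[THEN iffD2]) auto
  have S_le: "S j \<omega> \<le> (\<Sum>i\<le>j. \<bar>X i \<omega>\<bar>)" for j \<omega>
    unfolding S_def by (subst Max_le_iff) (auto intro!: member_le_sum)
  have YF: "Y i \<in> borel_measurable (F (tt i))" if "i < N" for i
    unfolding Y_def S_def using that aF XF[of _ i]
    by (intro borel_measurable_times borel_measurable_Max borel_measurable_sgn borel_measurable_abs) auto
  have Yint: "integrable M (Y i)" if "i < N" for i
    unfolding Y_def
  proof (intro mult_a that, rule Bochner_Integration.integrable_bound)
    show "integrable M (\<lambda>\<omega>. \<Sum>l\<le>i. \<bar>X l \<omega>\<bar>)"
      using that by (intro Bochner_Integration.integrable_sum integrable_abs
          square_integrable_imp_integrable[OF XM X2[THEN conjunct1]]) auto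
    show "(\<lambda>\<omega>. S i \<omega> * sgn (X i \<omega>)) \<in> borel_measurable M"
      unfolding S_def using that XM
      by (intro borel_measurable_times borel_measurable_Max borel_measurable_sgn borel_measurable_abs) auto
    show "AE \<omega> in M. norm (S i \<omega> * sgn (X i \<omega>)) \<le> norm (\<Sum>l\<le>i. \<bar>X l \<omega>\<bar>)"
      using S_le[of i] S_nonneg[of i]
      by (intro AE_I2) (auto simp: abs_mult abs_sgn_eq sum_nonneg)
  qed
  define R where "R \<omega> = 4 * (X N \<omega>)\<^sup>2 - 4 * (\<Sum>i<N. Y i \<omega> * D i \<omega>)" for \<omega>
  note Y1 = expectation_times_increment[OF tt_nonneg tt YF Yint, folded D_def]
  have path: "(S N \<omega>)\<^sup>2 \<le> R \<omega>" for \<omega>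
  proof -
    have "(\<Sum>i<N. Y i \<omega> * D i \<omega>) \<le> (\<Sum>i<N. S i \<omega> * (\<bar>X (Suc i) \<omega>\<bar> - \<bar>X i \<omega>\<bar>))"
    proof (rule sum_mono)
      fix i
      have "sgn (X i \<omega>) * (X (Suc i) \<omega> - X i \<omega>) \<le> \<bar>X (Suc i) \<omega>\<bar> - \<bar>X i \<omega>\<bar>"
        by (auto simp: sgn_real_def)
      from mult_left_mono[OF this S_nonneg[of i \<omega>]]
      show "Y i \<omega> * D i \<omega> \<le> S i \<omega> * (\<bar>X (Suc i) \<omega>\<bar> - \<bar>X i \<omega>\<bar>)"
        by (simp add: Y_def X_Suc algebra_simps)
    qed
    then show ?thesis
      using pathwise_doob[of "\<lambda>i. \<bar>X i \<omega>\<bar>" N] unfolding R_def S_def by simp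
  qed
  have Rint: "integrable M R"
    unfolding R_def using X2[of N] Y1(1) by (intro Bochner_Integration.integrable_diff) auto
  have "(\<integral>\<^sup>+\<omega>. ennreal ((S N \<omega>)\<^sup>2) \<partial>M) \<le> (\<integral>\<^sup>+\<omega>. ennreal (R \<omega>) \<partial>M)"
    by (intro nn_integral_mono ennreal_leI path)
  also have "\<dots> = ennreal (expectation R)"
    using path order_trans[OF zero_le_power2] by (intro nn_integral_eq_integral Rint AE_I2) blast
  also have "expectation R = 4 * expectation (\<lambda>\<omega>. (X N \<omega>)\<^sup>2) - 4 * (\<Sum>i<N. expectation (\<lambda>\<omega>. Y i \<omega> * D i \<omega>))"
    unfolding R_def using X2[of N] Y1(1)
    by (subst Bochner_Integration.integral_diff) (auto simp: Bochner_Integration.integral_sum)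
  also have "\<dots> = 4 * expectation (\<lambda>\<omega>. \<Sum>i<N. (a i \<omega>)\<^sup>2 * (tt (Suc i) - tt i))"
    using X2[of N] Y1(2) a2 by (simp add: Bochner_Integration.integral_sum)
  also have "ennreal \<dots> = 4 * ennreal (expectation (\<lambda>\<omega>. \<Sum>i<N. (a i \<omega>)\<^sup>2 * (tt (Suc i) - tt i)))"
    by (simp add: ennreal_mult')
  also have "\<dots> = 4 * (\<integral>\<^sup>+\<omega>. ennreal (\<Sum>i<N. (a i \<omega>)\<^sup>2 * (tt (Suc i) - tt i)) \<partial>M)"
    using a2 tt[THEN less_imp_le] by (subst nn_integral_eq_integral) (auto intro!: AE_I2 sum_nonneg)
  finally show ?thesis unfolding S_def .
qed

end

section \<open>Elementary integrals on a refining time grid\<close>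

text \<open>The point set \<open>P\<close> is prescribed, because one grid has to contain the jump
  times of two elementary processes, the times at which the level is checked and the times at which
  the integrals are compared.\<close>

definition time_grid :: "real \<Rightarrow> real set \<Rightarrow> nat \<Rightarrow> (nat \<Rightarrow> real) \<Rightarrow> bool" where
  "time_grid T P N tt \<longleftrightarrow> tt 0 = 0 \<and> tt N = T \<and> (\<forall>i<N. tt i < tt (Suc i)) \<and> tt ` {..N} = P"

lemma time_grid_exists:
  assumes "finite P" "P \<subseteq> {0..T}" "0 \<in> P" "T \<in> P"
  obtains N tt where "time_grid T P N tt"
proof -
  define xs where "xs = sorted_list_of_set P"
  have xs: "set xs = P" "sorted_wrt (<) xs"
    using assms(1) by (auto simp: xs_def)
  have nth_mono: "xs ! i < xs ! j" if "i < j" "j < length xs" for i j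
    using sorted_wrt_nth_less[OF xs(2) that] .
  have ne: "length xs \<noteq> 0"
    using xs(1) assms(3) by auto
  obtain i where i: "i < length xs" "xs ! i = 0"
    using assms(3) xs(1) by (metis in_set_conv_nth)
  obtain j where j: "j < length xs" "xs ! j = T"
    using assms(4) xs(1) by (metis in_set_conv_nth)
  have range: "0 \<le> xs ! k" "xs ! k \<le> T" if "k < length xs" for k
    using assms(2) xs(1) nth_mem[OF that] by auto
  have "xs ! 0 = 0"
    using nth_mono[of 0 i] i range[of 0] ne by (cases "i = 0") auto
  moreover have "xs ! (length xs - 1) = T"
  proof (cases "j = length xs - 1")
    case False
    then have "j < length xs - 1" using j by simp
    then show ?thesis using nth_mono[of j "length xs - 1"] j range[of "length xs - 1"] ne by simp
  qed (use j in simp)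
  moreover have "(!) xs ` {..length xs - 1} = P"
  proof -
    have "{..length xs - 1} = {..<length xs}" using ne by (cases "length xs") auto
    then show ?thesis using xs(1) by (auto simp: set_conv_nth)
  qed
  ultimately have "time_grid T P (length xs - 1) ((!) xs)"
    by (auto simp: time_grid_def intro: nth_mono)
  then show ?thesis by (rule that)
qed

locale grid =
  fixes T :: real and P :: "real set" and N :: nat and tt :: "nat \<Rightarrow> real"
  assumes grid: "time_grid T P N tt"
begin

lemma tt_0: "tt 0 = 0" and tt_N: "tt N = T" and tt_Suc: "i < N \<Longrightarrow> tt i < tt (Suc i)"
  and tt_image: "tt ` {..N} = P"
  using grid by (auto simp: time_grid_def)

lemma tt_strict_mono: "i < j \<Longrightarrow> j \<le> N \<Longrightarrow> tt i < tt j"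
proof (induction j)
  case (Suc j)
  then show ?case using tt_Suc[of j] by (cases "i = j") force+
qed simp

lemma tt_mono: "i \<le> j \<Longrightarrow> j \<le> N \<Longrightarrow> tt i \<le> tt j"
  using tt_strict_mono[of i j] by (cases "i = j") auto

lemma tt_nonneg: "i \<le> N \<Longrightarrow> 0 \<le> tt i"
  using tt_mono[of 0 i] tt_0 by simp

text \<open>No point of \<open>P\<close>, and none at or beyond \<open>T\<close>, lies strictly
  inside a cell. Cells are closed on the right, matching the left-continuous elementary
  processes.\<close>

lemma le_grid_iff:
  assumes "x \<in> P \<or> T \<le> x" "i < N" "s \<in> {tt i<..tt (Suc i)}"
  shows "s \<le> x \<longleftrightarrow> tt (Suc i) \<le> x"
proof
  assume sx: "s \<le> x"
  show "tt (Suc i) \<le> x"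
  proof (cases "T \<le> x")
    case True
    then show ?thesis using tt_mono[of "Suc i" N] assms(2) tt_N by simp
  next
    case False
    then obtain l where l: "x = tt l" "l \<le> N" using assms(1) tt_image by auto
    then have "\<not> l \<le> i" using tt_mono[of l i] assms sx by force
    then show ?thesis using tt_mono[of "Suc i" l] l by simp
  qed
qed (use assms in auto)

text \<open>The cells are disjoint, so at every \<open>s\<close> at most one summand is nonzero.
  Only monotonicity of the integral is applied to \<open>g\<close>, which carries no measurability
  assumption.\<close>

lemma sum_le_nn_integral:
  fixes c :: "nat \<Rightarrow> ennreal"
  assumes "\<And>i s. i < N \<Longrightarrow> s \<in> {tt i<..tt (Suc i)} \<Longrightarrow> c i \<le> g s"
  shows "(\<Sum>i<N. c i * ennreal (tt (Suc i) - tt i)) \<le> (\<integral>\<^sup>+s\<in>{0..T}. g s \<partial>lborel)"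
proof -
  have "(\<Sum>i<j. c i * indicator {tt i<..tt (Suc i)} s) \<le> g s * indicator {0..tt j} s" if "j \<le> N" for j s
    using that
  proof (induction j)
    case (Suc j)
    then have IH: "(\<Sum>i<j. c i * indicator {tt i<..tt (Suc i)} s) \<le> g s * indicator {0..tt j} s"
      by simp
    show ?case
    proof (cases "s \<in> {tt j<..tt (Suc j)}")
      case True
      then have "(\<Sum>i<j. c i * indicator {tt i<..tt (Suc i)} s) = 0"
        using IH by simp
      then show ?thesis
        using True assms[of j s] tt_nonneg[of j] Suc.prems by simp
    next
      case False
      have "g s * indicator {0..tt j} s \<le> g s * indicator {0..tt (Suc j)} s"
        using tt_Suc[of j] Suc.prems by (auto split: split_indicator)
      with IH False show ?thesis by (auto simp: indicator_def[of "{tt j<..tt (Suc j)}"])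
    qed
  qed simp
  from this[of N] have "(\<integral>\<^sup>+s. (\<Sum>i<N. c i * indicator {tt i<..tt (Suc i)} s) \<partial>lborel)
      \<le> (\<integral>\<^sup>+s\<in>{0..T}. g s \<partial>lborel)"
    by (intro nn_integral_mono) (simp add: tt_N)
  moreover have "(\<integral>\<^sup>+s. (\<Sum>i<N. c i * indicator {tt i<..tt (Suc i)} s) \<partial>lborel)
      = (\<Sum>i<N. c i * ennreal (tt (Suc i) - tt i))"
    using tt_Suc by (subst nn_integral_sum) (auto simp: nn_integral_cmult_indicator less_imp_le)
  ultimately show ?thesis by simp
qed

end

definition elementary_times :: "'w elementary \<Rightarrow> real set" where
  "elementary_times = (\<lambda>(n, \<tau>, h). \<tau> ` {..n})"

lemma finite_elementary_times: "finite (elementary_times G)"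
  by (simp add: elementary_times_def split: prod.split)

lemma elementary_process_times_nonneg:
  assumes "elementary_process M F (n, \<tau>, h)" "i \<le> n"
  shows "0 \<le> \<tau> i"
  using assms(2)
proof (induction i)
  case 0
  then show ?case using assms(1) by (simp add: elementary_process_def)
next
  case (Suc i)
  moreover have "\<tau> i \<le> \<tau> (Suc i)"
    using assms(1) Suc.prems by (simp add: elementary_process_def)
  ultimately show ?case by simp
qed

lemma elementary_val_bounded:
  assumes "elementary_process M F G"
  shows "\<exists>K. \<forall>t. \<forall>\<omega>\<in>space M. \<bar>elementary_val G t \<omega>\<bar> \<le> K"
proof -
  obtain n \<tau> h where G: "G = (n, \<tau>, h)" by (cases G)
  have "\<exists>K. \<forall>\<omega>\<in>space M. \<bar>h i \<omega>\<bar> \<le> K" if "i < n" for i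
    using assms that by (auto simp: G elementary_process_def)
  then obtain K where K: "\<And>i \<omega>. i < n \<Longrightarrow> \<omega> \<in> space M \<Longrightarrow> \<bar>h i \<omega>\<bar> \<le> K i"
    by metis
  have "\<bar>elementary_val G t \<omega>\<bar> \<le> (\<Sum>i<n. K i)" if "\<omega> \<in> space M" for t \<omega>
  proof -
    have "\<bar>elementary_val G t \<omega>\<bar> \<le> (\<Sum>i<n. \<bar>h i \<omega> * indicator {\<tau> i<..\<tau> (Suc i)} t\<bar>)"
      unfolding G elementary_val_def prod.case by (rule sum_abs)
    also have "\<dots> \<le> (\<Sum>i<n. K i)"
    proof (rule sum_mono)
      fix i assume "i \<in> {..<n}"
      then have "\<bar>h i \<omega>\<bar> \<le> K i" using K that by simp
      moreover from this have "0 \<le> K i" by linarith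
      ultimately show "\<bar>h i \<omega> * indicator {\<tau> i<..\<tau> (Suc i)} t\<bar> \<le> K i"
        by (auto split: split_indicator)
    qed
    finally show ?thesis .
  qed
  then show ?thesis by blast
qed

text \<open>Only jump times in \<open>{0..T}\<close> have to be grid points. A later one lies to the
  right of every cell, which is the alternative \<open>T \<le> \<tau> i\<close> in the lemma
  below.\<close>

locale elementary_grid = brownian_space + grid +
  fixes G :: "'a elementary"
  assumes elementary: "elementary_process M (brownian_filtration M W) G"
    and times: "elementary_times G \<inter> {0..T} \<subseteq> P"
begin

lemma elementary_components:
  obtains n \<tau> h where "G = (n, \<tau>, h)"
    "\<And>i. i \<le> n \<Longrightarrow> 0 \<le> \<tau> i" "\<And>i. i \<le> n \<Longrightarrow> \<tau> i \<in> P \<or> T \<le> \<tau> i"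
    "\<And>i. i < n \<Longrightarrow> \<tau> i \<le> \<tau> (Suc i)" "\<And>i. i < n \<Longrightarrow> h i \<in> borel_measurable (F (\<tau> i))"
proof -
  obtain n \<tau> h where G: "G = (n, \<tau>, h)" by (cases G)
  have mono: "\<And>i. i < n \<Longrightarrow> \<tau> i \<le> \<tau> (Suc i)"
    and m: "\<And>i. i < n \<Longrightarrow> h i \<in> borel_measurable (F (\<tau> i))"
    using elementary by (auto simp: G elementary_process_def)
  note nonneg = elementary_process_times_nonneg[OF elementary[unfolded G]]
  have "\<tau> i \<in> P \<or> T \<le> \<tau> i" if "i \<le> n" for i
    using times nonneg[OF that] that by (force simp: elementary_times_def G)
  with nonneg mono m show ?thesis by (intro that[OF G])
qed

lemma elementary_val_const:
  assumes "i < N" "s \<in> {tt i<..tt (Suc i)}"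
  shows "elementary_val G s \<omega> = elementary_val G (tt (Suc i)) \<omega>"
proof -
  obtain n \<tau> h where G: "G = (n, \<tau>, h)" and P: "\<And>i. i \<le> n \<Longrightarrow> \<tau> i \<in> P \<or> T \<le> \<tau> i"
    by (rule elementary_components) blast
  have "(s \<in> {\<tau> l<..\<tau> (Suc l)}) = (tt (Suc i) \<in> {\<tau> l<..\<tau> (Suc l)})" if "l < n" for l
    using le_grid_iff[OF P[of l] assms] le_grid_iff[OF P[of "Suc l"] assms] that by auto
  then show ?thesis
    by (auto simp: G elementary_val_def indicator_def intro!: sum.cong)
qed

text \<open>If the interval from \<open>\<tau> l\<close> to \<open>\<tau> (Suc l)\<close> contains
  \<open>tt (Suc i)\<close>, then \<open>\<tau> l\<close> is a grid point before it, hence at most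
  \<open>tt i\<close>, and \<open>h l\<close> is known at \<open>tt i\<close>.\<close>

lemma elementary_val_predictable:
  assumes "i < N"
  shows "elementary_val G (tt (Suc i)) \<in> borel_measurable (F (tt i))"
proof -
  obtain n \<tau> h where G: "G = (n, \<tau>, h)" and P: "\<And>i. i \<le> n \<Longrightarrow> \<tau> i \<in> P \<or> T \<le> \<tau> i"
    and m: "\<And>i. i < n \<Longrightarrow> h i \<in> borel_measurable (F (\<tau> i))"
    by (rule elementary_components) blast
  have "(\<lambda>\<omega>. h l \<omega> * indicator {\<tau> l<..\<tau> (Suc l)} (tt (Suc i))) \<in> borel_measurable (F (tt i))"
    if l: "l < n" for l
  proof (cases "tt (Suc i) \<in> {\<tau> l<..\<tau> (Suc l)}")
    case True
    have "tt i < tt (Suc i)" using tt_Suc[OF assms] .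
    \<comment> \<open>Were \<open>tt i < \<tau> l\<close>, the minimum below would be a point of the
      cell that is at most \<open>\<tau> l\<close>, which would force
      \<open>tt (Suc i) \<le> \<tau> l\<close>.\<close>
    then have "\<tau> l \<le> tt i"
      using le_grid_iff[OF P[of l] assms, of "min (tt (Suc i)) (\<tau> l)"] True l
      by (cases "tt i < \<tau> l") auto
    then have "h l \<in> borel_measurable (F (tt i))"
      by (rule F_mono[OF _ m[OF l]])
    then show ?thesis by simp
  qed simp
  then show ?thesis
    unfolding G elementary_val_def prod.case by (intro borel_measurable_sum) auto
qed

text \<open>Each stopped value of \<open>W\<close> telescopes over the cells to the left of the
  stopping point; in the difference for \<open>\<tau> l\<close> and \<open>\<tau> (Suc l)\<close>
  exactly the cells between the two are left. The value \<open>W 0\<close>, zero only almost surely,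
  cancels.\<close>

lemma elementary_int_eq:
  assumes "j \<le> N"
  shows "elementary_int W G (tt j) \<omega> =
    (\<Sum>i<j. elementary_val G (tt (Suc i)) \<omega> * (W (tt (Suc i)) \<omega> - W (tt i) \<omega>))"
proof -
  obtain n \<tau> h where G: "G = (n, \<tau>, h)" and P: "\<And>i. i \<le> n \<Longrightarrow> \<tau> i \<in> P \<or> T \<le> \<tau> i"
    and nonneg: "\<And>i. i \<le> n \<Longrightarrow> 0 \<le> \<tau> i" and mono: "\<And>i. i < n \<Longrightarrow> \<tau> i \<le> \<tau> (Suc i)"
    by (rule elementary_components) blast
  define D where "D i = W (tt (Suc i)) \<omega> - W (tt i) \<omega>" for i
  have W_min: "W (min (tt j) x) \<omega> - W 0 \<omega> = (\<Sum>i<j. of_bool (tt (Suc i) \<le> x) * D i)"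
    if "x \<in> P \<or> T \<le> x" "0 \<le> x" "j \<le> N" for x j
    using that(3)
  proof (induction j)
    case 0
    then show ?case using that(2) by (simp add: tt_0)
  next
    case (Suc j)
    have j: "tt j < tt (Suc j)" "j < N" using tt_Suc[of j] Suc.prems by auto
    show ?case
    proof (cases "tt (Suc j) \<le> x")
      case True
      then show ?thesis using Suc j by (simp add: D_def)
    next
      case False
      then have "x \<le> tt j"
        using le_grid_iff[OF that(1) j(2), of "min x (tt (Suc j))"] by (cases "x \<le> tt j") auto
      then show ?thesis using Suc j False by simp
    qed
  qed
  have "h l \<omega> * (W (min (tt j) (\<tau> (Suc l))) \<omega> - W (min (tt j) (\<tau> l)) \<omega>) =
      (\<Sum>i<j. h l \<omega> * indicator {\<tau> l<..\<tau> (Suc l)} (tt (Suc i)) * D i)" if l: "l < n" for l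
  proof -
    have "W (min (tt j) (\<tau> (Suc l))) \<omega> - W (min (tt j) (\<tau> l)) \<omega> =
        (\<Sum>i<j. (of_bool (tt (Suc i) \<le> \<tau> (Suc l)) - of_bool (tt (Suc i) \<le> \<tau> l)) * D i)"
      using W_min[OF P nonneg assms, of "Suc l"] W_min[OF P nonneg assms, of l] l
      by (simp add: left_diff_distrib sum_subtractf)
    also have "\<dots> = (\<Sum>i<j. indicator {\<tau> l<..\<tau> (Suc l)} (tt (Suc i)) * D i)"
      using mono[OF l] by (intro sum.cong) (auto simp: indicator_def)
    finally show ?thesis by (simp only: sum_distrib_left mult.assoc)
  qed
  then have "elementary_int W G (tt j) \<omega> =
      (\<Sum>l<n. \<Sum>i<j. h l \<omega> * indicator {\<tau> l<..\<tau> (Suc l)} (tt (Suc i)) * D i)"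
    unfolding G elementary_int_def prod.case by (intro sum.cong) auto
  also have "\<dots> = (\<Sum>i<j. elementary_val G (tt (Suc i)) \<omega> * D i)"
    unfolding G elementary_val_def prod.case by (subst sum.swap) (simp only: sum_distrib_right)
  finally show ?thesis by (simp add: D_def)
qed

end

context brownian_space
begin

text \<open>The coefficients are switched off at the first grid time at which a checked value of \<open>Y\<close>
  exceeds \<open>K\<close> or the accumulated square integral exceeds \<open>L\<close>; the latter includes the interval
  that is about to be added, so that it cannot overshoot.\<close>

lemma localized_elementary_doob:
  fixes G1 G2 :: "'w elementary" and Y :: "real \<Rightarrow> 'w \<Rightarrow> real"
  assumes el: "elementary_process M F G1" "elementary_process M F G2"
    and Y: "\<And>r. 0 \<le> r \<Longrightarrow> Y r \<in> borel_measurable (F r)"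
    and R: "finite R" "R \<subseteq> {0..}" and Q: "finite Q" "Q \<subseteq> {0..T}" and T: "0 \<le> T" and L: "0 \<le> L"
  defines "V \<equiv> \<lambda>s \<omega>. elementary_val G1 s \<omega> - elementary_val G2 s \<omega>"
  obtains \<Lambda> \<Phi> :: "'w \<Rightarrow> ennreal" where
    "\<Lambda> \<in> borel_measurable M" "\<Phi> \<in> borel_measurable M"
    "(\<integral>\<^sup>+\<omega>. \<Lambda> \<omega> \<partial>M) \<le> 4 * (\<integral>\<^sup>+\<omega>. \<Phi> \<omega> \<partial>M)"
    "\<And>\<omega>. \<Phi> \<omega> \<le> ennreal L"
    "\<And>\<omega>. \<Phi> \<omega> \<le>
      (\<integral>\<^sup>+s\<in>{0..T}. ennreal ((V s \<omega>)\<^sup>2) * of_bool (\<forall>r\<in>R. r < s \<longrightarrow> Y r \<omega> \<le> K) \<partial>lborel)"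
    "\<And>\<omega> t. t \<in> Q \<Longrightarrow> \<forall>r\<in>R. r < t \<longrightarrow> Y r \<omega> \<le> K \<Longrightarrow>
      (\<integral>\<^sup>+s\<in>{0..T}. ennreal ((V s \<omega>)\<^sup>2) \<partial>lborel) \<le> ennreal L \<Longrightarrow>
      ennreal ((elementary_int W G1 t \<omega> - elementary_int W G2 t \<omega>)\<^sup>2) \<le> \<Lambda> \<omega>"
proof -
  \<comment> \<open>All relevant times become grid points. Times beyond \<open>T\<close> may be
    dropped, since they separate no two points of a cell.\<close>
  define P where "P = insert 0 (insert T (Q \<union> (R \<union> elementary_times G1 \<union> elementary_times G2) \<inter> {0..T}))"
  have "finite P" "P \<subseteq> {0..T}" "0 \<in> P" "T \<in> P"
    using Q R T by (auto simp: P_def finite_elementary_times)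
  then obtain N tt where grid: "time_grid T P N tt"
    by (rule time_grid_exists)
  interpret grid T P N tt by (unfold_locales) (rule grid)
  interpret G1: elementary_grid M W T P N tt G1
    by (unfold_locales) (use el in \<open>auto simp: P_def\<close>)
  interpret G2: elementary_grid M W T P N tt G2
    by (unfold_locales) (use el in \<open>auto simp: P_def\<close>)
  define v where "v i = V (tt (Suc i))" for i
  define D where "D i = tt (Suc i) - tt i" for i
  define q where "q i \<omega> = (\<Sum>k<i. (v k \<omega>)\<^sup>2 * D k)" for i \<omega>
  \<comment> \<open>\<open>A i\<close> is decided at \<open>tt i\<close>: the checks reach up to the
    left end of the cell, and \<open>q (Suc i)\<close>, although it covers the cell itself, involves
    only the predictable values \<open>v\<close>.\<close>
  define A where "A i \<omega> \<longleftrightarrow> (\<forall>r\<in>R. r \<le> tt i \<longrightarrow> Y r \<omega> \<le> K) \<and> q (Suc i) \<omega> \<le> L" for i \<omega>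
  define a where "a i \<omega> = (if A i \<omega> then v i \<omega> else 0)" for i \<omega>
  define X where "X j \<omega> = (\<Sum>i<j. a i \<omega> * (W (tt (Suc i)) \<omega> - W (tt i) \<omega>))" for j \<omega>
  define \<Lambda> where "\<Lambda> \<omega> = ennreal ((Max ((\<lambda>j. \<bar>X j \<omega>\<bar>) ` {..N}))\<^sup>2)" for \<omega>
  define \<Phi> where "\<Phi> \<omega> = ennreal (\<Sum>i<N. (a i \<omega>)\<^sup>2 * D i)" for \<omega>
  have D: "0 \<le> D i" if "i < N" for i
    using tt_Suc[OF that] by (simp add: D_def)
  have V_eq: "V s \<omega> = v i \<omega>" if "i < N" "s \<in> {tt i<..tt (Suc i)}" for i s \<omega>
    using G1.elementary_val_const[OF that] G2.elementary_val_const[OF that] by (simp add: V_def v_def)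
  have vF: "v i \<in> borel_measurable (F (tt i))" if "i < N" for i
    unfolding v_def V_def using that
    by (intro borel_measurable_diff G1.elementary_val_predictable G2.elementary_val_predictable)
  have qF: "q (Suc i) \<in> borel_measurable (F (tt i))" if "i < N" for i
    unfolding q_def
    by (intro borel_measurable_sum borel_measurable_times borel_measurable_power borel_measurable_const
        F_mono[OF _ vF]) (use that tt_mono[of _ i] in auto)
  have aF: "a i \<in> borel_measurable (F (tt i))" if "i < N" for i
  proof -
    have *: "R \<inter> {..tt i} \<subseteq> {0..tt i}" "finite (R \<inter> {..tt i})"
      using R by auto
    have "Measurable.pred (F (tt i)) (\<lambda>\<omega>. Y r \<omega> \<le> K)" if "r \<in> R \<inter> {..tt i}" for r
    proof -
      have [measurable]: "Y r \<in> borel_measurable (F (tt i))"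
        using that *(1) F_mono[OF _ Y, of r "tt i"] by auto
      show ?thesis by measurable
    qed
    then have "Measurable.pred (F (tt i)) (\<lambda>\<omega>. \<forall>r\<in>R \<inter> {..tt i}. Y r \<omega> \<le> K)"
      using *(2) by (intro pred_intros_finite(3)) auto
    moreover have "Measurable.pred (F (tt i)) (\<lambda>\<omega>. q (Suc i) \<omega> \<le> L)"
      using qF[OF that] by measurable
    ultimately have "Measurable.pred (F (tt i)) (A i)"
      unfolding A_def by (auto simp: Ball_def imp_conjL)
    then show ?thesis
      unfolding a_def using vF[OF that] by (intro measurable_If) (auto simp: pred_def)
  qed
  obtain K1 K2 where K: "\<And>s \<omega>. \<omega> \<in> space M \<Longrightarrow> \<bar>elementary_val G1 s \<omega>\<bar> \<le> K1"
    "\<And>s \<omega>. \<omega> \<in> space M \<Longrightarrow> \<bar>elementary_val G2 s \<omega>\<bar> \<le> K2"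
    using elementary_val_bounded[OF el(1)] elementary_val_bounded[OF el(2)] by blast
  have aK: "\<bar>a i \<omega>\<bar> \<le> K1 + K2" if "\<omega> \<in> space M" for i \<omega>
    using K(1)[OF that, of "tt (Suc i)"] K(2)[OF that, of "tt (Suc i)"]
    by (auto simp: a_def v_def V_def)
  have WM: "W (tt i) \<in> borel_measurable M" if "i \<le> N" for i
    using tt_nonneg[OF that] by (rule W_measurable)
  have aM: "a i \<in> borel_measurable M" if "i < N" for i
    using F_measurable_M[OF aF[OF that]] .
  show ?thesis
  proof
    show "\<Lambda> \<in> borel_measurable M"
      unfolding \<Lambda>_def X_def
      by (intro measurable_compose[OF _ measurable_ennreal] borel_measurable_power borel_measurable_Max
          borel_measurable_abs borel_measurable_sum borel_measurable_times borel_measurable_diff)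
         (auto intro!: aM WM)
    show "\<Phi> \<in> borel_measurable M"
      unfolding \<Phi>_def
      by (intro measurable_compose[OF _ measurable_ennreal] borel_measurable_sum borel_measurable_times
          borel_measurable_power) (auto intro!: aM)
    show "(\<integral>\<^sup>+\<omega>. \<Lambda> \<omega> \<partial>M) \<le> 4 * (\<integral>\<^sup>+\<omega>. \<Phi> \<omega> \<partial>M)"
      unfolding \<Lambda>_def \<Phi>_def X_def D_def
      by (rule discrete_doob_ito[where K = "K1 + K2"]) (auto simp: tt_0 tt_Suc aF aK)
  next
    fix \<omega>
    \<comment> \<open>When cell \<open>j\<close> is switched on, the whole sum so far is at most
      \<open>q (Suc j)\<close>, which \<open>A j\<close> bounds by \<open>L\<close>; otherwise the
      sum does not grow.\<close>
    have "(\<Sum>i<j. (a i \<omega>)\<^sup>2 * D i) \<le> L" if "j \<le> N" for j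
      using that
    proof (induction j)
      case (Suc j)
      show ?case
      proof (cases "A j \<omega>")
        case True
        have "(\<Sum>i<Suc j. (a i \<omega>)\<^sup>2 * D i) \<le> q (Suc j) \<omega>"
          unfolding q_def using Suc.prems D
          by (intro sum_mono mult_right_mono) (auto simp: a_def)
        then show ?thesis using True by (simp add: A_def)
      qed (use Suc in \<open>simp add: a_def\<close>)
    qed (simp add: L)
    then show "\<Phi> \<omega> \<le> ennreal L"
      unfolding \<Phi>_def by (intro ennreal_leI) auto
    have "\<Phi> \<omega> = (\<Sum>i<N. ennreal ((a i \<omega>)\<^sup>2) * ennreal (tt (Suc i) - tt i))"
      unfolding \<Phi>_def using D by (subst sum_ennreal[symmetric]) (auto simp: ennreal_mult D_def)
    also have "\<dots> \<le> (\<integral>\<^sup>+s\<in>{0..T}. ennreal ((V s \<omega>)\<^sup>2) * of_bool (\<forall>r\<in>R. r < s \<longrightarrow> Y r \<omega> \<le> K) \<partial>lborel)"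
    proof (rule sum_le_nn_integral)
      fix i s assume i: "i < N" "s \<in> {tt i<..tt (Suc i)}"
      show "ennreal ((a i \<omega>)\<^sup>2) \<le> ennreal ((V s \<omega>)\<^sup>2) * of_bool (\<forall>r\<in>R. r < s \<longrightarrow> Y r \<omega> \<le> K)"
      proof (cases "A i \<omega>")
        case True
        \<comment> \<open>A check time before \<open>s\<close> is not inside the cell, so it lies at
          or before the left end, where \<open>A i\<close> covers it.\<close>
        have "\<forall>r\<in>R. r < s \<longrightarrow> Y r \<omega> \<le> K"
        proof (intro ballI impI)
          fix r assume "r \<in> R" "r < s"
          moreover from this have "r \<in> P \<or> T \<le> r" using R by (auto simp: P_def)
          ultimately have "r \<le> tt i"
            using le_grid_iff[of r i r] i by force
          then show "Y r \<omega> \<le> K" using True \<open>r \<in> R\<close> by (simp add: A_def)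
        qed
        then show ?thesis using True by (simp add: a_def V_eq[OF i])
      qed (simp add: a_def)
    qed
    finally show "\<Phi> \<omega> \<le>
      (\<integral>\<^sup>+s\<in>{0..T}. ennreal ((V s \<omega>)\<^sup>2) * of_bool (\<forall>r\<in>R. r < s \<longrightarrow> Y r \<omega> \<le> K) \<partial>lborel)" .
  next
    fix \<omega> t
    assume t: "t \<in> Q" and Yt: "\<forall>r\<in>R. r < t \<longrightarrow> Y r \<omega> \<le> K"
      and VL: "(\<integral>\<^sup>+s\<in>{0..T}. ennreal ((V s \<omega>)\<^sup>2) \<partial>lborel) \<le> ennreal L"
    obtain j where j: "t = tt j" "j \<le> N"
      using tt_image t by (auto simp: P_def)
    have "ennreal (q N \<omega>) = (\<Sum>i<N. ennreal ((v i \<omega>)\<^sup>2) * ennreal (tt (Suc i) - tt i))"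
      unfolding q_def using D by (subst sum_ennreal[symmetric]) (auto simp: ennreal_mult D_def)
    also have "\<dots> \<le> (\<integral>\<^sup>+s\<in>{0..T}. ennreal ((V s \<omega>)\<^sup>2) \<partial>lborel)"
      by (intro sum_le_nn_integral) (simp add: V_eq)
    also note VL
    finally have qN: "q N \<omega> \<le> L"
      using L by simp
    \<comment> \<open>Along such a path nothing has been switched off before \<open>t\<close>: since
      \<open>tt i < tt j\<close>, the checks strictly before \<open>t\<close> include those of
      \<open>A i\<close>.\<close>
    have "a i \<omega> = v i \<omega>" if "i < j" for i
    proof -
      have "q (Suc i) \<omega> \<le> q N \<omega>"
        unfolding q_def using that j D by (intro sum_mono2) auto
      moreover have "\<forall>r\<in>R. r \<le> tt i \<longrightarrow> Y r \<omega> \<le> K"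
        using Yt tt_strict_mono[OF that j(2)] by (auto simp: j)
      ultimately show ?thesis
        using qN by (auto simp: a_def A_def)
    qed
    then have "X j \<omega> = elementary_int W G1 t \<omega> - elementary_int W G2 t \<omega>"
      by (simp add: X_def j G1.elementary_int_eq G2.elementary_int_eq v_def V_def
          left_diff_distrib sum_subtractf)
    moreover have "\<bar>X j \<omega>\<bar> \<le> Max ((\<lambda>j. \<bar>X j \<omega>\<bar>) ` {..N})"
      using j by (intro Max_ge) auto
    ultimately show "ennreal ((elementary_int W G1 t \<omega> - elementary_int W G2 t \<omega>)\<^sup>2) \<le> \<Lambda> \<omega>"
      unfolding \<Lambda>_def by (intro ennreal_leI) (metis abs_le_square_iff abs_of_nonneg abs_ge_zero order_trans)
  qed
qed

end

section \<open>Localized maximal inequality for the stochastic integral\<close>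

text \<open>The enumeration lets the checks be made at finitely many times, those with index at most
  \<open>k\<close>, before \<open>k\<close> tends to infinity.\<close>

definition nonneg_rat :: "nat \<Rightarrow> real" where
  "nonneg_rat i = \<bar>of_rat (nat_to_rat_surj i)\<bar>"

lemma nonneg_rat_nonneg [simp]: "0 \<le> nonneg_rat i"
  by (simp add: nonneg_rat_def)

lemma range_nonneg_rat: "range nonneg_rat = \<rat> \<inter> {0..}"
proof (intro equalityI subsetI)
  fix x :: real assume "x \<in> \<rat> \<inter> {0..}"
  then obtain q where "x = of_rat q" "0 \<le> x" by (auto simp: Rats_def)
  then have "x = \<bar>of_rat q\<bar>" by simp
  moreover obtain i where "q = nat_to_rat_surj i"
    using surj_nat_to_rat_surj by (auto simp: surj_def)
  ultimately show "x \<in> range nonneg_rat" by (auto simp: nonneg_rat_def)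
qed (auto simp: nonneg_rat_def)

lemma countable_Rats_Int: "countable (\<rat> \<inter> A)" for A :: "real set"
  by (rule countable_subset[OF _ countable_rat]) simp

lemma rational_sequence:
  fixes t T :: real
  assumes "t \<in> {0..T}" "0 < T"
  obtains x where "\<And>n. x n \<in> \<rat> \<inter> {0..T}" "x \<longlonglongrightarrow> t"
proof -
  have "closure ({0..T} \<inter> \<rat>) = {0..T}"
    using assms(2) by (subst closure_convex_Int_superset) (auto simp: Rats_closure_real)
  then show ?thesis
    using assms(1) that closure_sequential[of t "{0..T} \<inter> \<rat>"] by auto
qed

text \<open>The approach is strictly from the left because \<open>stays_below\<close> at time
  \<open>t\<close> controls only earlier times.\<close>

lemma rational_sequence_less:
  fixes t :: real
  assumes "0 < t"
  obtains x where "\<And>n. x n \<in> \<rat> \<inter> {0..<t}" "x \<longlonglongrightarrow> t"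
proof -
  have "closure ({0..<t} \<inter> \<rat>) = {0..t}"
    using assms by (subst closure_convex_Int_superset) (auto simp: Rats_closure_real)
  then show ?thesis
    using assms that closure_sequential[of t "{0..<t} \<inter> \<rat>"] by auto
qed

text \<open>By continuity every value is a limit of values at rational times. The countable supremum
  is the one whose measurability is clear.\<close>

lemma SUP_rats_eq:
  fixes f :: "real \<Rightarrow> real"
  assumes "0 < T" "continuous_on {0..T} f"
  shows "(SUP t\<in>{0..T}. ennreal (f t)) = (SUP t\<in>\<rat> \<inter> {0..T}. ennreal (f t))"
proof (rule antisym)
  show "(SUP t\<in>{0..T}. ennreal (f t)) \<le> (SUP t\<in>\<rat> \<inter> {0..T}. ennreal (f t))"
  proof (rule SUP_least)
    fix t assume t: "t \<in> {0..T}"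
    obtain x where x: "\<And>n. x n \<in> \<rat> \<inter> {0..T}" "x \<longlonglongrightarrow> t"
      using rational_sequence[OF t assms(1)] by blast
    then have "(\<lambda>n. f (x n)) \<longlonglongrightarrow> f t"
      by (intro continuous_on_tendsto_compose[OF assms(2) x(2) t]) auto
    then have "(\<lambda>n. ennreal (f (x n))) \<longlonglongrightarrow> ennreal (f t)"
      by (rule tendsto_ennrealI)
    then show "ennreal (f t) \<le> (SUP t\<in>\<rat> \<inter> {0..T}. ennreal (f t))"
      by (rule LIMSEQ_le_const2) (intro exI[of _ 0] allI impI SUP_upper x(1))
  qed
qed (rule SUP_subset_mono, auto)

text \<open>Choose \<open>r k\<close> such that every \<open>u j (r k)\<close> exceeds
  \<open>(1/2) ^ k\<close> with probability below \<open>(1/2) ^ k\<close>; Borel--Cantelli does the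
  rest. Finiteness of \<open>J\<close> allows one choice for all \<open>j\<close>. The map
  \<open>r\<close> is not claimed to be increasing, since only the limits along it are used.\<close>

lemma (in prob_space) tendsto_zero_in_prob_AE_subseq:
  fixes u :: "'j \<Rightarrow> nat \<Rightarrow> 'a \<Rightarrow> ennreal"
  assumes "finite J" "\<And>j. j \<in> J \<Longrightarrow> tendsto_zero_in_prob M (u j)"
    and meas: "\<And>j m \<epsilon>. j \<in> J \<Longrightarrow> 0 < \<epsilon> \<Longrightarrow> {\<omega> \<in> space M. ennreal \<epsilon> < u j m \<omega>} \<in> sets M"
  obtains r where "AE \<omega> in M. \<forall>j\<in>J. (\<lambda>k. u j (r k) \<omega>) \<longlonglongrightarrow> 0"
proof -
  have "\<exists>m. \<forall>j\<in>J. prob {\<omega> \<in> space M. ennreal ((1/2) ^ k) < u j m \<omega>} < (1/2) ^ k" for k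
  proof -
    have "\<forall>\<^sub>F m in sequentially. \<forall>j\<in>J. prob {\<omega> \<in> space M. ennreal ((1/2) ^ k) < u j m \<omega>} < (1/2) ^ k"
    proof (intro eventually_ball_finite assms(1) ballI)
      fix j assume "j \<in> J"
      then have "(\<lambda>m. prob {\<omega> \<in> space M. ennreal ((1/2) ^ k) < u j m \<omega>}) \<longlonglongrightarrow> 0"
        using assms(2) by (simp add: tendsto_zero_in_prob_def)
      then show "\<forall>\<^sub>F m in sequentially. prob {\<omega> \<in> space M. ennreal ((1/2) ^ k) < u j m \<omega>} < (1/2) ^ k"
        by (rule order_tendstoD) simp
    qed
    then show ?thesis by (auto simp: eventually_sequentially)
  qed
  then obtain r where r: "\<And>k j. j \<in> J \<Longrightarrow> prob {\<omega> \<in> space M. ennreal ((1/2) ^ k) < u j (r k) \<omega>} < (1/2) ^ k"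
    by metis
  have "AE \<omega> in M. (\<lambda>k. u j (r k) \<omega>) \<longlonglongrightarrow> 0" if "j \<in> J" for j
  proof -
    have "AE \<omega> in M. \<forall>\<^sub>F k in sequentially. \<omega> \<in> space M - {\<omega> \<in> space M. ennreal ((1/2) ^ k) < u j (r k) \<omega>}"
    proof (rule borel_cantelli_AE1)
      show "summable (\<lambda>k. prob {\<omega> \<in> space M. ennreal ((1/2) ^ k) < u j (r k) \<omega>})"
        using r[OF that, THEN less_imp_le]
        by (intro summable_comparison_test_ev[OF _ summable_geometric[of "1/2 :: real"]] always_eventually) auto
    qed (use that meas in \<open>auto simp: less_top[symmetric]\<close>)
    then show ?thesis
    proof eventually_elim
      case (elim \<omega>)
      then have "\<forall>\<^sub>F k in sequentially. u j (r k) \<omega> \<le> ennreal ((1/2) ^ k)"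
        by (auto elim!: eventually_mono simp: not_less)
      moreover have "(\<lambda>k. ennreal ((1/2) ^ k)) \<longlonglongrightarrow> 0"
        using LIMSEQ_realpow_zero[of "1/2"] by (subst ennreal_tendsto_0_iff) auto
      ultimately show ?case
        by (rule tendsto_sandwich[OF always_eventually _ tendsto_const, rotated]) auto
    qed
  qed
  then have "AE \<omega> in M. \<forall>j\<in>J. (\<lambda>k. u j (r k) \<omega>) \<longlonglongrightarrow> 0"
    using assms(1) by (simp add: AE_finite_all)
  then show ?thesis by (rule that)
qed

text \<open>This is the event \<open>t \<le> \<theta>\<close>, with \<open>\<theta>\<close> the
  infimum of the nonnegative rational times at which \<open>Y\<close> exceeds \<open>K\<close>. The
  strict inequality makes its indicator left continuous in \<open>t\<close>; the restriction to
  rationals makes it measurable without regularity of \<open>Y\<close>.\<close>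

definition stays_below :: "(real \<Rightarrow> 'w \<Rightarrow> real) \<Rightarrow> real \<Rightarrow> real \<Rightarrow> 'w \<Rightarrow> bool" where
  "stays_below Y K t \<omega> \<longleftrightarrow> (\<forall>i. nonneg_rat i < t \<longrightarrow> Y (nonneg_rat i) \<omega> \<le> K)"

text \<open>\<open>max 0 s\<close> extends the process to the whole line so that
  \<open>lborel\<close> can be used; the extended values are never integrated. The order of the
  factors is the one of the later Fubini argument.\<close>

lemma measurable_process_pair:
  assumes "measurable_process M H"
  shows "(\<lambda>(\<omega>, s). H (max 0 s) \<omega>) \<in> borel_measurable (M \<Otimes>\<^sub>M lborel)"
proof -
  have *: "(\<lambda>(\<omega>, s :: real). (max 0 s, \<omega>)) \<in> M \<Otimes>\<^sub>M lborel \<rightarrow>\<^sub>M restrict_space borel {0..} \<Otimes>\<^sub>M M"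
  proof -
    have "(\<lambda>x. max 0 (snd x)) \<in> M \<Otimes>\<^sub>M lborel \<rightarrow>\<^sub>M (restrict_space borel {0..} :: real measure)"
      by (rule measurable_restrict_space2) (auto intro!: borel_measurable_max measurable_snd'')
    then show ?thesis
      unfolding split_beta' by (intro measurable_Pair measurable_fst)
  qed
  show ?thesis
    using measurable_compose[OF * assms[unfolded measurable_process_def]] by (simp add: split_beta')
qed

context brownian_space
begin

lemma adapted_measurable: "adapted F X \<Longrightarrow> 0 \<le> t \<Longrightarrow> X t \<in> borel_measurable M"
  using F_measurable_M by (auto simp: adapted_def)

lemma stays_below_measurable_pair:
  assumes "\<And>t. 0 \<le> t \<Longrightarrow> Y t \<in> borel_measurable M"
  shows "Measurable.pred (M \<Otimes>\<^sub>M lborel) (\<lambda>(\<omega>, s). stays_below Y K s \<omega>)"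
proof -
  have [measurable]: "Y (nonneg_rat i) \<in> borel_measurable M" for i
    using assms by simp
  show ?thesis unfolding stays_below_def split_beta' by measurable
qed

lemma stays_below_measurable:
  assumes "\<And>t. 0 \<le> t \<Longrightarrow> Y t \<in> borel_measurable M"
  shows "Measurable.pred M (stays_below Y K s)"
proof -
  have [measurable]: "Y (nonneg_rat i) \<in> borel_measurable M" for i
    using assms by simp
  show ?thesis unfolding stays_below_def by measurable
qed

lemma elementary_val_pair:
  assumes "elementary_process M F G"
  shows "(\<lambda>(\<omega>, s). elementary_val G s \<omega>) \<in> borel_measurable (M \<Otimes>\<^sub>M lborel)"
proof -
  obtain n \<tau> h where G: "G = (n, \<tau>, h)" by (cases G)
  have [measurable]: "h i \<in> borel_measurable M" if "i < n" for i
    using assms that by (auto simp: G elementary_process_def intro: F_measurable_M)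
  show ?thesis
    unfolding G elementary_val_def split_beta' prod.sel prod.case
    by (intro borel_measurable_sum borel_measurable_times) auto
qed

lemma elementary_int_measurable:
  assumes "elementary_process M F G" "0 \<le> t"
  shows "elementary_int W G t \<in> borel_measurable M"
proof -
  obtain n \<tau> h where G: "G = (n, \<tau>, h)" by (cases G)
  have h: "\<And>i. i < n \<Longrightarrow> h i \<in> borel_measurable M"
    using assms by (auto simp: G elementary_process_def intro: F_measurable_M)
  have "0 \<le> \<tau> i" if "i \<le> n" for i
    using elementary_process_times_nonneg[OF assms(1)[unfolded G] that] .
  then show ?thesis
    unfolding G elementary_int_def prod.case using h assms(2)
    by (intro borel_measurable_sum borel_measurable_times borel_measurable_diff W_measurable) auto
qed

lemma elementary_int_continuous:
  assumes "elementary_process M F G"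
  shows "AE \<omega> in M. continuous_on {0..} (\<lambda>t. elementary_int W G t \<omega>)"
proof -
  obtain n \<tau> h where G: "G = (n, \<tau>, h)" by (cases G)
  note nonneg = elementary_process_times_nonneg[OF assms[unfolded G]]
  have "AE \<omega> in M. continuous_on {0..} (\<lambda>t. W t \<omega>)"
    using brownian by (simp add: brownian_motion_def)
  then show ?thesis
  proof eventually_elim
    case (elim \<omega>)
    have "continuous_on {0..} (\<lambda>t. W (min t (\<tau> i)) \<omega>)" if "i \<le> n" for i
      using nonneg[OF that]
      by (intro continuous_on_compose2[OF elim]) (auto intro!: continuous_intros)
    then show ?case
      unfolding G elementary_int_def prod.case by (intro continuous_intros) auto
  qed
qed

text \<open>Without completeness the set might fail to be measurable, and \<open>measure M\<close> of a nonmeasurable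
  set is \<open>0\<close>.\<close>

lemma ucp_level_set:
  assumes "elementary_process M F G" "adapted F I" "continuous_paths M I" "0 < T"
  shows "{\<omega> \<in> space M. \<epsilon> < (SUP t\<in>{0..T}. ennreal \<bar>I t \<omega> - elementary_int W G t \<omega>\<bar>)} \<in> sets M"
proof (rule in_sets_AE)
  let ?S = "\<lambda>\<omega>. SUP t\<in>\<rat> \<inter> {0..T}. ennreal \<bar>I t \<omega> - elementary_int W G t \<omega>\<bar>"
  have [measurable]: "?S \<in> borel_measurable M"
    using adapted_measurable[OF assms(2)] elementary_int_measurable[OF assms(1)]
    by (intro borel_measurable_SUP countable_Rats_Int) (auto intro!: borel_measurable_diff)
  show "{\<omega> \<in> space M. \<epsilon> < ?S \<omega>} \<in> sets M"
    by measurable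
  show "AE \<omega> in M. \<omega> \<in> {\<omega> \<in> space M. \<epsilon> < ?S \<omega>} \<longleftrightarrow>
      \<omega> \<in> {\<omega> \<in> space M. \<epsilon> < (SUP t\<in>{0..T}. ennreal \<bar>I t \<omega> - elementary_int W G t \<omega>\<bar>)}"
    using elementary_int_continuous[OF assms(1)] AE_space
  proof eventually_elim
    case (elim \<omega>)
    then have "continuous_on {0..T} (\<lambda>t. \<bar>I t \<omega> - elementary_int W G t \<omega>\<bar>)"
      using assms(3) unfolding continuous_paths_def
      by (intro continuous_intros) (auto intro: continuous_on_subset)
    from SUP_rats_eq[OF assms(4) this] show ?case by auto
  qed
qed auto

end

text \<open>Two applications of \<open>(x + y)^2 \<le> 2 x^2 + 2 y^2\<close>. Only the factor 2 at
  \<open>u\<close> survives in the limit, where \<open>a\<close> and \<open>b\<close> are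
  approximation errors.\<close>

lemma square_split_ennreal:
  fixes u a b :: real
  shows "ennreal ((u - a + b)\<^sup>2) \<le> 2 * ennreal (u\<^sup>2) + (4 * ennreal (a\<^sup>2) + 4 * ennreal (b\<^sup>2))"
proof -
  have "0 \<le> (u - (b - a))\<^sup>2" "0 \<le> 2 * (a + b)\<^sup>2"
    by simp_all
  then have "(u - a + b)\<^sup>2 \<le> 2 * u\<^sup>2 + (4 * a\<^sup>2 + 4 * b\<^sup>2)"
    by (simp add: power2_eq_square algebra_simps)
  then have "ennreal ((u - a + b)\<^sup>2) \<le> ennreal (2 * u\<^sup>2 + (4 * a\<^sup>2 + 4 * b\<^sup>2))"
    by (rule ennreal_leI)
  then show ?thesis by (simp add: ennreal_plus ennreal_mult)
qed

lemma stays_below_tendsto: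
  "(\<lambda>k. of_bool (\<forall>i\<le>k. nonneg_rat i < s \<longrightarrow> Y (nonneg_rat i) \<omega> \<le> K) :: ennreal)
    \<longlonglongrightarrow> of_bool (stays_below Y K s \<omega>)"
proof (cases "stays_below Y K s \<omega>")
  case True
  then show ?thesis by (simp add: stays_below_def)
next
  case False
  then obtain i where "nonneg_rat i < s" "\<not> Y (nonneg_rat i) \<omega> \<le> K"
    by (auto simp: stays_below_def)
  then have "\<forall>\<^sub>F k in sequentially.
      (of_bool (\<forall>i\<le>k. nonneg_rat i < s \<longrightarrow> Y (nonneg_rat i) \<omega> \<le> K) :: ennreal) = 0"
    by (intro eventually_sequentiallyI[of i]) auto
  then show ?thesis
    using False by (intro tendsto_eventually) simp
qed

lemma set_nn_integral_max_0:
  "(\<integral>\<^sup>+s\<in>{0..T::real}. f (max 0 s) s \<partial>lborel) = (\<integral>\<^sup>+s\<in>{0..T}. f s s \<partial>lborel)"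
  by (intro nn_integral_cong) (auto split: split_indicator simp: max_def)

context brownian_space
begin

text \<open>Along a subsequence both approximations converge almost surely; Fatou's lemma on the left and
  the bound \<open>L\<close> on the right then pass the discrete inequality to the limit. The constant
  \<open>8\<close> is \<open>4\<close> from Doob's inequality times \<open>2\<close> from comparing the elementary integrand with
  its limit.\<close>

lemma ito_integral_maximal:
  assumes I1: "ito_integral M W H1 I1" and I2: "ito_integral M W H2 I2"
    and Y: "adapted F Y" and T: "0 < T"
  shows "(\<integral>\<^sup>+\<omega>. (SUP t\<in>\<rat> \<inter> {0..T}. ennreal ((I1 t \<omega> - I2 t \<omega>)\<^sup>2) * of_bool (stays_below Y K t \<omega>)) \<partial>M)
    \<le> 8 * (\<integral>\<^sup>+\<omega>. (\<integral>\<^sup>+s\<in>{0..T}. ennreal ((H1 s \<omega> - H2 s \<omega>)\<^sup>2) * of_bool (stays_below Y K s \<omega>) \<partial>lborel) \<partial>M)"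
proof -
  obtain G1 where G1: "\<And>m. elementary_process M F (G1 m)"
    "tendsto_zero_in_prob M
      (\<lambda>m \<omega>. \<integral>\<^sup>+s\<in>{0..T}. ennreal ((H1 s \<omega> - elementary_val (G1 m) s \<omega>)\<^sup>2) \<partial>lborel)"
    "tendsto_zero_in_prob M (\<lambda>m \<omega>. SUP t\<in>{0..T}. ennreal \<bar>I1 t \<omega> - elementary_int W (G1 m) t \<omega>\<bar>)"
    using I1 T unfolding ito_integral_def by blast
  obtain G2 where G2: "\<And>m. elementary_process M F (G2 m)"
    "tendsto_zero_in_prob M
      (\<lambda>m \<omega>. \<integral>\<^sup>+s\<in>{0..T}. ennreal ((H2 s \<omega> - elementary_val (G2 m) s \<omega>)\<^sup>2) \<partial>lborel)"
    "tendsto_zero_in_prob M (\<lambda>m \<omega>. SUP t\<in>{0..T}. ennreal \<bar>I2 t \<omega> - elementary_int W (G2 m) t \<omega>\<bar>)"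
    using I2 T unfolding ito_integral_def by blast
  have I: "adapted F I1" "continuous_paths M I1" "adapted F I2" "continuous_paths M I2"
    and H: "measurable_process M H1" "measurable_process M H2"
    using I1 I2 by (auto simp: ito_integral_def)
  note [measurable] = measurable_process_pair[OF H(1)] measurable_process_pair[OF H(2)]
    elementary_val_pair[OF G1(1)] elementary_val_pair[OF G2(1)]
  define e1 where "e1 m \<omega> = (\<integral>\<^sup>+s\<in>{0..T}. ennreal ((H1 (max 0 s) \<omega> - elementary_val (G1 m) s \<omega>)\<^sup>2) \<partial>lborel)" for m \<omega>
  define e2 where "e2 m \<omega> = (\<integral>\<^sup>+s\<in>{0..T}. ennreal ((H2 (max 0 s) \<omega> - elementary_val (G2 m) s \<omega>)\<^sup>2) \<partial>lborel)" for m \<omega>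
  define d1 where "d1 m \<omega> = (SUP t\<in>{0..T}. ennreal \<bar>I1 t \<omega> - elementary_int W (G1 m) t \<omega>\<bar>)" for m \<omega>
  define d2 where "d2 m \<omega> = (SUP t\<in>{0..T}. ennreal \<bar>I2 t \<omega> - elementary_int W (G2 m) t \<omega>\<bar>)" for m \<omega>
  have e_eq: "e1 = (\<lambda>m \<omega>. \<integral>\<^sup>+s\<in>{0..T}. ennreal ((H1 s \<omega> - elementary_val (G1 m) s \<omega>)\<^sup>2) \<partial>lborel)"
    "e2 = (\<lambda>m \<omega>. \<integral>\<^sup>+s\<in>{0..T}. ennreal ((H2 s \<omega> - elementary_val (G2 m) s \<omega>)\<^sup>2) \<partial>lborel)"
    unfolding fun_eq_iff e1_def e2_def
    using set_nn_integral_max_0[of "\<lambda>t s. ennreal ((H1 t _ - elementary_val (G1 _) s _)\<^sup>2)"]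
      set_nn_integral_max_0[of "\<lambda>t s. ennreal ((H2 t _ - elementary_val (G2 _) s _)\<^sup>2)"] by auto
  have [measurable]: "e1 m \<in> borel_measurable M" "e2 m \<in> borel_measurable M" for m
    unfolding e1_def e2_def by measurable
  \<comment> \<open>The four error quantities are indexed together so that a single subsequence
    serves them all.\<close>
  define u where "u j = [e1, e2, d1, d2] ! j" for j :: nat
  have u_tendsto: "tendsto_zero_in_prob M (u j)" if "j \<in> {..<4}" for j
    using that G1(2,3) G2(2,3) unfolding e_eq[symmetric] d1_def[symmetric] d2_def[symmetric]
    by (auto simp: u_def less_Suc_eq numeral_eq_Suc)
  have u_meas: "{\<omega> \<in> space M. ennreal \<epsilon> < u j m \<omega>} \<in> sets M" if "j \<in> {..<4}" for j m \<epsilon>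
  proof -
    have "{\<omega> \<in> space M. ennreal \<epsilon> < e1 m \<omega>} \<in> sets M" "{\<omega> \<in> space M. ennreal \<epsilon> < e2 m \<omega>} \<in> sets M"
      by measurable
    moreover have "{\<omega> \<in> space M. ennreal \<epsilon> < d1 m \<omega>} \<in> sets M" "{\<omega> \<in> space M. ennreal \<epsilon> < d2 m \<omega>} \<in> sets M"
      unfolding d1_def d2_def by (intro ucp_level_set G1 G2 I T)+
    ultimately show ?thesis
      using that by (auto simp: u_def less_Suc_eq numeral_eq_Suc)
  qed
  obtain r where r: "AE \<omega> in M. \<forall>j\<in>{..<4}. (\<lambda>k. u j (r k) \<omega>) \<longlonglongrightarrow> 0"
    using tendsto_zero_in_prob_AE_subseq[of "{..<4}" u, OF _ u_tendsto u_meas] by auto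
  define B where "B k s \<omega> \<longleftrightarrow> (\<forall>i\<le>k. nonneg_rat i < s \<longrightarrow> Y (nonneg_rat i) \<omega> \<le> K)" for k :: nat and s \<omega>
  define U where "U s \<omega> = H1 (max 0 s) \<omega> - H2 (max 0 s) \<omega>" for s \<omega>
  define A where "A k \<omega> = (\<integral>\<^sup>+s\<in>{0..T}. ennreal ((U s \<omega>)\<^sup>2) * of_bool (B k s \<omega>) \<partial>lborel)" for k \<omega>
  define A' where "A' \<omega> = (\<integral>\<^sup>+s\<in>{0..T}. ennreal ((U s \<omega>)\<^sup>2) * of_bool (stays_below Y K s \<omega>) \<partial>lborel)" for \<omega>
  define U2 where "U2 \<omega> = (\<integral>\<^sup>+s\<in>{0..T}. ennreal ((U s \<omega>)\<^sup>2) \<partial>lborel)" for \<omega>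
  define V where "V k s \<omega> = elementary_val (G1 (r k)) s \<omega> - elementary_val (G2 (r k)) s \<omega>" for k s \<omega>
  define J where "J k t \<omega> = elementary_int W (G1 (r k)) t \<omega> - elementary_int W (G2 (r k)) t \<omega>" for k t \<omega>
  define S where "S \<omega> = (SUP t\<in>\<rat> \<inter> {0..T}. ennreal ((I1 t \<omega> - I2 t \<omega>)\<^sup>2) * of_bool (stays_below Y K t \<omega>))" for \<omega>
  note YM = adapted_measurable[OF Y]
  have [measurable]: "Y (nonneg_rat i) \<in> borel_measurable M" for i
    using YM by simp
  have U_pair [measurable]: "(\<lambda>(\<omega>, s). U s \<omega>) \<in> borel_measurable (M \<Otimes>\<^sub>M lborel)"
    unfolding U_def by measurable
  have sections [measurable]: "(\<lambda>s. U s \<omega>) \<in> borel_measurable borel"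
    "(\<lambda>s. elementary_val (G1 m) s \<omega>) \<in> borel_measurable borel"
    "(\<lambda>s. elementary_val (G2 m) s \<omega>) \<in> borel_measurable borel"
    "(\<lambda>s. H1 (max 0 s) \<omega>) \<in> borel_measurable borel" "(\<lambda>s. H2 (max 0 s) \<omega>) \<in> borel_measurable borel"
    if "\<omega> \<in> space M" for \<omega> m
    using measurable_Pair2[OF U_pair that] measurable_Pair2[OF elementary_val_pair[OF G1(1)] that]
      measurable_Pair2[OF elementary_val_pair[OF G2(1)] that]
      measurable_Pair2[OF measurable_process_pair[OF H(1)] that]
      measurable_Pair2[OF measurable_process_pair[OF H(2)] that] by simp_all
  have [measurable]: "Measurable.pred borel (\<lambda>s. B k s \<omega>)"
    "Measurable.pred borel (\<lambda>s. stays_below Y K s \<omega>)" for k \<omega>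
    unfolding B_def stays_below_def by measurable
  have [measurable]: "A' \<in> borel_measurable M"
    unfolding A'_def using stays_below_measurable_pair[OF YM] by measurable
  have [measurable]: "U2 \<in> borel_measurable M"
    unfolding U2_def by measurable
  have [measurable]: "S \<in> borel_measurable M"
    unfolding S_def
    using adapted_measurable[OF I(1)] adapted_measurable[OF I(3)] stays_below_measurable[OF YM]
    by (intro borel_measurable_SUP countable_Rats_Int) auto
  \<comment> \<open>Passes from the elementary integrands to \<open>H1 - H2\<close> for any cut-off
    \<open>P\<close>: with \<open>P\<close> constantly true it shows that the bound \<open>L\<close>
    is eventually respected, with \<open>P\<close> equal to \<open>B k\<close> it controls the
    right-hand side.\<close>
  have V_le: "(\<integral>\<^sup>+s\<in>{0..T}. ennreal ((V k s \<omega>)\<^sup>2) * of_bool (P s) \<partial>lborel)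
      \<le> 2 * (\<integral>\<^sup>+s\<in>{0..T}. ennreal ((U s \<omega>)\<^sup>2) * of_bool (P s) \<partial>lborel) + (4 * e1 (r k) \<omega> + 4 * e2 (r k) \<omega>)"
    if [measurable]: "\<omega> \<in> space M" "Measurable.pred borel P" for k \<omega> P
  proof -
    let ?a = "\<lambda>s. H1 (max 0 s) \<omega> - elementary_val (G1 (r k)) s \<omega>"
    let ?b = "\<lambda>s. H2 (max 0 s) \<omega> - elementary_val (G2 (r k)) s \<omega>"
    have "(\<integral>\<^sup>+s\<in>{0..T}. ennreal ((V k s \<omega>)\<^sup>2) * of_bool (P s) \<partial>lborel)
       \<le> (\<integral>\<^sup>+s. 2 * (ennreal ((U s \<omega>)\<^sup>2) * of_bool (P s) * indicator {0..T} s) +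
            (4 * (ennreal ((?a s)\<^sup>2) * indicator {0..T} s) + 4 * (ennreal ((?b s)\<^sup>2) * indicator {0..T} s)) \<partial>lborel)"
    proof (rule nn_integral_mono)
      fix s
      have "V k s \<omega> = U s \<omega> - ?a s + ?b s" by (simp add: V_def U_def)
      then show "ennreal ((V k s \<omega>)\<^sup>2) * of_bool (P s) * indicator {0..T} s \<le>
          2 * (ennreal ((U s \<omega>)\<^sup>2) * of_bool (P s) * indicator {0..T} s) +
            (4 * (ennreal ((?a s)\<^sup>2) * indicator {0..T} s) + 4 * (ennreal ((?b s)\<^sup>2) * indicator {0..T} s))"
        using square_split_ennreal[of "U s \<omega>" "?a s" "?b s"] by (auto split: split_indicator)
    qed
    also have "\<dots> = 2 * (\<integral>\<^sup>+s\<in>{0..T}. ennreal ((U s \<omega>)\<^sup>2) * of_bool (P s) \<partial>lborel) + (4 * e1 (r k) \<omega> + 4 * e2 (r k) \<omega>)"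
      using that unfolding e1_def e2_def
      by (simp add: nn_integral_add nn_integral_cmult)
    finally show ?thesis .
  qed
  have AE_conv: "AE \<omega> in M. \<omega> \<in> space M \<and> U2 \<omega> < \<infinity> \<and> (\<lambda>k. e1 (r k) \<omega>) \<longlonglongrightarrow> 0 \<and> (\<lambda>k. e2 (r k) \<omega>) \<longlonglongrightarrow> 0 \<and>
      (\<forall>t\<in>{0..T}. (\<lambda>k. J k t \<omega>) \<longlonglongrightarrow> I1 t \<omega> - I2 t \<omega>)"
  proof -
    have "AE \<omega> in M. set_integrable lborel {0..T} (\<lambda>s. (H1 s \<omega>)\<^sup>2)"
      "AE \<omega> in M. set_integrable lborel {0..T} (\<lambda>s. (H2 s \<omega>)\<^sup>2)"
      using I1 I2 T by (auto simp: ito_integral_def)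
    then show ?thesis
      using r AE_space
    proof eventually_elim
      case (elim \<omega>)
      have e: "(\<lambda>k. e1 (r k) \<omega>) \<longlonglongrightarrow> 0" "(\<lambda>k. e2 (r k) \<omega>) \<longlonglongrightarrow> 0"
        and d: "(\<lambda>k. d1 (r k) \<omega>) \<longlonglongrightarrow> 0" "(\<lambda>k. d2 (r k) \<omega>) \<longlonglongrightarrow> 0"
        using elim(3)[rule_format, of 0] elim(3)[rule_format, of 1]
          elim(3)[rule_format, of 2] elim(3)[rule_format, of 3] by (simp_all add: u_def)
      have "U2 \<omega> < \<infinity>"
      proof -
        have int: "set_integrable lborel {0..T} (\<lambda>s. 2 * (H1 s \<omega>)\<^sup>2 + 2 * (H2 s \<omega>)\<^sup>2)"
          using elim(1,2) by (intro set_integral_add set_integrable_mult_right) auto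
        have "U2 \<omega> \<le> (\<integral>\<^sup>+s. ennreal (indicator {0..T} s *\<^sub>R (2 * (H1 s \<omega>)\<^sup>2 + 2 * (H2 s \<omega>)\<^sup>2)) \<partial>lborel)"
          unfolding U2_def
        proof (rule nn_integral_mono)
          fix s
          have "0 \<le> (H1 s \<omega> + H2 s \<omega>)\<^sup>2" by simp
          then have "(H1 s \<omega> - H2 s \<omega>)\<^sup>2 \<le> 2 * (H1 s \<omega>)\<^sup>2 + 2 * (H2 s \<omega>)\<^sup>2"
            by (simp add: power2_eq_square algebra_simps)
          from ennreal_leI[OF this] show "ennreal ((U s \<omega>)\<^sup>2) * indicator {0..T} s
              \<le> ennreal (indicator {0..T} s *\<^sub>R (2 * (H1 s \<omega>)\<^sup>2 + 2 * (H2 s \<omega>)\<^sup>2))"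
            by (auto split: split_indicator simp: U_def max_def)
        qed
        also have "\<dots> < \<infinity>"
          using integrableD(2)[OF int[unfolded set_integrable_def]]
          by (simp add: top.not_eq_extremum)
        finally show ?thesis .
      qed
      moreover have "(\<lambda>k. J k t \<omega>) \<longlonglongrightarrow> I1 t \<omega> - I2 t \<omega>" if t: "t \<in> {0..T}" for t
      proof -
        have lim: "(\<lambda>k. x k) \<longlonglongrightarrow> y" if "\<And>k. ennreal \<bar>y - x k\<bar> \<le> d k" "d \<longlonglongrightarrow> 0" for x :: "nat \<Rightarrow> real" and y d
        proof -
          have "(\<lambda>k. ennreal \<bar>y - x k\<bar>) \<longlonglongrightarrow> 0"
            by (rule tendsto_sandwich[OF _ _ tendsto_const that(2)]) (auto simp: that(1))
          then have "(\<lambda>k. \<bar>y - x k\<bar>) \<longlonglongrightarrow> 0"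
            by (subst (asm) ennreal_tendsto_0_iff) auto
          then have "(\<lambda>k. y - (y - x k)) \<longlonglongrightarrow> y - 0"
            by (intro tendsto_diff tendsto_const) (simp add: tendsto_rabs_zero_iff)
          then show ?thesis by simp
        qed
        show ?thesis
          unfolding J_def using t
          by (intro tendsto_diff lim[OF _ d(1)] lim[OF _ d(2)]) (auto simp: d1_def d2_def intro!: SUP_upper)
      qed
      ultimately show ?case using e elim(4) by auto
    qed
  qed
  \<comment> \<open>The strict inequality leaves room for the vanishing terms \<open>4 * e1\<close>
    and \<open>4 * e2\<close>: on this event the elementary square integrals eventually stay below
    \<open>L\<close>, so the corresponding switch does not act. The factor 2 is the one in
    \<open>V_le\<close>.\<close>
  have le_L: "(\<integral>\<^sup>+\<omega>. S \<omega> * of_bool (2 * U2 \<omega> < ennreal (real L)) \<partial>M) \<le> 8 * (\<integral>\<^sup>+\<omega>. A' \<omega> \<partial>M)" for L :: nat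
  proof -
    define ok where "ok k \<Lambda> \<Phi> \<longleftrightarrow>
        \<Lambda> \<in> borel_measurable M \<and> \<Phi> \<in> borel_measurable M \<and>
        (\<integral>\<^sup>+\<omega>. \<Lambda> \<omega> \<partial>M) \<le> 4 * (\<integral>\<^sup>+\<omega>. \<Phi> \<omega> \<partial>M) \<and> (\<forall>\<omega>. \<Phi> \<omega> \<le> ennreal (real L)) \<and>
        (\<forall>\<omega>. \<Phi> \<omega> \<le> (\<integral>\<^sup>+s\<in>{0..T}. ennreal ((V k s \<omega>)\<^sup>2) * of_bool (B k s \<omega>) \<partial>lborel)) \<and>
        (\<forall>\<omega>. \<forall>t\<in>nonneg_rat ` {..k} \<inter> {0..T}. B k t \<omega> \<longrightarrow>
          (\<integral>\<^sup>+s\<in>{0..T}. ennreal ((V k s \<omega>)\<^sup>2) \<partial>lborel) \<le> ennreal (real L) \<longrightarrow>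
          ennreal ((J k t \<omega>)\<^sup>2) \<le> \<Lambda> \<omega>)"
      for k and \<Lambda> \<Phi> :: "'w \<Rightarrow> ennreal"
    have "\<exists>\<Lambda> \<Phi>. ok k \<Lambda> \<Phi>" for k
    proof -
      have Yr: "\<And>r. 0 \<le> r \<Longrightarrow> Y r \<in> borel_measurable (F r)"
        using Y by (auto simp: adapted_def)
      have B_eq: "B k s \<omega> \<longleftrightarrow> (\<forall>r\<in>nonneg_rat ` {..k}. r < s \<longrightarrow> Y r \<omega> \<le> K)" for s \<omega>
        by (auto simp: B_def)
      show ?thesis
        unfolding ok_def B_eq V_def J_def
      proof (rule localized_elementary_doob[OF G1(1)[of "r k"] G2(1)[of "r k"] Yr, of "nonneg_rat ` {..k}"
              "nonneg_rat ` {..k} \<inter> {0..T}" T "real L" K], goal_cases)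
        case (8 \<Lambda> \<Phi>)
        show ?case
          by (intro exI[of _ \<Lambda>] exI[of _ \<Phi>] conjI allI ballI impI; rule 8; assumption)
      qed (use T in auto)
    qed
    then obtain \<Lambda> \<Phi> where ok: "\<And>k. ok k (\<Lambda> k) (\<Phi> k)"
      by metis
    have \<Lambda>\<Phi>:
      "\<And>k. \<Lambda> k \<in> borel_measurable M" "\<And>k. \<Phi> k \<in> borel_measurable M"
      "\<And>k. (\<integral>\<^sup>+\<omega>. \<Lambda> k \<omega> \<partial>M) \<le> 4 * (\<integral>\<^sup>+\<omega>. \<Phi> k \<omega> \<partial>M)"
      "\<And>k \<omega>. \<Phi> k \<omega> \<le> ennreal (real L)"
      "\<And>k \<omega>. \<Phi> k \<omega> \<le> (\<integral>\<^sup>+s\<in>{0..T}. ennreal ((V k s \<omega>)\<^sup>2) * of_bool (B k s \<omega>) \<partial>lborel)"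
      "\<And>k \<omega> t. t \<in> nonneg_rat ` {..k} \<inter> {0..T} \<Longrightarrow> B k t \<omega> \<Longrightarrow>
          (\<integral>\<^sup>+s\<in>{0..T}. ennreal ((V k s \<omega>)\<^sup>2) \<partial>lborel) \<le> ennreal (real L) \<Longrightarrow>
          ennreal ((J k t \<omega>)\<^sup>2) \<le> \<Lambda> k \<omega>"
      using ok unfolding ok_def by blast+
    note [measurable] = \<Lambda>\<Phi>(1,2)
    have lower: "AE \<omega> in M. S \<omega> * of_bool (2 * U2 \<omega> < ennreal (real L)) \<le> liminf (\<lambda>k. \<Lambda> k \<omega>)"
      using AE_conv
    proof eventually_elim
      case (elim \<omega>)
      show ?case
      proof (cases "2 * U2 \<omega> < ennreal (real L)")
        case True
        have "(\<lambda>k. 2 * U2 \<omega> + (4 * e1 (r k) \<omega> + 4 * e2 (r k) \<omega>)) \<longlonglongrightarrow> 2 * U2 \<omega> + (4 * 0 + 4 * 0)"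
          using elim by (intro tendsto_add tendsto_const ennreal_tendsto_cmult) auto
        then have evL: "\<forall>\<^sub>F k in sequentially. 2 * U2 \<omega> + (4 * e1 (r k) \<omega> + 4 * e2 (r k) \<omega>) < ennreal (real L)"
          using True by (intro order_tendstoD(2)) auto
        have "ennreal ((I1 t \<omega> - I2 t \<omega>)\<^sup>2) * of_bool (stays_below Y K t \<omega>) \<le> liminf (\<lambda>k. \<Lambda> k \<omega>)"
          if t: "t \<in> \<rat> \<inter> {0..T}" for t
        proof (cases "stays_below Y K t \<omega>")
          case below: True
          have "t \<in> range nonneg_rat" using t by (auto simp: range_nonneg_rat)
          then obtain i where i: "t = nonneg_rat i" by auto
          have "(\<lambda>k. J k t \<omega>) \<longlonglongrightarrow> I1 t \<omega> - I2 t \<omega>"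
            using elim t by auto
          then have "(\<lambda>k. ennreal ((J k t \<omega>)\<^sup>2)) \<longlonglongrightarrow> ennreal ((I1 t \<omega> - I2 t \<omega>)\<^sup>2)"
            by (intro tendsto_ennrealI tendsto_power)
          then have "ennreal ((I1 t \<omega> - I2 t \<omega>)\<^sup>2) = liminf (\<lambda>k. ennreal ((J k t \<omega>)\<^sup>2))"
            by (rule lim_imp_Liminf[OF trivial_limit_sequentially, symmetric])
          also have "\<dots> \<le> liminf (\<lambda>k. \<Lambda> k \<omega>)"
          proof (rule Liminf_mono)
            show "\<forall>\<^sub>F k in sequentially. ennreal ((J k t \<omega>)\<^sup>2) \<le> \<Lambda> k \<omega>"
              using evL eventually_ge_at_top[of i]
            proof eventually_elim
              case ev: (elim k)
              have "(\<integral>\<^sup>+s\<in>{0..T}. ennreal ((V k s \<omega>)\<^sup>2) \<partial>lborel) \<le> 2 * U2 \<omega> + (4 * e1 (r k) \<omega> + 4 * e2 (r k) \<omega>)"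
                using V_le[of \<omega> "\<lambda>_. True" k] elim by (simp add: U2_def)
              with ev(1) have "(\<integral>\<^sup>+s\<in>{0..T}. ennreal ((V k s \<omega>)\<^sup>2) \<partial>lborel) \<le> ennreal (real L)"
                by (meson less_imp_le order_trans)
              then show ?case
                using t ev(2) below by (intro \<Lambda>\<Phi>(6)) (auto simp: i stays_below_def B_def)
            qed
          qed
          finally show ?thesis using below by simp
        qed simp
        then show ?thesis using True by (simp add: S_def SUP_le_iff)
      qed simp
    qed
    \<comment> \<open>As \<open>U2\<close> is finite, dominated convergence in \<open>s\<close> lets
      the number of check times tend to infinity.\<close>
    have upper: "AE \<omega> in M. limsup (\<lambda>k. 4 * \<Phi> k \<omega>) \<le> 8 * A' \<omega>"
      using AE_conv
    proof eventually_elim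
      case (elim \<omega>)
      have [measurable]: "(\<lambda>s. U s \<omega>) \<in> borel_measurable borel"
        using elim by (intro sections) auto
      have "(\<lambda>k. A k \<omega>) \<longlonglongrightarrow> A' \<omega>"
        unfolding A_def A'_def
      proof (rule nn_integral_dominated_convergence)
        show "(\<integral>\<^sup>+s. ennreal ((U s \<omega>)\<^sup>2) * indicator {0..T} s \<partial>lborel) < \<infinity>"
          using elim by (simp add: U2_def)
        show "AE s in lborel. (\<lambda>k. ennreal ((U s \<omega>)\<^sup>2) * of_bool (B k s \<omega>) * indicator {0..T} s)
            \<longlonglongrightarrow> ennreal ((U s \<omega>)\<^sup>2) * of_bool (stays_below Y K s \<omega>) * indicator {0..T} s"
          unfolding B_def
          by (intro AE_I2 tendsto_mult_ennreal tendsto_const stays_below_tendsto)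
             (auto simp: indicator_def split: if_splits)
        show "AE s in lborel. ennreal ((U s \<omega>)\<^sup>2) * of_bool (B k s \<omega>) * indicator {0..T} s
            \<le> ennreal ((U s \<omega>)\<^sup>2) * indicator {0..T} s" for k
          by (intro AE_I2) (auto split: split_indicator)
      qed measurable
      then have lim: "(\<lambda>k. 4 * (2 * A k \<omega> + (4 * e1 (r k) \<omega> + 4 * e2 (r k) \<omega>))) \<longlonglongrightarrow> 4 * (2 * A' \<omega> + (4 * 0 + 4 * 0))"
        using elim by (intro tendsto_add ennreal_tendsto_cmult) auto
      have "limsup (\<lambda>k. 4 * \<Phi> k \<omega>) \<le> limsup (\<lambda>k. 4 * (2 * A k \<omega> + (4 * e1 (r k) \<omega> + 4 * e2 (r k) \<omega>)))"
        using order_trans[OF \<Lambda>\<Phi>(5) V_le[of \<omega> "\<lambda>s. B _ s \<omega>"]] elim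
        by (intro Limsup_mono always_eventually allI mult_left_mono) (auto simp: A_def)
      also have "\<dots> = 4 * (2 * A' \<omega> + (4 * 0 + 4 * 0))"
        by (rule lim_imp_Limsup[OF _ lim]) simp
      finally show ?case by (simp add: mult.assoc[symmetric])
    qed
    have "(\<integral>\<^sup>+\<omega>. S \<omega> * of_bool (2 * U2 \<omega> < ennreal (real L)) \<partial>M) \<le> (\<integral>\<^sup>+\<omega>. liminf (\<lambda>k. \<Lambda> k \<omega>) \<partial>M)"
      by (rule nn_integral_mono_AE[OF lower])
    also have "\<dots> \<le> liminf (\<lambda>k. \<integral>\<^sup>+\<omega>. \<Lambda> k \<omega> \<partial>M)"
      by (rule nn_integral_liminf) measurable
    also have "\<dots> \<le> limsup (\<lambda>k. \<integral>\<^sup>+\<omega>. \<Lambda> k \<omega> \<partial>M)"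
      by (rule Liminf_le_Limsup) simp
    also have "\<dots> \<le> limsup (\<lambda>k. \<integral>\<^sup>+\<omega>. 4 * \<Phi> k \<omega> \<partial>M)"
      using \<Lambda>\<Phi>(3) by (intro Limsup_mono always_eventually allI) (simp add: nn_integral_cmult)
    also have "\<dots> \<le> (\<integral>\<^sup>+\<omega>. limsup (\<lambda>k. 4 * \<Phi> k \<omega>) \<partial>M)"
    proof (rule nn_integral_limsup)
      show "(\<integral>\<^sup>+\<omega>. 4 * ennreal (real L) \<partial>M) < \<infinity>"
        by (simp add: emeasure_space_1 ennreal_mult_less_top)
      show "AE \<omega> in M. 4 * \<Phi> k \<omega> \<le> 4 * ennreal (real L)" for k
        using \<Lambda>\<Phi>(4) by (intro AE_I2 mult_left_mono) auto
    qed measurable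
    also have "\<dots> \<le> (\<integral>\<^sup>+\<omega>. 8 * A' \<omega> \<partial>M)"
      by (rule nn_integral_mono_AE[OF upper])
    also have "\<dots> = 8 * (\<integral>\<^sup>+\<omega>. A' \<omega> \<partial>M)"
      by (rule nn_integral_cmult) measurable
    finally show ?thesis .
  qed
  have "(\<integral>\<^sup>+\<omega>. S \<omega> \<partial>M) \<le> (\<integral>\<^sup>+\<omega>. (SUP L::nat. S \<omega> * of_bool (2 * U2 \<omega> < ennreal (real L))) \<partial>M)"
    using AE_conv
  proof (intro nn_integral_mono_AE, eventually_elim)
    case (elim \<omega>)
    then have "2 * U2 \<omega> < \<infinity>" by (simp add: ennreal_mult_less_top)
    then obtain L :: nat where "2 * U2 \<omega> < ennreal (real L)"
      by (metis ennreal_Ex_less_of_nat ennreal_of_nat_eq_real_of_nat infinity_ennreal_def)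
    then have "S \<omega> = S \<omega> * of_bool (2 * U2 \<omega> < ennreal (real L))" by simp
    then show ?case by (metis (no_types, lifting) SUP_upper UNIV_I)
  qed
  also have "\<dots> = (SUP L::nat. \<integral>\<^sup>+\<omega>. S \<omega> * of_bool (2 * U2 \<omega> < ennreal (real L)) \<partial>M)"
  proof (rule nn_integral_monotone_convergence_SUP)
    show "incseq (\<lambda>L::nat. \<lambda>\<omega>. S \<omega> * of_bool (2 * U2 \<omega> < ennreal (real L)))"
    proof (intro incseq_SucI le_funI mult_left_mono)
      fix L :: nat and \<omega>
      have "ennreal (real L) \<le> ennreal (real (Suc L))"
        by (intro ennreal_leI) simp
      then show "(of_bool (2 * U2 \<omega> < ennreal (real L)) :: ennreal) \<le> of_bool (2 * U2 \<omega> < ennreal (real (Suc L)))"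
        using less_le_trans[of "2 * U2 \<omega>" "ennreal (real L)" "ennreal (real (Suc L))"]
        by (auto simp del: of_nat_Suc)
    qed simp
  qed measurable
  also have "\<dots> \<le> 8 * (\<integral>\<^sup>+\<omega>. A' \<omega> \<partial>M)"
    by (intro SUP_least le_L)
  also have "A' = (\<lambda>\<omega>. \<integral>\<^sup>+s\<in>{0..T}. ennreal ((H1 s \<omega> - H2 s \<omega>)\<^sup>2) * of_bool (stays_below Y K s \<omega>) \<partial>lborel)"
    unfolding A'_def U_def
    by (intro ext set_nn_integral_max_0[of "\<lambda>t s. ennreal ((H1 t _ - H2 t _)\<^sup>2) * of_bool (stays_below Y K s _)"])
  finally show ?thesis unfolding S_def .
qed

end

section \<open>A stochastic Gronwall inequality\<close>

text \<open>Instead of iterating, take the supremum \<open>m\<close> of \<open>f t e\<^sup>-\<^sup>2\<^sup>b\<^sup>t\<close>; the hypothesis gives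
  \<open>m \<le> a + m / 2\<close>, and \<open>m\<close> is finite.\<close>

lemma gronwall_ennreal:
  fixes f :: "real \<Rightarrow> ennreal" and a :: ennreal and b K T :: real
  assumes [measurable]: "f \<in> borel_measurable borel" and b: "0 \<le> b"
    and K: "\<And>t. t \<in> {0<..T} \<Longrightarrow> f t \<le> ennreal K"
    and f: "\<And>t. t \<in> {0<..T} \<Longrightarrow> f t \<le> a + ennreal b * (\<integral>\<^sup>+s\<in>{0..t}. f s \<partial>lborel)"
    and t: "t \<in> {0<..T}"
  shows "f t \<le> 2 * a * ennreal (exp (2 * b * T))"
proof -
  define m where "m = (SUP t\<in>{0<..T}. f t * ennreal (exp (- 2 * b * t)))"
  have exp_inv: "ennreal (exp (- 2 * b * s)) * ennreal (exp (2 * b * s)) = 1" for s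
    by (simp add: ennreal_mult'[symmetric] exp_add[symmetric])
  have f_le: "f s \<le> m * ennreal (exp (2 * b * s))" if "s \<in> {0<..T}" for s
  proof -
    have "f s = (f s * ennreal (exp (- 2 * b * s))) * ennreal (exp (2 * b * s))"
      by (simp only: mult.assoc[of "f s"] exp_inv mult_1_right)
    also have "\<dots> \<le> m * ennreal (exp (2 * b * s))"
      unfolding m_def using that by (intro mult_right_mono SUP_upper) auto
    finally show ?thesis .
  qed
  have "m \<le> ennreal K"
    unfolding m_def
  proof (rule SUP_least)
    fix s assume s: "s \<in> {0<..T}"
    have "f s * ennreal (exp (- 2 * b * s)) \<le> ennreal K * ennreal 1"
      using b s by (intro mult_mono K ennreal_leI) auto
    then show "f s * ennreal (exp (- 2 * b * s)) \<le> ennreal K" by simp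
  qed
  then have m_fin: "m < top"
    by (simp add: le_less_trans)
  have "m \<le> a + m * ennreal (1 / 2)"
    unfolding m_def[of]
  proof (rule SUP_least, fold m_def)
    fix s assume s: "s \<in> {0<..T}"
    have "(\<integral>\<^sup>+r\<in>{0..s}. f r \<partial>lborel) \<le> (\<integral>\<^sup>+r\<in>{0..s}. m * ennreal (exp (2 * b * r)) \<partial>lborel)"
      using AE_lborel_singleton[of "0 :: real"]
    proof (intro nn_integral_mono_AE, eventually_elim)
      case (elim r)
      then show ?case
        using f_le[of r] s by (auto split: split_indicator)
    qed
    then have "ennreal b * (\<integral>\<^sup>+r\<in>{0..s}. f r \<partial>lborel)
        \<le> ennreal b * (\<integral>\<^sup>+r\<in>{0..s}. m * ennreal (exp (2 * b * r)) \<partial>lborel)"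
      by (rule mult_left_mono) simp
    also have "\<dots> = m * (\<integral>\<^sup>+r. ennreal (b * exp (2 * b * r)) * indicator {0..s} r \<partial>lborel)"
      using b by (simp add: nn_integral_cmult[symmetric] ennreal_mult mult_ac)
    \<comment> \<open>The weight grows at twice the rate \<open>b\<close>, so integrating it against
      \<open>b\<close> returns at most half of it. This is the source of both factors 2 in the
      conclusion.\<close>
    also have "(\<integral>\<^sup>+r. ennreal (b * exp (2 * b * r)) * indicator {0..s} r \<partial>lborel)
        = ennreal (exp (2 * b * s) / 2 - exp (2 * b * 0) / 2)"
      using b s
      by (intro nn_integral_FTC_Icc[where F = "\<lambda>r. exp (2 * b * r) / 2"])
         (auto intro!: derivative_eq_intros)
    also have "m * \<dots> \<le> m * ennreal (exp (2 * b * s) * (1 / 2))"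
      by (intro mult_left_mono ennreal_leI) auto
    finally have "f s \<le> a + m * ennreal (exp (2 * b * s) * (1 / 2))"
      using f[OF s] by (meson add_left_mono order_trans)
    then have "f s * ennreal (exp (- 2 * b * s))
        \<le> (a + m * ennreal (exp (2 * b * s) * (1 / 2))) * ennreal (exp (- 2 * b * s))"
      by (rule mult_right_mono) simp
    also have "\<dots> = a * ennreal (exp (- 2 * b * s)) + m * ennreal (1 / 2)"
      by (simp add: distrib_right mult.assoc ennreal_mult'[symmetric] exp_minus)
    also have "\<dots> \<le> a * 1 + m * ennreal (1 / 2)"
    proof (intro add_mono mult_left_mono order_refl)
      have "ennreal (exp (- 2 * b * s)) \<le> ennreal 1"
        using b s by (intro ennreal_leI) auto
      then show "ennreal (exp (- 2 * b * s)) \<le> 1" by simp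
    qed auto
    finally show "f s * ennreal (exp (- 2 * b * s)) \<le> a + m * ennreal (1 / 2)" by simp
  qed
  have m_le: "m \<le> 2 * a"
  proof (cases a)
    case (real a')
    obtain m' where m': "m = ennreal m'" "0 \<le> m'"
      using m_fin by (cases m) auto
    have "ennreal m' \<le> ennreal (a' + m' * (1 / 2))"
      using \<open>m \<le> a + m * ennreal (1 / 2)\<close> real m' by (simp add: ennreal_mult[symmetric] del: ennreal_half)
    then have "m' \<le> 2 * a'"
      using real m' by (subst (asm) ennreal_le_iff) auto
    then have "ennreal m' \<le> ennreal (2 * a')" by (rule ennreal_leI)
    then show ?thesis
      using real m' by (simp add: ennreal_mult)
  qed (simp add: ennreal_mult_top)
  have "f t \<le> m * ennreal (exp (2 * b * t))" by (rule f_le[OF t])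
  also have "\<dots> \<le> 2 * a * ennreal (exp (2 * b * T))"
    using b t m_le by (intro mult_mono ennreal_leI) (auto intro: mult_left_mono)
  finally show ?thesis .
qed

text \<open>Cauchy--Schwarz against the indicator of \<open>{0..t}\<close>. The right-hand side is
  an \<open>ennreal\<close>, so \<open>f\<close> may fail to be square integrable.\<close>

lemma set_integral_square_le:
  fixes f :: "real \<Rightarrow> real"
  assumes f: "set_integrable lborel {0..t} f" and "0 \<le> t"
  shows "ennreal ((LINT s:{0..t}|lborel. f s)\<^sup>2) \<le> ennreal t * (\<integral>\<^sup>+s\<in>{0..t}. ennreal ((f s)\<^sup>2) \<partial>lborel)"
proof -
  let ?g = "\<lambda>s. indicator {0..t} s *\<^sub>R f s"
  have [measurable]: "?g \<in> borel_measurable lborel"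
    using f unfolding set_integrable_def by (rule borel_measurable_integrable)
  have "ennreal \<bar>LINT s:{0..t}|lborel. f s\<bar> \<le> (\<integral>\<^sup>+s. ennreal \<bar>?g s\<bar> \<partial>lborel)"
    using integral_norm_bound_ennreal[of lborel ?g] f
    unfolding set_lebesgue_integral_def set_integrable_def by simp
  also have "\<dots> = (\<integral>\<^sup>+s. ennreal \<bar>?g s\<bar> * indicator {0..t} s \<partial>lborel)"
    by (intro nn_integral_cong) (auto split: split_indicator)
  finally have "(ennreal \<bar>LINT s:{0..t}|lborel. f s\<bar>)\<^sup>2 \<le> (\<integral>\<^sup>+s. ennreal \<bar>?g s\<bar> * indicator {0..t} s \<partial>lborel)\<^sup>2"
    by (rule power_mono) simp
  also have "\<dots> \<le> (\<integral>\<^sup>+s. (ennreal \<bar>?g s\<bar>)\<^sup>2 \<partial>lborel) * (\<integral>\<^sup>+s. (indicator {0..t} s)\<^sup>2 \<partial>lborel)"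
    by (rule Cauchy_Schwarz_nn_integral) measurable
  also have "(\<integral>\<^sup>+s. (indicator {0..t} s :: ennreal)\<^sup>2 \<partial>lborel) = (\<integral>\<^sup>+s. indicator {0..t} s \<partial>lborel)"
    by (intro nn_integral_cong) (auto split: split_indicator)
  also have "\<dots> = ennreal t"
    using assms(2) by simp
  also have "(\<integral>\<^sup>+s. (ennreal \<bar>?g s\<bar>)\<^sup>2 \<partial>lborel) = (\<integral>\<^sup>+s\<in>{0..t}. ennreal ((f s)\<^sup>2) \<partial>lborel)"
    by (intro nn_integral_cong) (auto split: split_indicator simp: ennreal_power)
  finally show ?thesis
    by (simp add: ennreal_power mult.commute)
qed

context brownian_space
begin

text \<open>Sampling at the multiple of \<open>1 / (n + 1)\<close> to the left of the time involves
  countably many random variables, and path continuity gives convergence.\<close>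

lemma continuous_paths_pair:
  assumes "\<And>t. 0 \<le> t \<Longrightarrow> D t \<in> borel_measurable M" "continuous_paths M D"
  shows "(\<lambda>(\<omega>, s). D (max 0 s) \<omega>) \<in> borel_measurable (M \<Otimes>\<^sub>M lborel)"
proof (rule borel_measurable_LIMSEQ_real)
  define x where "x n s = real (nat \<lfloor>real (Suc n) * max 0 s\<rfloor>) / real (Suc n)" for n :: nat and s :: real
  have [measurable]: "D (real i / real (Suc n)) \<in> borel_measurable M" for i n
    by (intro assms(1)) auto
  show "(\<lambda>(\<omega>, s). D (x n s) \<omega>) \<in> borel_measurable (M \<Otimes>\<^sub>M lborel)" for n
    unfolding x_def split_beta'
    by (rule measurable_compose_countable[where f = "\<lambda>i p. D (real i / real (Suc n)) (fst p)"
          and g = "\<lambda>p. nat \<lfloor>real (Suc n) * max 0 (snd p)\<rfloor>"]) measurable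
  show "(\<lambda>n. (case p of (\<omega>, s) \<Rightarrow> D (x n s) \<omega>)) \<longlonglongrightarrow> (case p of (\<omega>, s) \<Rightarrow> D (max 0 s) \<omega>)"
    if p: "p \<in> space (M \<Otimes>\<^sub>M lborel)" for p
  proof -
    obtain \<omega> s where ps: "p = (\<omega>, s)" "\<omega> \<in> space M"
      using p by (auto simp: space_pair_measure)
    have "(\<lambda>n. x n s) \<longlonglongrightarrow> max 0 s"
    proof (rule tendsto_sandwich[of "\<lambda>n. max 0 s - 1 / real (Suc n)" _ _ "\<lambda>n. max 0 s"])
      show "\<forall>\<^sub>F n in sequentially. max 0 s - 1 / real (Suc n) \<le> x n s"
      proof (intro always_eventually allI)
        fix n
        have "real (Suc n) * max 0 s - 1 \<le> real (nat \<lfloor>real (Suc n) * max 0 s\<rfloor>)"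
          by linarith
        then have "(real (Suc n) * max 0 s - 1) / real (Suc n) \<le> x n s"
          unfolding x_def by (intro divide_right_mono) auto
        then show "max 0 s - 1 / real (Suc n) \<le> x n s"
          by (simp add: diff_divide_distrib del: of_nat_Suc)
      qed
      show "\<forall>\<^sub>F n in sequentially. x n s \<le> max 0 s"
      proof (intro always_eventually allI)
        fix n
        have "0 \<le> real (Suc n) * max 0 s" by simp
        then have "real (nat \<lfloor>real (Suc n) * max 0 s\<rfloor>) \<le> real (Suc n) * max 0 s"
          by linarith
        then have "x n s \<le> (real (Suc n) * max 0 s) / real (Suc n)"
          unfolding x_def by (intro divide_right_mono) auto
        then show "x n s \<le> max 0 s"
          by (simp del: of_nat_Suc)
      qed
      have "(\<lambda>n. max 0 s - 1 / real (Suc n)) \<longlonglongrightarrow> max 0 s - 0"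
        by (intro tendsto_diff tendsto_const LIMSEQ_inverse_real_of_nat[unfolded inverse_eq_divide])
      then show "(\<lambda>n. max 0 s - 1 / real (Suc n)) \<longlonglongrightarrow> max 0 s" by simp
    qed simp
    moreover have "continuous_on {0..} (\<lambda>t. D t \<omega>)"
      using assms(2) ps(2) by (simp add: continuous_paths_def)
    ultimately have "(\<lambda>n. D (x n s) \<omega>) \<longlonglongrightarrow> D (max 0 s) \<omega>"
      by (intro continuous_on_tendsto_compose[of "{0..}" "\<lambda>t. D t \<omega>" "\<lambda>n. x n s"]) (auto simp: x_def)
    then show ?thesis by (simp add: ps)
  qed
qed

end

text \<open>The factor 3 comes from squaring the sum of initial value, drift and stochastic
  integral, \<open>T\<close> from Cauchy--Schwarz for the drift, 8 from the maximal inequality, and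
  \<open>1 + T\<close> from the current value together with the history integral.\<close>

definition gronwall_rate :: "real \<Rightarrow> real \<Rightarrow> real" where
  "gronwall_rate c T = 3 * (T + 8) * (c * (1 + T))"

text \<open>\<open>3 * (1 + (T + 8) * T)\<close> collects initial value and forcing; the other
  factor inserts the Gronwall bound for fixed times back into the estimate of the supremum.\<close>

definition gronwall_const :: "real \<Rightarrow> real \<Rightarrow> real" where
  "gronwall_const c T =
     3 * (1 + (T + 8) * T) * (1 + 2 * gronwall_rate c T * T * exp (2 * gronwall_rate c T * T))"

lemma gronwall_const_pos:
  assumes "0 \<le> c" "0 \<le> T"
  shows "0 < gronwall_const c T"
  using assms unfolding gronwall_const_def gronwall_rate_def
  by (intro mult_pos_pos add_pos_nonneg mult_nonneg_nonneg) auto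

lemma stays_below_mono: "stays_below Y K t \<omega> \<Longrightarrow> s \<le> t \<Longrightarrow> stays_below Y K s \<omega>"
  by (auto simp: stays_below_def)

lemma stays_below_bound: "K \<le> K' \<Longrightarrow> stays_below Y K t \<omega> \<Longrightarrow> stays_below Y K' t \<omega>"
  unfolding stays_below_def by (meson order_trans)

lemma stays_below_D:
  assumes "stays_below Y K t \<omega>" "r \<in> \<rat> \<inter> {0..<t}"
  shows "Y r \<omega> \<le> K"
proof -
  have "r \<in> range nonneg_rat" using assms(2) by (simp add: range_nonneg_rat)
  then show ?thesis using assms by (auto simp: stays_below_def)
qed

lemma square_sum3_ennreal:
  fixes x y z :: real
  shows "ennreal ((x + y + z)\<^sup>2) \<le> 3 * (ennreal (x\<^sup>2) + (ennreal (y\<^sup>2) + ennreal (z\<^sup>2)))"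
proof -
  have "0 \<le> (x - y)\<^sup>2 + (y - z)\<^sup>2 + (x - z)\<^sup>2" by simp
  then have "(x + y + z)\<^sup>2 \<le> 3 * (x\<^sup>2 + (y\<^sup>2 + z\<^sup>2))"
    by (simp add: power2_eq_square algebra_simps)
  then have "ennreal ((x + y + z)\<^sup>2) \<le> ennreal (3 * (x\<^sup>2 + (y\<^sup>2 + z\<^sup>2)))"
    by (rule ennreal_leI)
  then show ?thesis by (simp add: ennreal_mult)
qed

context brownian_space
begin

text \<open>The forcing \<open>\<Gamma>\<close> is random, since it will carry the truncation error
  times the history of \<open>S\<close>. Neither \<open>X1 - X2\<close> nor \<open>\<Gamma>\<close>
  is assumed integrable: the difference is cut off at a level \<open>K\<close>, the bound obtained
  does not depend on \<open>K\<close>, and \<open>ennreal\<close> admits an infinite right-hand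
  side.\<close>

lemma stochastic_gronwall:
  assumes X1: "ito_process M W x1 B1 A1 X1" and X2: "ito_process M W x2 B2 A2 X2"
    and T: "0 < T" and c: "0 \<le> c" and \<Gamma> [measurable]: "\<Gamma> \<in> borel_measurable M"
    and bound: "AE \<omega> in M. \<forall>s\<in>{0<..T}.
      ennreal ((B1 s \<omega> - B2 s \<omega>)\<^sup>2) \<le> \<Gamma> \<omega> + ennreal c * (ennreal ((X1 s \<omega> - X2 s \<omega>)\<^sup>2)
        + (\<integral>\<^sup>+r\<in>{0..s}. ennreal ((X1 r \<omega> - X2 r \<omega>)\<^sup>2) \<partial>lborel)) \<and>
      ennreal ((A1 s \<omega> - A2 s \<omega>)\<^sup>2) \<le> \<Gamma> \<omega> + ennreal c * (ennreal ((X1 s \<omega> - X2 s \<omega>)\<^sup>2)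
        + (\<integral>\<^sup>+r\<in>{0..s}. ennreal ((X1 r \<omega> - X2 r \<omega>)\<^sup>2) \<partial>lborel))"
  shows "(\<integral>\<^sup>+\<omega>. (SUP t\<in>{0..T}. ennreal ((X1 t \<omega> - X2 t \<omega>)\<^sup>2)) \<partial>M)
    \<le> ennreal (gronwall_const c T) * (ennreal ((x1 - x2)\<^sup>2) + (\<integral>\<^sup>+\<omega>. \<Gamma> \<omega> \<partial>M))"
proof -
  interpret P: pair_sigma_finite M "lborel :: real measure" by unfold_locales
  define D where "D t \<omega> = X1 t \<omega> - X2 t \<omega>" for t \<omega>
  define Y where "Y t \<omega> = \<bar>D t \<omega>\<bar>" for t \<omega>
  obtain I1 where I1: "ito_integral M W A1 I1"
    "AE \<omega> in M. \<forall>t\<ge>0. X1 t \<omega> = x1 + (LINT s:{0..t}|lborel. B1 s \<omega>) + I1 t \<omega>"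
    using X1 by (auto simp: ito_process_def)
  obtain I2 where I2: "ito_integral M W A2 I2"
    "AE \<omega> in M. \<forall>t\<ge>0. X2 t \<omega> = x2 + (LINT s:{0..t}|lborel. B2 s \<omega>) + I2 t \<omega>"
    using X2 by (auto simp: ito_process_def)
  have XF: "\<And>t. 0 \<le> t \<Longrightarrow> X1 t \<in> borel_measurable (F t)" "\<And>t. 0 \<le> t \<Longrightarrow> X2 t \<in> borel_measurable (F t)"
    and Xc: "continuous_paths M X1" "continuous_paths M X2"
    using X1 X2 by (auto simp: ito_process_def adapted_def)
  have YF: "adapted F Y"
    unfolding adapted_def Y_def D_def by (auto intro!: borel_measurable_abs borel_measurable_diff XF)
  note YM = adapted_measurable[OF YF]
  have DM: "D t \<in> borel_measurable M" if "0 \<le> t" for t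
    unfolding D_def using XF[OF that] by (intro borel_measurable_diff F_measurable_M[of _ t]) auto
  have Dc: "continuous_on {0..} (\<lambda>t. D t \<omega>)" if "\<omega> \<in> space M" for \<omega>
    unfolding D_def using Xc that by (auto simp: continuous_paths_def intro!: continuous_on_diff)
  have D_pair [measurable]: "(\<lambda>(\<omega>, s). D (max 0 s) \<omega>) \<in> borel_measurable (M \<Otimes>\<^sub>M lborel)"
    using Dc DM by (intro continuous_paths_pair) (auto simp: continuous_paths_def)
  have IM: "I1 t \<in> borel_measurable M" "I2 t \<in> borel_measurable M" if "0 \<le> t" for t
    using I1(1) I2(1) that by (auto simp: ito_integral_def intro: adapted_measurable)
  have D_eq: "AE \<omega> in M. \<forall>t\<in>{0..T}. D t \<omega> = (x1 - x2) + (LINT s:{0..t}|lborel. B1 s \<omega> - B2 s \<omega>)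
        + (I1 t \<omega> - I2 t \<omega>) \<and> set_integrable lborel {0..t} (\<lambda>s. B1 s \<omega> - B2 s \<omega>)"
  proof -
    have "AE \<omega> in M. set_integrable lborel {0..T} (\<lambda>s. B1 s \<omega>)"
      "AE \<omega> in M. set_integrable lborel {0..T} (\<lambda>s. B2 s \<omega>)"
      using X1 X2 T by (auto simp: ito_process_def)
    then show ?thesis
      using I1(2) I2(2)
    proof eventually_elim
      case (elim \<omega>)
      have "set_integrable lborel {0..t} (\<lambda>s. B1 s \<omega>)" "set_integrable lborel {0..t} (\<lambda>s. B2 s \<omega>)"
        if "t \<in> {0..T}" for t
        using that by (auto intro: set_integrable_subset[OF elim(1)] set_integrable_subset[OF elim(2)])
      then show ?case
        using elim(3,4) by (auto simp: D_def set_integral_diff)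
    qed
  qed
  define x where "x = ennreal ((x1 - x2)\<^sup>2)"
  define E\<Gamma> where "E\<Gamma> = (\<integral>\<^sup>+\<omega>. \<Gamma> \<omega> \<partial>M)"
  define b where "b = gronwall_rate c T"
  define a where "a = 3 * x + ennreal (3 * (T + 8) * T) * E\<Gamma>"
  have b: "0 \<le> b"
    using c T by (simp add: b_def gronwall_rate_def)
  have localized: "(\<integral>\<^sup>+\<omega>. (SUP t\<in>\<rat> \<inter> {0..T}. ennreal ((D t \<omega>)\<^sup>2) * of_bool (stays_below Y K t \<omega>)) \<partial>M)
      \<le> ennreal (gronwall_const c T) * (x + E\<Gamma>)" for K :: real
  proof -
    define g :: "real \<Rightarrow> 'w \<Rightarrow> ennreal" where "g s \<omega> = of_bool (stays_below Y K s \<omega>)" for s \<omega>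
    define q where "q s \<omega> = ennreal ((D (max 0 s) \<omega>)\<^sup>2) * g s \<omega>" for s \<omega>
    define \<phi> where "\<phi> s = (\<integral>\<^sup>+\<omega>. q s \<omega> \<partial>M)" for s
    define Q where "Q t \<omega> = (\<integral>\<^sup>+s\<in>{0..t}. q s \<omega> \<partial>lborel)" for t \<omega>
    define SD where "SD t \<omega> = (SUP r\<in>\<rat> \<inter> {0..t}. ennreal ((D r \<omega>)\<^sup>2) * g r \<omega>)" for t \<omega>
    define SI where "SI t \<omega> = (SUP r\<in>\<rat> \<inter> {0..t}. ennreal ((I1 r \<omega> - I2 r \<omega>)\<^sup>2) * g r \<omega>)" for t \<omega>
    note [measurable] = stays_below_measurable_pair[OF YM] stays_below_measurable[OF YM]
    have g_pair [measurable]: "(\<lambda>(\<omega>, s). g s \<omega>) \<in> borel_measurable (M \<Otimes>\<^sub>M lborel)"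
      unfolding g_def by measurable
    have q_pair [measurable]: "(\<lambda>(\<omega>, s). q s \<omega>) \<in> borel_measurable (M \<Otimes>\<^sub>M lborel)"
      unfolding q_def by measurable
    have [measurable]: "(\<lambda>s. q s \<omega>) \<in> borel_measurable borel" if "\<omega> \<in> space M" for \<omega>
      using measurable_Pair2[OF q_pair that] by simp
    have [measurable]: "q s \<in> borel_measurable M" for s
      using measurable_Pair1[OF q_pair, of s] by simp
    have [measurable]: "\<phi> \<in> borel_measurable borel"
      using borel_measurable_nn_integral[of "\<lambda>s \<omega>. q s \<omega>" lborel] measurable_pair_swap[OF q_pair]
      unfolding \<phi>_def by simp
    have [measurable]: "Q t \<in> borel_measurable M" for t
      unfolding Q_def by measurable
    have [measurable]: "SI t \<in> borel_measurable M" for t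
      unfolding SI_def g_def using IM
      by (intro borel_measurable_SUP countable_Rats_Int) auto
    have Q_\<phi>: "(\<integral>\<^sup>+\<omega>. Q t \<omega> \<partial>M) = (\<integral>\<^sup>+s\<in>{0..t}. \<phi> s \<partial>lborel)" for t
    proof -
      have "(\<integral>\<^sup>+\<omega>. Q t \<omega> \<partial>M) = (\<integral>\<^sup>+s. \<integral>\<^sup>+\<omega>. q s \<omega> * indicator {0..t} s \<partial>M \<partial>lborel)"
        unfolding Q_def by (rule P.Fubini'[symmetric]) measurable
      then show ?thesis
        unfolding \<phi>_def by (simp add: nn_integral_multc)
    qed
    \<comment> \<open>The cut-off passes inside the history integral: a path that stays below
      \<open>K\<close> up to \<open>s\<close> does so up to every earlier \<open>r\<close>. Hence
      the bound closes in terms of the cut-off quantity \<open>Q\<close>.\<close>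
    have coeff_le: "(\<integral>\<^sup>+s\<in>{0..t}. ennreal ((h s)\<^sup>2) * g s \<omega> \<partial>lborel)
        \<le> ennreal t * \<Gamma> \<omega> + ennreal (c * (1 + t)) * Q t \<omega>"
      if t: "t \<in> {0<..T}" and \<omega>: "\<omega> \<in> space M"
        and h: "\<And>s. s \<in> {0<..T} \<Longrightarrow> ennreal ((h s)\<^sup>2) \<le> \<Gamma> \<omega> + ennreal c * (ennreal ((D s \<omega>)\<^sup>2)
          + (\<integral>\<^sup>+r\<in>{0..s}. ennreal ((D r \<omega>)\<^sup>2) \<partial>lborel))" for t \<omega> and h :: "real \<Rightarrow> real"
    proof -
      have "(\<integral>\<^sup>+s\<in>{0..t}. ennreal ((h s)\<^sup>2) * g s \<omega> \<partial>lborel)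
          \<le> (\<integral>\<^sup>+s. \<Gamma> \<omega> * indicator {0..t} s + ennreal c * (q s \<omega> * indicator {0..t} s + Q t \<omega> * indicator {0..t} s) \<partial>lborel)"
        using AE_lborel_singleton[of "0 :: real"]
      proof (intro nn_integral_mono_AE, eventually_elim)
        case (elim s)
        show ?case
        proof (cases "s \<in> {0..t} \<and> stays_below Y K s \<omega>")
          case True
          then have s: "s \<in> {0<..T}" and s': "s \<in> {0..t}"
            using elim t by auto
          have "(\<integral>\<^sup>+r\<in>{0..s}. ennreal ((D r \<omega>)\<^sup>2) \<partial>lborel) \<le> Q t \<omega>"
            unfolding Q_def
          proof (rule nn_integral_mono)
            fix r
            show "ennreal ((D r \<omega>)\<^sup>2) * indicator {0..s} r \<le> q r \<omega> * indicator {0..t} r"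
              using s' True stays_below_mono[of Y K s \<omega> r]
              by (auto simp: q_def g_def split: split_indicator)
          qed
          then have "\<Gamma> \<omega> + ennreal c * (ennreal ((D s \<omega>)\<^sup>2) + (\<integral>\<^sup>+r\<in>{0..s}. ennreal ((D r \<omega>)\<^sup>2) \<partial>lborel))
              \<le> \<Gamma> \<omega> + ennreal c * (ennreal ((D s \<omega>)\<^sup>2) + Q t \<omega>)"
            by (intro add_left_mono mult_left_mono) auto
          with h[OF s] have "ennreal ((h s)\<^sup>2) \<le> \<Gamma> \<omega> + ennreal c * (ennreal ((D s \<omega>)\<^sup>2) + Q t \<omega>)"
            by (rule order_trans)
          then show ?thesis
            using s s' True by (simp add: q_def g_def)
        next
          case False
          then show ?thesis by (auto simp: g_def split: split_indicator)
        qed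
      qed
      also have "\<dots> = ennreal t * \<Gamma> \<omega> + ennreal c * (Q t \<omega> + Q t \<omega> * ennreal t)"
      proof -
        have "(\<integral>\<^sup>+s. k * indicator {0..t} s \<partial>lborel) = k * ennreal t" for k
          using t by (simp add: nn_integral_cmult_indicator)
        then show ?thesis
          using \<omega> unfolding mult.commute[of "ennreal t" "\<Gamma> \<omega>"]
          by (simp add: nn_integral_add nn_integral_cmult Q_def[symmetric])
      qed
      also have "ennreal c * (Q t \<omega> + Q t \<omega> * ennreal t) = ennreal (c * (1 + t)) * Q t \<omega>"
        using c t by (simp add: ennreal_mult distrib_left distrib_right mult_ac)
      finally show ?thesis .
    qed
    have step: "(\<integral>\<^sup>+\<omega>. SD t \<omega> \<partial>M) \<le> a + ennreal b * (\<integral>\<^sup>+s\<in>{0..t}. \<phi> s \<partial>lborel)"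
      if t: "t \<in> {0<..T}" for t
    proof -
      define Z where "Z \<omega> = ennreal t * \<Gamma> \<omega> + ennreal (c * (1 + t)) * Q t \<omega>" for \<omega>
      have [measurable]: "Z \<in> borel_measurable M"
        unfolding Z_def by measurable
      have "AE \<omega> in M. SD t \<omega> \<le> 3 * (x + (ennreal t * Z \<omega> + SI t \<omega>))"
        using D_eq bound AE_space
      proof eventually_elim
        case (elim \<omega>)
        have BZ: "(\<integral>\<^sup>+s\<in>{0..t}. ennreal ((B1 s \<omega> - B2 s \<omega>)\<^sup>2) * g s \<omega> \<partial>lborel) \<le> Z \<omega>"
          unfolding Z_def using elim by (intro coeff_le t) (auto simp: D_def)
        show ?case
          unfolding SD_def
        proof (rule SUP_least)
          fix r assume r: "r \<in> \<rat> \<inter> {0..t}"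
          show "ennreal ((D r \<omega>)\<^sup>2) * g r \<omega> \<le> 3 * (x + (ennreal t * Z \<omega> + SI t \<omega>))"
          proof (cases "stays_below Y K r \<omega>")
            case True
            have "r \<in> {0..T}" using r t by auto
            with elim(1) have D: "D r \<omega> = (x1 - x2) + (LINT s:{0..r}|lborel. B1 s \<omega> - B2 s \<omega>) + (I1 r \<omega> - I2 r \<omega>)"
              and int: "set_integrable lborel {0..r} (\<lambda>s. B1 s \<omega> - B2 s \<omega>)" by auto
            have "ennreal ((LINT s:{0..r}|lborel. B1 s \<omega> - B2 s \<omega>)\<^sup>2)
                \<le> ennreal r * (\<integral>\<^sup>+s\<in>{0..r}. ennreal ((B1 s \<omega> - B2 s \<omega>)\<^sup>2) \<partial>lborel)"
              using r by (intro set_integral_square_le int) auto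
            also have "\<dots> \<le> ennreal t * (\<integral>\<^sup>+s\<in>{0..t}. ennreal ((B1 s \<omega> - B2 s \<omega>)\<^sup>2) * g s \<omega> \<partial>lborel)"
            proof (rule mult_mono[OF ennreal_leI nn_integral_mono])
              fix s
              show "ennreal ((B1 s \<omega> - B2 s \<omega>)\<^sup>2) * indicator {0..r} s
                  \<le> ennreal ((B1 s \<omega> - B2 s \<omega>)\<^sup>2) * g s \<omega> * indicator {0..t} s"
                using r True stays_below_mono[of Y K r \<omega> s]
                by (auto simp: g_def split: split_indicator)
            qed (use r in auto)
            also have "\<dots> \<le> ennreal t * Z \<omega>"
              by (intro mult_left_mono BZ) simp
            finally have 1: "ennreal ((LINT s:{0..r}|lborel. B1 s \<omega> - B2 s \<omega>)\<^sup>2) \<le> ennreal t * Z \<omega>" .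
            have 2: "ennreal ((I1 r \<omega> - I2 r \<omega>)\<^sup>2) \<le> SI t \<omega>"
              unfolding SI_def using r True by (intro SUP_upper2[of r]) (auto simp: g_def)
            have "ennreal ((D r \<omega>)\<^sup>2) \<le> 3 * (x + (ennreal t * Z \<omega> + SI t \<omega>))"
              unfolding D x_def
              by (rule order_trans[OF square_sum3_ennreal]) (intro mult_left_mono add_mono order_refl 1 2 zero_le)
            then show ?thesis using True by (simp add: g_def)
          qed (simp add: g_def)
        qed
      qed
      then have "(\<integral>\<^sup>+\<omega>. SD t \<omega> \<partial>M) \<le> (\<integral>\<^sup>+\<omega>. 3 * (x + (ennreal t * Z \<omega> + SI t \<omega>)) \<partial>M)"
        by (rule nn_integral_mono_AE)
      also have "\<dots> = 3 * (x + (ennreal t * (\<integral>\<^sup>+\<omega>. Z \<omega> \<partial>M) + (\<integral>\<^sup>+\<omega>. SI t \<omega> \<partial>M)))"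
        by (simp add: nn_integral_cmult nn_integral_add emeasure_space_1)
      also have "(\<integral>\<^sup>+\<omega>. SI t \<omega> \<partial>M) \<le> 8 * (\<integral>\<^sup>+\<omega>. Z \<omega> \<partial>M)"
      proof -
        have "(\<integral>\<^sup>+\<omega>. SI t \<omega> \<partial>M) \<le> 8 * (\<integral>\<^sup>+\<omega>. (\<integral>\<^sup>+s\<in>{0..t}. ennreal ((A1 s \<omega> - A2 s \<omega>)\<^sup>2) * g s \<omega> \<partial>lborel) \<partial>M)"
          unfolding SI_def g_def using t by (intro ito_integral_maximal I1 I2 YF) auto
        also have "\<dots> \<le> 8 * (\<integral>\<^sup>+\<omega>. Z \<omega> \<partial>M)"
          using bound AE_space[of M]
        proof (intro mult_left_mono nn_integral_mono_AE, eventually_elim)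
          case (elim \<omega>)
          then show ?case
            unfolding Z_def by (intro coeff_le t) (auto simp: D_def)
        qed simp
        finally show ?thesis .
      qed
      finally have "(\<integral>\<^sup>+\<omega>. SD t \<omega> \<partial>M)
          \<le> 3 * (x + (ennreal t * (\<integral>\<^sup>+\<omega>. Z \<omega> \<partial>M) + 8 * (\<integral>\<^sup>+\<omega>. Z \<omega> \<partial>M)))"
        by (simp add: add_left_mono mult_left_mono)
      also have "ennreal t * (\<integral>\<^sup>+\<omega>. Z \<omega> \<partial>M) + 8 * (\<integral>\<^sup>+\<omega>. Z \<omega> \<partial>M) = ennreal (t + 8) * (\<integral>\<^sup>+\<omega>. Z \<omega> \<partial>M)"
        using t by (simp add: distrib_right)
      also have "(\<integral>\<^sup>+\<omega>. Z \<omega> \<partial>M) = ennreal t * E\<Gamma> + ennreal (c * (1 + t)) * (\<integral>\<^sup>+s\<in>{0..t}. \<phi> s \<partial>lborel)"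
        unfolding Z_def E\<Gamma>_def by (simp add: nn_integral_add nn_integral_cmult Q_\<phi>)
      also have "3 * (x + ennreal (t + 8) * \<dots>)
          \<le> 3 * (x + ennreal (T + 8) * (ennreal T * E\<Gamma> + ennreal (c * (1 + T)) * (\<integral>\<^sup>+s\<in>{0..t}. \<phi> s \<partial>lborel)))"
        using t c by (intro mult_mono add_mono order_refl ennreal_leI) (auto intro: mult_left_mono)
      also have "\<dots> = a + ennreal b * (\<integral>\<^sup>+s\<in>{0..t}. \<phi> s \<partial>lborel)"
      proof -
        have mult3: "ennreal (3 * u * v) = 3 * ennreal u * ennreal v" if "0 \<le> u" "0 \<le> v" for u v
          using that by (simp add: ennreal_mult)
        have "ennreal (3 * (T + 8) * T) = 3 * ennreal (T + 8) * ennreal T"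
          "ennreal b = 3 * ennreal (T + 8) * ennreal (c * (1 + T))"
          unfolding b_def gronwall_rate_def using c T by (intro mult3; simp)+
        then show ?thesis
          unfolding a_def by (simp only: distrib_left mult_ac add.assoc)
      qed
      finally show ?thesis .
    qed
    \<comment> \<open>Limits along rationals from the left transfer both bounds to \<open>t\<close>.
      At time 0 nothing has been checked and \<open>K^2\<close> need not bound the initial
      difference, which is why Gronwall's lemma is stated on \<open>{0<..T}\<close>.\<close>
    have q_le: "q t \<omega> \<le> SD t \<omega> \<and> q t \<omega> \<le> ennreal (K\<^sup>2)"
      if t: "t \<in> {0<..T}" and \<omega>: "\<omega> \<in> space M" for t \<omega>
    proof (cases "stays_below Y K t \<omega>")
      case True
      obtain z where z: "\<And>n. z n \<in> \<rat> \<inter> {0..<t}" "z \<longlonglongrightarrow> t"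
        using rational_sequence_less[of t] t by auto
      have "(\<lambda>n. D (z n) \<omega>) \<longlonglongrightarrow> D t \<omega>"
        using z t by (intro continuous_on_tendsto_compose[OF Dc[OF \<omega>] z(2)]) (auto intro: always_eventually)
      then have lim: "(\<lambda>n. ennreal ((D (z n) \<omega>)\<^sup>2)) \<longlonglongrightarrow> ennreal ((D t \<omega>)\<^sup>2)"
        by (intro tendsto_ennrealI tendsto_power)
      have "ennreal ((D (z n) \<omega>)\<^sup>2) \<le> SD t \<omega>" for n
        unfolding SD_def using z(1)[of n] stays_below_mono[OF True, of "z n"]
        by (intro SUP_upper2[of "z n"]) (auto simp: g_def)
      then have 1: "ennreal ((D t \<omega>)\<^sup>2) \<le> SD t \<omega>"
        using LIMSEQ_le_const2[OF lim] by blast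
      have "ennreal ((D (z n) \<omega>)\<^sup>2) \<le> ennreal (K\<^sup>2)" for n
        using stays_below_D[OF True z(1)[of n]] unfolding Y_def
        by (intro ennreal_leI) (simp add: abs_le_square_iff[symmetric])
      then have "ennreal ((D t \<omega>)\<^sup>2) \<le> ennreal (K\<^sup>2)"
        using LIMSEQ_le_const2[OF lim] by blast
      with 1 show ?thesis
        using True t by (simp add: q_def g_def)
    qed (simp add: q_def g_def)
    have \<phi>_SD: "\<phi> t \<le> (\<integral>\<^sup>+\<omega>. SD t \<omega> \<partial>M)" if "t \<in> {0<..T}" for t
      unfolding \<phi>_def using q_le[OF that] by (intro nn_integral_mono) auto
    have \<phi>_K: "\<phi> t \<le> ennreal (K\<^sup>2)" if "t \<in> {0<..T}" for t
    proof -
      have "\<phi> t \<le> (\<integral>\<^sup>+\<omega>. ennreal (K\<^sup>2) \<partial>M)"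
        unfolding \<phi>_def using q_le[OF that] by (intro nn_integral_mono) auto
      then show ?thesis by (simp add: emeasure_space_1)
    qed
    have \<phi>_le: "\<phi> t \<le> 2 * a * ennreal (exp (2 * b * T))" if "t \<in> {0<..T}" for t
      using \<phi>_SD step by (intro gronwall_ennreal[OF _ b \<phi>_K _ that]) (auto intro: order_trans)
    \<comment> \<open>Gronwall's lemma bounds only expectations at fixed times; inserting this into
      \<open>step\<close> at \<open>T\<close> recovers the supremum.\<close>
    have "(\<integral>\<^sup>+s\<in>{0..T}. \<phi> s \<partial>lborel) \<le> (\<integral>\<^sup>+s\<in>{0..T}. 2 * a * ennreal (exp (2 * b * T)) \<partial>lborel)"
      using AE_lborel_singleton[of "0 :: real"]
    proof (intro nn_integral_mono_AE, eventually_elim)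
      case (elim s)
      then show ?case using \<phi>_le[of s] by (auto split: split_indicator)
    qed
    also have "\<dots> = 2 * a * ennreal (exp (2 * b * T)) * ennreal T"
      using T by (simp add: nn_integral_cmult_indicator)
    finally have "(\<integral>\<^sup>+\<omega>. SD T \<omega> \<partial>M) \<le> a + ennreal b * (2 * a * ennreal (exp (2 * b * T)) * ennreal T)"
      using T by (intro order_trans[OF step] add_left_mono mult_left_mono) auto
    also have "\<dots> = a * ennreal (1 + 2 * b * T * exp (2 * b * T))"
      using b T by (simp add: ennreal_mult distrib_left mult_ac)
    also have "a \<le> ennreal (3 * (1 + (T + 8) * T)) * (x + E\<Gamma>)"
    proof -
      have "3 * x \<le> ennreal (3 * (1 + (T + 8) * T)) * x"
        using T ennreal_leI[of 3 "3 * (1 + (T + 8) * T)"] by (intro mult_right_mono) auto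
      moreover have "ennreal (3 * (T + 8) * T) * E\<Gamma> \<le> ennreal (3 * (1 + (T + 8) * T)) * E\<Gamma>"
        using T by (intro mult_right_mono ennreal_leI) (auto simp: algebra_simps)
      ultimately show ?thesis
        unfolding a_def distrib_left by (rule add_mono)
    qed
    also have "ennreal (3 * (1 + (T + 8) * T)) * (x + E\<Gamma>) * ennreal (1 + 2 * b * T * exp (2 * b * T))
        = ennreal (gronwall_const c T) * (x + E\<Gamma>)"
      unfolding gronwall_const_def b_def[symmetric] using b T
      by (subst ennreal_mult) (auto simp: mult_ac)
    finally show ?thesis
      unfolding SD_def g_def by (simp add: mult_right_mono)
  qed
  \<comment> \<open>Every path is bounded on \<open>{0..T}\<close>, so some integer level covers it,
    and the suprema increase with the level.\<close>
  have "(\<integral>\<^sup>+\<omega>. (SUP t\<in>{0..T}. ennreal ((D t \<omega>)\<^sup>2)) \<partial>M)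
      \<le> (\<integral>\<^sup>+\<omega>. (SUP K::nat. SUP t\<in>\<rat> \<inter> {0..T}. ennreal ((D t \<omega>)\<^sup>2) * of_bool (stays_below Y (real K) t \<omega>)) \<partial>M)"
  proof (rule nn_integral_mono)
    fix \<omega> assume \<omega>: "\<omega> \<in> space M"
    have cont: "continuous_on {0..T} (\<lambda>t. D t \<omega>)"
      by (rule continuous_on_subset[OF Dc[OF \<omega>]]) auto
    then have "bounded ((\<lambda>t. D t \<omega>) ` {0..T})"
      by (intro compact_imp_bounded compact_continuous_image) auto
    then obtain C where "\<forall>t\<in>{0..T}. \<bar>D t \<omega>\<bar> \<le> C"
      by (auto simp: bounded_iff)
    then have C: "\<bar>D t \<omega>\<bar> \<le> C" if "t \<in> {0..T}" for t
      using that by blast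
    obtain K :: nat where "C \<le> real K"
      using real_arch_simple by blast
    then have "stays_below Y (real K) t \<omega>" if "t \<in> {0..T}" for t
      unfolding stays_below_def Y_def using C that by (auto intro!: order_trans[OF C])
    then have "(SUP t\<in>\<rat> \<inter> {0..T}. ennreal ((D t \<omega>)\<^sup>2))
        = (SUP t\<in>\<rat> \<inter> {0..T}. ennreal ((D t \<omega>)\<^sup>2) * of_bool (stays_below Y (real K) t \<omega>))"
      by (intro SUP_cong) auto
    also have "\<dots> \<le> (SUP K::nat. SUP t\<in>\<rat> \<inter> {0..T}. ennreal ((D t \<omega>)\<^sup>2) * of_bool (stays_below Y (real K) t \<omega>))"
      by (rule SUP_upper) simp
    finally show "(SUP t\<in>{0..T}. ennreal ((D t \<omega>)\<^sup>2)) \<le> \<dots>"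
      using SUP_rats_eq[OF T, of "\<lambda>t. (D t \<omega>)\<^sup>2"] cont by (simp add: continuous_on_power)
  qed
  also have "\<dots> = (SUP K::nat. \<integral>\<^sup>+\<omega>. (SUP t\<in>\<rat> \<inter> {0..T}. ennreal ((D t \<omega>)\<^sup>2) * of_bool (stays_below Y (real K) t \<omega>)) \<partial>M)"
  proof (rule nn_integral_monotone_convergence_SUP)
    show "incseq (\<lambda>K::nat. \<lambda>\<omega>. SUP t\<in>\<rat> \<inter> {0..T}. ennreal ((D t \<omega>)\<^sup>2) * of_bool (stays_below Y (real K) t \<omega>))"
    proof (intro incseq_SucI le_funI SUP_mono)
      fix K :: nat and \<omega> t assume t: "t \<in> \<rat> \<inter> {0..T}"
      have "ennreal ((D t \<omega>)\<^sup>2) * of_bool (stays_below Y (real K) t \<omega>)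
          \<le> ennreal ((D t \<omega>)\<^sup>2) * of_bool (stays_below Y (real (Suc K)) t \<omega>)"
        using stays_below_bound[of "real K" "real (Suc K)" Y t \<omega>] by auto
      with t show "\<exists>m\<in>\<rat> \<inter> {0..T}. ennreal ((D t \<omega>)\<^sup>2) * of_bool (stays_below Y (real K) t \<omega>)
          \<le> ennreal ((D m \<omega>)\<^sup>2) * of_bool (stays_below Y (real (Suc K)) m \<omega>)"
        by blast
    qed
    show "(\<lambda>\<omega>. SUP t\<in>\<rat> \<inter> {0..T}. ennreal ((D t \<omega>)\<^sup>2) * of_bool (stays_below Y (real K) t \<omega>)) \<in> borel_measurable M" for K :: nat
      using DM stays_below_measurable[OF YM]
      by (intro borel_measurable_SUP countable_Rats_Int) auto
  qed
  also have "\<dots> \<le> ennreal (gronwall_const c T) * (x + E\<Gamma>)"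
    by (intro SUP_least localized)
  finally show ?thesis
    unfolding D_def x_def E\<Gamma>_def .
qed

end

section \<open>The weighted space and the Laguerre basis\<close>

definition inner_L2w :: "real \<Rightarrow> (real \<Rightarrow> real) \<Rightarrow> (real \<Rightarrow> real) \<Rightarrow> real" where
  "inner_L2w p f g = (LINT \<xi>:{..0}|lborel. f \<xi> * g \<xi> * exp (p * \<xi>))"

lemma inner_w_inner_L2w: "inner_w p x y = fst x * fst y + inner_L2w p (snd x) (snd y)"
  by (simp add: inner_w_def inner_L2w_def)

lemma L2w_cut_measurable:
  "f \<in> L2w p \<Longrightarrow> (\<lambda>\<xi>. indicator {..0} \<xi> * f \<xi>) \<in> borel_measurable borel"
  by (simp add: L2w_def set_borel_measurable_def)

lemma L2wI:
  assumes "(\<lambda>\<xi>. indicator {..0} \<xi> * f \<xi>) \<in> borel_measurable borel"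
    and "set_integrable lborel {..0} g"
    and "\<And>\<xi>. \<xi> \<le> 0 \<Longrightarrow> (f \<xi>)\<^sup>2 * exp (p * \<xi>) \<le> g \<xi>"
  shows "f \<in> L2w p"
proof -
  have [measurable]: "(\<lambda>\<xi>. indicator {..0} \<xi> * f \<xi>) \<in> borel_measurable borel" by fact
  have eq: "(\<lambda>\<xi>. indicator {..0} \<xi> *\<^sub>R ((f \<xi>)\<^sup>2 * exp (p * \<xi>)))
      = (\<lambda>\<xi>. (indicator {..0} \<xi> * f \<xi>)\<^sup>2 * exp (p * \<xi>))"
    by (auto simp: indicator_def)
  have "set_borel_measurable lborel {..0} (\<lambda>\<xi>. (f \<xi>)\<^sup>2 * exp (p * \<xi>))"
    unfolding set_borel_measurable_def eq by measurable
  with assms(2) have "set_integrable lborel {..0} (\<lambda>\<xi>. (f \<xi>)\<^sup>2 * exp (p * \<xi>))"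
    by (rule set_integrable_bound) (auto intro!: AE_I2 order_trans[OF assms(3) abs_ge_self])
  then show ?thesis
    using assms(1) by (simp add: L2w_def set_borel_measurable_def)
qed

lemma inner_L2w_integrable:
  assumes "f \<in> L2w p" "g \<in> L2w p"
  shows "set_integrable lborel {..0} (\<lambda>\<xi>. f \<xi> * g \<xi> * exp (p * \<xi>))"
proof -
  have [measurable]: "(\<lambda>\<xi>. indicator {..0} \<xi> * f \<xi>) \<in> borel_measurable borel"
    "(\<lambda>\<xi>. indicator {..0} \<xi> * g \<xi>) \<in> borel_measurable borel"
    using assms by (auto intro: L2w_cut_measurable)
  \<comment> \<open>Representatives are measurable only after multiplication by the indicator, so
    the integrand is rewritten as a product of such cut functions.\<close>
  have eq: "(\<lambda>\<xi>. indicator {..0} \<xi> *\<^sub>R (f \<xi> * g \<xi> * exp (p * \<xi>)))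
      = (\<lambda>\<xi>. (indicator {..0} \<xi> * f \<xi>) * (indicator {..0} \<xi> * g \<xi>) * exp (p * \<xi>))"
    by (auto simp: indicator_def)
  have m: "set_borel_measurable lborel {..0} (\<lambda>\<xi>. f \<xi> * g \<xi> * exp (p * \<xi>))"
    unfolding set_borel_measurable_def eq by measurable
  have "set_integrable lborel {..0} (\<lambda>\<xi>. (f \<xi>)\<^sup>2 * exp (p * \<xi>) + (g \<xi>)\<^sup>2 * exp (p * \<xi>))"
    using assms by (intro set_integral_add) (auto simp: L2w_def)
  then show ?thesis
  proof (rule set_integrable_bound[OF _ m], intro AE_I2 impI)
    fix \<xi>
    have "\<bar>f \<xi> * g \<xi>\<bar> \<le> (f \<xi>)\<^sup>2 + (g \<xi>)\<^sup>2"
    proof -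
      have "0 \<le> (\<bar>f \<xi>\<bar> - \<bar>g \<xi>\<bar>)\<^sup>2" by simp
      then have "2 * \<bar>f \<xi> * g \<xi>\<bar> \<le> (f \<xi>)\<^sup>2 + (g \<xi>)\<^sup>2"
        by (simp add: power2_diff abs_mult)
      then show ?thesis using abs_ge_zero[of "f \<xi> * g \<xi>"] by linarith
    qed
    then have "\<bar>f \<xi> * g \<xi>\<bar> * exp (p * \<xi>) \<le> ((f \<xi>)\<^sup>2 + (g \<xi>)\<^sup>2) * exp (p * \<xi>)"
      by (intro mult_right_mono) auto
    then show "norm (f \<xi> * g \<xi> * exp (p * \<xi>)) \<le> norm ((f \<xi>)\<^sup>2 * exp (p * \<xi>) + (g \<xi>)\<^sup>2 * exp (p * \<xi>))"
      by (simp add: abs_mult distrib_right)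
  qed
qed

lemma L2w_cmult: "f \<in> L2w p \<Longrightarrow> (\<lambda>\<xi>. c * f \<xi>) \<in> L2w p"
proof (rule L2wI)
  assume f: "f \<in> L2w p"
  show "(\<lambda>\<xi>. indicator {..0} \<xi> * (c * f \<xi>)) \<in> borel_measurable borel"
    using borel_measurable_times[OF borel_measurable_const[of c] L2w_cut_measurable[OF f]]
    by (simp add: mult.left_commute)
  show "set_integrable lborel {..0} (\<lambda>\<xi>. c\<^sup>2 * ((f \<xi>)\<^sup>2 * exp (p * \<xi>)))"
    using f by (intro set_integrable_mult_right) (auto simp: L2w_def)
qed (simp add: power_mult_distrib)

lemma L2w_add:
  assumes "f \<in> L2w p" "g \<in> L2w p"
  shows "(\<lambda>\<xi>. f \<xi> + g \<xi>) \<in> L2w p"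
proof (rule L2wI)
  show "(\<lambda>\<xi>. indicator {..0} \<xi> * (f \<xi> + g \<xi>)) \<in> borel_measurable borel"
    using borel_measurable_add[OF L2w_cut_measurable[OF assms(1)] L2w_cut_measurable[OF assms(2)]]
    by (simp add: distrib_left)
  show "set_integrable lborel {..0} (\<lambda>\<xi>. 2 * ((f \<xi>)\<^sup>2 * exp (p * \<xi>)) + 2 * ((g \<xi>)\<^sup>2 * exp (p * \<xi>)))"
    using assms by (intro set_integral_add set_integrable_mult_right) (auto simp: L2w_def)
  fix \<xi>
  have "0 \<le> (f \<xi> - g \<xi>)\<^sup>2" by simp
  then have "(f \<xi> + g \<xi>)\<^sup>2 \<le> 2 * (f \<xi>)\<^sup>2 + 2 * (g \<xi>)\<^sup>2"
    by (simp add: power2_eq_square algebra_simps)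
  then have "(f \<xi> + g \<xi>)\<^sup>2 * exp (p * \<xi>) \<le> (2 * (f \<xi>)\<^sup>2 + 2 * (g \<xi>)\<^sup>2) * exp (p * \<xi>)"
    by (rule mult_right_mono) simp
  then show "(f \<xi> + g \<xi>)\<^sup>2 * exp (p * \<xi>) \<le> 2 * ((f \<xi>)\<^sup>2 * exp (p * \<xi>)) + 2 * ((g \<xi>)\<^sup>2 * exp (p * \<xi>))"
    by (simp add: algebra_simps)
qed

lemma L2w_diff: "f \<in> L2w p \<Longrightarrow> g \<in> L2w p \<Longrightarrow> (\<lambda>\<xi>. f \<xi> - g \<xi>) \<in> L2w p"
  using L2w_add[OF _ L2w_cmult[of g p "-1"], of f] by simp

lemma L2w_zero: "(\<lambda>_. 0) \<in> L2w p"
  by (simp add: L2w_def set_borel_measurable_def set_integrable_def)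

lemma L2w_sum: "(\<And>k. k \<in> A \<Longrightarrow> f k \<in> L2w p) \<Longrightarrow> (\<lambda>\<xi>. \<Sum>k\<in>A. f k \<xi>) \<in> L2w p"
  by (induction A rule: infinite_finite_induct) (auto intro: L2w_zero L2w_add)

lemma inner_L2w_commute: "inner_L2w p f g = inner_L2w p g f"
  by (simp add: inner_L2w_def mult.commute)

lemma inner_L2w_nonneg: "0 \<le> inner_L2w p f f"
  unfolding inner_L2w_def set_lebesgue_integral_def
  by (intro integral_nonneg_AE AE_I2) (auto simp: indicator_def)

lemma inner_L2w_zero_left [simp]: "inner_L2w p (\<lambda>_. 0) g = 0"
  by (simp add: inner_L2w_def set_lebesgue_integral_def)

lemma inner_L2w_cmult_left: "inner_L2w p (\<lambda>\<xi>. c * f \<xi>) g = c * inner_L2w p f g"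
  unfolding inner_L2w_def by (simp add: mult.assoc)

lemma inner_L2w_cmult_right: "inner_L2w p g (\<lambda>\<xi>. c * f \<xi>) = c * inner_L2w p g f"
  using inner_L2w_cmult_left[of p c f g] by (simp add: inner_L2w_commute)

lemma inner_L2w_add_left:
  assumes "f \<in> L2w p" "g \<in> L2w p" "h \<in> L2w p"
  shows "inner_L2w p (\<lambda>\<xi>. f \<xi> + g \<xi>) h = inner_L2w p f h + inner_L2w p g h"
  unfolding inner_L2w_def using inner_L2w_integrable[OF assms(1,3)] inner_L2w_integrable[OF assms(2,3)]
  by (simp add: distrib_right set_integral_add)

lemma inner_L2w_diff_left:
  assumes "f \<in> L2w p" "g \<in> L2w p" "h \<in> L2w p"
  shows "inner_L2w p (\<lambda>\<xi>. f \<xi> - g \<xi>) h = inner_L2w p f h - inner_L2w p g h"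
  unfolding inner_L2w_def using inner_L2w_integrable[OF assms(1,3)] inner_L2w_integrable[OF assms(2,3)]
  by (simp add: left_diff_distrib set_integral_diff)

lemma inner_L2w_diff_right:
  assumes "f \<in> L2w p" "g \<in> L2w p" "h \<in> L2w p"
  shows "inner_L2w p h (\<lambda>\<xi>. f \<xi> - g \<xi>) = inner_L2w p h f - inner_L2w p h g"
  using inner_L2w_diff_left[OF assms] by (simp add: inner_L2w_commute)

lemma inner_L2w_sum_left:
  assumes "\<And>k. k \<in> A \<Longrightarrow> f k \<in> L2w p" "g \<in> L2w p"
  shows "inner_L2w p (\<lambda>\<xi>. \<Sum>k\<in>A. f k \<xi>) g = (\<Sum>k\<in>A. inner_L2w p (f k) g)"
  using assms(1)
  by (induction A rule: infinite_finite_induct) (auto simp: inner_L2w_add_left[OF _ L2w_sum assms(2)])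

lemma inner_L2w_Cauchy_Schwarz:
  assumes f: "f \<in> L2w p" and g: "g \<in> L2w p"
  shows "(inner_L2w p f g)\<^sup>2 \<le> inner_L2w p f f * inner_L2w p g g"
proof -
  have quad: "0 \<le> inner_L2w p f f - 2 * t * inner_L2w p f g + t\<^sup>2 * inner_L2w p g g" for t
  proof -
    let ?h = "\<lambda>\<xi>. f \<xi> - t * g \<xi>"
    have h: "?h \<in> L2w p" by (intro L2w_diff L2w_cmult f g)
    have "inner_L2w p ?h ?h = inner_L2w p f ?h - t * inner_L2w p g ?h"
      by (simp add: inner_L2w_diff_left[OF f L2w_cmult[OF g] h] inner_L2w_cmult_left)
    also have "inner_L2w p f ?h = inner_L2w p f f - t * inner_L2w p f g"
      by (simp add: inner_L2w_diff_right[OF f L2w_cmult[OF g] f] inner_L2w_cmult_right)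
    also have "inner_L2w p g ?h = inner_L2w p f g - t * inner_L2w p g g"
      by (simp add: inner_L2w_diff_right[OF f L2w_cmult[OF g] g] inner_L2w_cmult_right inner_L2w_commute[of p g f])
    finally have "inner_L2w p ?h ?h = inner_L2w p f f - 2 * t * inner_L2w p f g + t\<^sup>2 * inner_L2w p g g"
      by (simp add: power2_eq_square algebra_simps)
    with inner_L2w_nonneg[of p ?h] show ?thesis by simp
  qed
  show ?thesis
  proof (cases "inner_L2w p g g = 0")
    case True
    \<comment> \<open>Otherwise the polynomial in \<open>t\<close> would be affine and not constant;
      at the \<open>t\<close> chosen below its value is -1.\<close>
    have "inner_L2w p f g = 0"
    proof (rule ccontr)
      assume "inner_L2w p f g \<noteq> 0"
      with quad[of "(inner_L2w p f f + 1) / (2 * inner_L2w p f g)"] show False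
        by (simp add: True)
    qed
    then show ?thesis by (simp add: True)
  next
    case False
    with inner_L2w_nonneg[of p g] have pos: "0 < inner_L2w p g g" by simp
    have "0 \<le> inner_L2w p f f - (inner_L2w p f g)\<^sup>2 / inner_L2w p g g"
      using quad[of "inner_L2w p f g / inner_L2w p g g"] pos by (simp add: power2_eq_square)
    then show ?thesis using pos by (simp add: field_simps)
  qed
qed

section \<open>Orthonormality of the Laguerre functions\<close>

lemma exp_set_integrable:
  assumes "0 < a"
  shows "set_integrable lborel {..0} (\<lambda>\<xi>::real. exp (a * \<xi>))"
proof -
  have "(\<integral>\<^sup>+\<xi>. ennreal (exp (a * \<xi>)) * indicator {..0} \<xi> \<partial>lborel)
      = (\<integral>\<^sup>+\<xi>. ennreal (exp (- a * \<xi>)) * indicator {0..} \<xi> \<partial>lborel)"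
    by (subst nn_integral_real_affine[where c = "-1" and t = 0])
       (auto intro!: nn_integral_cong simp: indicator_def)
  also have "\<dots> = ennreal (0 - (- exp (- a * 0) / a))"
  proof (rule nn_integral_FTC_atLeast)
    show "((\<lambda>x. - exp (- a * x) / a) has_real_derivative exp (- a * x)) (at x)" for x
      using assms by (auto intro!: derivative_eq_intros)
    have "filterlim (\<lambda>x. - a * x) at_bot at_top"
      using assms by (intro filterlim_tendsto_neg_mult_at_bot[OF tendsto_const] filterlim_ident) auto
    then have "((\<lambda>x. exp (- a * x)) \<longlongrightarrow> 0) at_top"
      by (rule filterlim_compose[OF exp_at_bot])
    then have "((\<lambda>x. - exp (- a * x) / a) \<longlongrightarrow> - 0 / a) at_top"
      by (intro tendsto_divide tendsto_minus tendsto_const) (use assms in auto)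
    then show "((\<lambda>x. - exp (- a * x) / a) \<longlongrightarrow> 0) at_top" by simp
  qed auto
  finally have "(\<integral>\<^sup>+\<xi>. ennreal (exp (a * \<xi>)) * indicator {..0} \<xi> \<partial>lborel) < \<infinity>"
    by simp
  then have "(\<integral>\<^sup>+\<xi>. ennreal (norm (indicator {..0} \<xi> *\<^sub>R exp (a * \<xi>))) \<partial>lborel) < \<infinity>"
    by (rule order_le_less_trans[rotated]) (auto intro!: nn_integral_mono simp: indicator_def)
  then show ?thesis
    unfolding set_integrable_def by (intro integrableI_bounded) auto
qed

lemma power_div_fact_le_exp:
  fixes x :: real
  assumes "0 \<le> x"
  shows "x ^ i / fact i \<le> exp x"
proof -
  have "(\<Sum>n\<in>{i}. x ^ n /\<^sub>R fact n) \<le> (\<Sum>n. x ^ n /\<^sub>R fact n)"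
    using assms by (intro sum_le_suminf sums_summable[OF exp_converges]) auto
  then show ?thesis
    using sums_unique[OF exp_converges[of x]] by (simp add: divide_inverse mult.commute)
qed

text \<open>Each monomial is compared with one term of the exponential series of
  \<open>- \<delta> * x\<close>, at the cost of a factor \<open>1 / \<delta> ^ i\<close>. The rate
  \<open>\<delta>\<close> is free, so only part of the decay of the weight has to be spent.\<close>

lemma lag_P_exp_bound:
  assumes "0 < \<delta>"
  shows "\<exists>C\<ge>0. \<forall>x\<le>0. \<bar>lag_P k x\<bar> \<le> C * exp (- \<delta> * x)"
proof (intro exI conjI allI impI)
  show "0 \<le> (\<Sum>i\<le>k. real (k choose i) / \<delta> ^ i)"
    using assms by (intro sum_nonneg) auto
  fix x :: real assume x: "x \<le> 0"
  have "\<bar>lag_P k x\<bar> \<le> (\<Sum>i\<le>k. \<bar>real (k choose i) * x ^ i / fact i\<bar>)"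
    unfolding lag_P_def by (rule sum_abs)
  also have "\<dots> \<le> (\<Sum>i\<le>k. real (k choose i) / \<delta> ^ i * exp (- \<delta> * x))"
  proof (rule sum_mono)
    fix i
    have "\<bar>real (k choose i) * x ^ i / fact i\<bar> = real (k choose i) / \<delta> ^ i * ((- \<delta> * x) ^ i / fact i)"
    proof -
      have "(- \<delta> * x) ^ i = \<delta> ^ i * (- x) ^ i" "\<bar>x ^ i\<bar> = (- x) ^ i"
        using x by (simp_all only: power_mult_distrib[symmetric] mult_minus_left mult_minus_right power_abs)
          simp_all
      then show ?thesis using assms by (simp add: abs_mult)
    qed
    also have "\<dots> \<le> real (k choose i) / \<delta> ^ i * exp (- \<delta> * x)"
      using x assms by (intro mult_left_mono power_div_fact_le_exp) (auto simp: mult_nonneg_nonpos)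
    finally show "\<bar>real (k choose i) * x ^ i / fact i\<bar> \<le> real (k choose i) / \<delta> ^ i * exp (- \<delta> * x)" .
  qed
  finally show "\<bar>lag_P k x\<bar> \<le> (\<Sum>i\<le>k. real (k choose i) / \<delta> ^ i) * exp (- \<delta> * x)"
    by (simp add: sum_distrib_right)
qed

text \<open>The two factors \<open>exp (- (p / 2) * \<xi>)\<close> cancel the weight, so
  \<open>p\<close> drops out and only Laguerre polynomials with exponential weight in the variable
  \<open>2 * p0 * \<xi>\<close> remain.\<close>

lemma lag_L_product:
  assumes "0 < p0"
  shows "lag_L p0 p j \<xi> * lag_L p0 p k \<xi> * exp (p * \<xi>)
    = 2 * p0 * (lag_P j (2 * p0 * \<xi>) * lag_P k (2 * p0 * \<xi>) * exp (2 * p0 * \<xi>))"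
proof -
  let ?c = "sqrt (2 * p0)" and ?a = "exp (- (p / 2) * \<xi>)" and ?b = "exp (p0 * \<xi>)"
  have "?a * ?b * (?a * ?b) * exp (p * \<xi>) = exp (2 * p0 * \<xi>)"
    by (simp add: exp_add[symmetric])
  moreover have "?c * ?c = 2 * p0"
    using assms by simp
  moreover have "lag_L p0 p j \<xi> * lag_L p0 p k \<xi> * exp (p * \<xi>)
      = ?c * ?c * (lag_P j (2 * p0 * \<xi>) * lag_P k (2 * p0 * \<xi>) * (?a * ?b * (?a * ?b) * exp (p * \<xi>)))"
    unfolding lag_L_def by (simp only: mult_ac)
  ultimately show ?thesis by (simp only:)
qed

lemma lag_PP_exp_bound:
  assumes "0 < p0"
  shows "\<exists>C\<ge>0. \<forall>\<xi>\<le>0. \<bar>lag_P j (2 * p0 * \<xi>) * lag_P k (2 * p0 * \<xi>) * exp (2 * p0 * \<xi>)\<bar> \<le> C * exp (p0 * \<xi>)"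
proof -
  \<comment> \<open>Rate \<open>1/4\<close> for each polynomial uses up half of the exponent
    \<open>2 * p0 * \<xi>\<close> and leaves \<open>exp (p0 * \<xi>)\<close>, still integrable on
    the half-line.\<close>
  obtain C where C: "0 \<le> C" "\<And>x. x \<le> 0 \<Longrightarrow> \<bar>lag_P j x\<bar> \<le> C * exp (- (1/4) * x)"
    using lag_P_exp_bound[of "1/4" j] by auto
  obtain D where D: "0 \<le> D" "\<And>x. x \<le> 0 \<Longrightarrow> \<bar>lag_P k x\<bar> \<le> D * exp (- (1/4) * x)"
    using lag_P_exp_bound[of "1/4" k] by auto
  have "\<bar>lag_P j (2 * p0 * \<xi>) * lag_P k (2 * p0 * \<xi>) * exp (2 * p0 * \<xi>)\<bar> \<le> C * D * exp (p0 * \<xi>)"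
    if "\<xi> \<le> 0" for \<xi>
  proof -
    have \<xi>: "2 * p0 * \<xi> \<le> 0" using assms that by (simp add: mult_nonneg_nonpos)
    have "\<bar>lag_P j (2 * p0 * \<xi>)\<bar> * \<bar>lag_P k (2 * p0 * \<xi>)\<bar> * exp (2 * p0 * \<xi>)
        \<le> (C * exp (- (1/4) * (2 * p0 * \<xi>))) * (D * exp (- (1/4) * (2 * p0 * \<xi>))) * exp (2 * p0 * \<xi>)"
      using C(1) D(1) by (intro mult_right_mono mult_mono C(2) D(2) \<xi>) auto
    also have "\<dots> = C * D * (exp (- (1/4) * (2 * p0 * \<xi>)) * exp (- (1/4) * (2 * p0 * \<xi>)) * exp (2 * p0 * \<xi>))"
      by (simp only: mult_ac)
    also have "exp (- (1/4) * (2 * p0 * \<xi>)) * exp (- (1/4) * (2 * p0 * \<xi>)) * exp (2 * p0 * \<xi>) = exp (p0 * \<xi>)"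
      by (simp add: exp_add[symmetric])
    finally show ?thesis by (simp add: abs_mult)
  qed
  then show ?thesis using C(1) D(1) by (intro exI[of _ "C * D"]) auto
qed

lemma lag_P_continuous: "continuous_on A (lag_P k)"
  unfolding lag_P_def by (intro continuous_intros) auto

lemma lag_L_continuous: "continuous_on A (lag_L p0 p k)"
  unfolding lag_L_def
  by (intro continuous_intros continuous_on_compose2[OF lag_P_continuous[of UNIV]]) auto

lemma lag_L_measurable [measurable]: "lag_L p0 p k \<in> borel_measurable borel"
  by (intro borel_measurable_continuous_onI lag_L_continuous)

lemma lag_L_L2w:
  assumes "0 < p0"
  shows "lag_L p0 p k \<in> L2w p"
proof -
  obtain C where C: "\<And>\<xi>. \<xi> \<le> 0 \<Longrightarrow>
      \<bar>lag_P k (2 * p0 * \<xi>) * lag_P k (2 * p0 * \<xi>) * exp (2 * p0 * \<xi>)\<bar> \<le> C * exp (p0 * \<xi>)"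
    using lag_PP_exp_bound[OF assms, of k k] by blast
  show ?thesis
  proof (rule L2wI)
    show "set_integrable lborel {..0} (\<lambda>\<xi>. (2 * p0 * C) * exp (p0 * \<xi>))"
      by (intro set_integrable_mult_right exp_set_integrable assms)
    fix \<xi> :: real assume "\<xi> \<le> 0"
    from mult_left_mono[OF order_trans[OF abs_ge_self C[OF this]], of "2 * p0"] assms
    show "(lag_L p0 p k \<xi>)\<^sup>2 * exp (p * \<xi>) \<le> (2 * p0 * C) * exp (p0 * \<xi>)"
      unfolding power2_eq_square lag_L_product[OF assms] by (simp add: mult_ac)
  qed measurable
qed

text \<open>Integrating the derivative of \<open>P\<^sub>j P\<^sub>k e\<^sup>x\<close>, whose value at \<open>0\<close> is \<open>1\<close>, gives a triangular
  recursion for the inner products, because \<open>P\<^sub>k' = \<Sum>i<k. P\<^sub>i\<close>.\<close>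

lemma lag_L_recursion:
  assumes "0 < p0"
  shows "(\<Sum>i<j. inner_L2w p (lag_L p0 p i) (lag_L p0 p k)) + (\<Sum>i<k. inner_L2w p (lag_L p0 p j) (lag_L p0 p i))
    + inner_L2w p (lag_L p0 p j) (lag_L p0 p k) = 1"
proof -
  define h where "h j k \<xi> = lag_L p0 p j \<xi> * lag_L p0 p k \<xi> * exp (p * \<xi>)" for j k \<xi>
  define H where "H \<xi> = lag_P j (2 * p0 * \<xi>) * lag_P k (2 * p0 * \<xi>) * exp (2 * p0 * \<xi>)" for \<xi>
  define f where "f \<xi> = (\<Sum>i<j. h i k \<xi>) + (\<Sum>i<k. h j i \<xi>) + h j k \<xi>" for \<xi>
  have h_int: "set_integrable lborel {..0} (h i l)" for i l
    unfolding h_def by (intro inner_L2w_integrable lag_L_L2w assms)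
  have sum_int: "set_integrable lborel {..0} (\<lambda>\<xi>. \<Sum>i<n. h (u i) (v i) \<xi>)" for n :: nat and u v
    using h_int unfolding set_integrable_def scaleR_sum_right
    by (intro Bochner_Integration.integrable_sum) simp
  have sum_eq: "(LINT \<xi>:{..0}|lborel. \<Sum>i<n. h (u i) (v i) \<xi>)
      = (\<Sum>i<n. inner_L2w p (lag_L p0 p (u i)) (lag_L p0 p (v i)))" for n :: nat and u v
    using h_int unfolding set_integrable_def set_lebesgue_integral_def inner_L2w_def h_def scaleR_sum_right
    by (intro Bochner_Integration.integral_sum) simp
  have f_int: "set_integrable lborel {..0} f"
    unfolding f_def by (intro set_integral_add sum_int[of "\<lambda>i. i" "\<lambda>_. k"] sum_int[of "\<lambda>_. j" "\<lambda>i. i"] h_int)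
  have f_eq: "(LINT \<xi>:{..0}|lborel. f \<xi>) =
      (\<Sum>i<j. inner_L2w p (lag_L p0 p i) (lag_L p0 p k)) + (\<Sum>i<k. inner_L2w p (lag_L p0 p j) (lag_L p0 p i))
    + inner_L2w p (lag_L p0 p j) (lag_L p0 p k)"
  proof -
    have "(LINT \<xi>:{..0}|lborel. f \<xi>) = (LINT \<xi>:{..0}|lborel. \<Sum>i<j. h i k \<xi>)
        + (LINT \<xi>:{..0}|lborel. \<Sum>i<k. h j i \<xi>) + (LINT \<xi>:{..0}|lborel. h j k \<xi>)"
      unfolding f_def
      by (simp only: set_integral_add(2) set_integral_add(1) h_int
          sum_int[of "\<lambda>i. i" "\<lambda>_. k"] sum_int[of "\<lambda>_. j" "\<lambda>i. i"])
    then show ?thesis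
      unfolding sum_eq[of "\<lambda>i. i" "\<lambda>_. k"] sum_eq[of "\<lambda>_. j" "\<lambda>i. i"] by (simp add: inner_L2w_def h_def)
  qed
  have dP: "((\<lambda>\<xi>. lag_P i (2 * p0 * \<xi>)) has_real_derivative (\<Sum>l<i. lag_P l (2 * p0 * \<xi>)) * (2 * p0)) (at \<xi>)" for i \<xi>
    by (rule DERIV_chain2[OF lag_P_has_derivative]) (rule derivative_eq_intros refl | simp)+
  \<comment> \<open>The factor \<open>2 * p0\<close> of the chain rule is the one in
    \<open>lag_L_product\<close>, so the derivative is a plain sum of weighted products of Laguerre
    functions.\<close>
  have dH: "(H has_real_derivative f \<xi>) (at \<xi>)" for \<xi>
  proof -
    let ?P = "\<lambda>i. lag_P i (2 * p0 * \<xi>)" and ?E = "exp (2 * p0 * \<xi>)"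
    have dE: "((\<lambda>\<xi>. exp (2 * p0 * \<xi>)) has_real_derivative ?E * (2 * p0)) (at \<xi>)"
      by (auto intro!: derivative_eq_intros)
    have "f \<xi> = 2 * p0 * ((\<Sum>i<j. ?P i) * ?P k * ?E) + 2 * p0 * (?P j * (\<Sum>i<k. ?P i) * ?E)
        + 2 * p0 * (?P j * ?P k * ?E)"
      unfolding f_def h_def lag_L_product[OF assms] by (simp only: sum_distrib_left sum_distrib_right)
    also have "\<dots> = ((\<Sum>i<j. ?P i) * (2 * p0) * ?P k + (\<Sum>i<k. ?P i) * (2 * p0) * ?P j) * ?E
        + ?E * (2 * p0) * (?P j * ?P k)"
      by algebra
    finally have "f \<xi> = \<dots>" .
    with DERIV_mult[OF DERIV_mult[OF dP[of j \<xi>] dP[of k \<xi>]] dE] show ?thesis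
      unfolding H_def by (simp only:)
  qed
  have H0: "H 0 = 1"
    by (simp add: H_def lag_P_def power_0_left sum.atMost_shift)
  have "isCont f \<xi>" for \<xi>
  proof -
    have "continuous_on UNIV f"
      unfolding f_def h_def by (intro continuous_intros lag_L_continuous)
    then show ?thesis by (simp add: continuous_on_eq_continuous_at)
  qed
  then have FTC: "(LINT \<xi>:{a..0}|lborel. f \<xi>) = 1 - H a" if "a \<le> 0" for a
    using integral_FTC_Icc_real[of a 0 H f] that dH H0
    unfolding set_lebesgue_integral_def by (simp add: mult.commute)
  obtain C where C: "\<And>\<xi>. \<xi> \<le> 0 \<Longrightarrow> \<bar>H \<xi>\<bar> \<le> C * exp (p0 * \<xi>)"
    using lag_PP_exp_bound[OF assms, of j k] unfolding H_def by blast
  have "filterlim (\<lambda>x. p0 * x) at_bot at_bot"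
    using assms by (intro filterlim_tendsto_pos_mult_at_bot[OF tendsto_const] filterlim_ident) auto
  then have "((\<lambda>x. exp (p0 * x)) \<longlongrightarrow> 0) at_bot"
    by (rule filterlim_compose[OF exp_at_bot])
  then have "((\<lambda>x. C * exp (p0 * x)) \<longlongrightarrow> 0) at_bot"
    by (rule tendsto_mult_right_zero)
  then have "(H \<longlongrightarrow> 0) at_bot"
    using C by (intro Lim_null_comparison[of H]) (auto intro!: eventually_mono[OF eventually_le_at_bot[of 0]])
  then have "((\<lambda>a. 1 - H a) \<longlongrightarrow> 1 - 0) at_bot"
    by (intro tendsto_diff tendsto_const)
  moreover have "((\<lambda>a. LINT \<xi>:{a..0}|lborel. f \<xi>) \<longlongrightarrow> (LINT \<xi>:{..0}|lborel. f \<xi>)) at_bot"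
    by (rule tendsto_set_lebesgue_integral_at_bot[OF _ f_int]) auto
  then have "((\<lambda>a. 1 - H a) \<longlongrightarrow> (LINT \<xi>:{..0}|lborel. f \<xi>)) at_bot"
    by (rule Lim_transform_eventually)
       (auto intro!: eventually_mono[OF eventually_le_at_bot[of 0]] simp: FTC)
  ultimately have "(LINT \<xi>:{..0}|lborel. f \<xi>) = 1"
    using tendsto_unique[OF trivial_limit_at_bot_linorder] by fastforce
  then show ?thesis by (simp add: f_eq)
qed

text \<open>The sums in the recursion contain only inner products of smaller total index. For
  \<open>j \<noteq> k\<close> exactly one of these is 1, so the remaining term vanishes; for
  \<open>j = k\<close> they are all 0, so the remaining term is 1.\<close>

lemma lag_L_orthonormal:
  assumes "0 < p0"
  shows "inner_L2w p (lag_L p0 p j) (lag_L p0 p k) = of_bool (j = k)"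
proof (induction "j + k" arbitrary: j k rule: less_induct)
  case less
  have 1: "(\<Sum>i<j. inner_L2w p (lag_L p0 p i) (lag_L p0 p k)) = of_bool (k < j)"
  proof -
    have "(\<Sum>i<j. inner_L2w p (lag_L p0 p i) (lag_L p0 p k)) = (\<Sum>i<j. of_bool (i = k))"
      by (intro sum.cong less) auto
    also have "\<dots> = of_bool (k < j)"
      by (simp add: of_bool_def sum.delta)
    finally show ?thesis .
  qed
  have 2: "(\<Sum>i<k. inner_L2w p (lag_L p0 p j) (lag_L p0 p i)) = of_bool (j < k)"
  proof -
    have "(\<Sum>i<k. inner_L2w p (lag_L p0 p j) (lag_L p0 p i)) = (\<Sum>i<k. of_bool (j = i))"
      by (intro sum.cong less) auto
    also have "\<dots> = of_bool (j < k)"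
      by (simp add: of_bool_def sum.delta')
    finally show ?thesis .
  qed
  show ?case
    using lag_L_recursion[OF assms, where j = j and k = k and p = p] 1 2 by (cases j k rule: linorder_cases) auto
qed

section \<open>Projections onto finitely many Laguerre functions\<close>

text \<open>The function component of \<open>trunc_w\<close>. Index 0 of \<open>basis_w\<close>
  belongs to the real component, so the basis indices from 1 to \<open>n\<close> become
  \<open>lag_L\<close> with indices below \<open>n\<close>.\<close>

definition laguerre_proj :: "real \<Rightarrow> real \<Rightarrow> nat \<Rightarrow> (real \<Rightarrow> real) \<Rightarrow> real \<Rightarrow> real" where
  "laguerre_proj p0 p n f = (\<lambda>\<xi>. \<Sum>k<n. inner_L2w p (lag_L p0 p k) f * lag_L p0 p k \<xi>)"

lemma laguerre_proj_L2w: "0 < p0 \<Longrightarrow> laguerre_proj p0 p n f \<in> L2w p"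
  unfolding laguerre_proj_def by (intro L2w_sum L2w_cmult lag_L_L2w)

lemma inner_L2w_laguerre_proj:
  assumes "0 < p0" "g \<in> L2w p"
  shows "inner_L2w p (laguerre_proj p0 p n f) g = (\<Sum>k<n. inner_L2w p (lag_L p0 p k) f * inner_L2w p (lag_L p0 p k) g)"
  unfolding laguerre_proj_def using assms
  by (subst inner_L2w_sum_left) (auto intro: L2w_cmult lag_L_L2w simp: inner_L2w_cmult_left)

text \<open>Orthonormality gives \<open>inner_L2w p g g = inner_L2w p g f\<close>, so the squared
  norm of \<open>f - g\<close>, which is nonnegative, equals the difference of the two
  sides.\<close>

lemma bessel:
  fixes n :: nat
  assumes "0 < p0" and f: "f \<in> L2w p"
  defines "g \<equiv> laguerre_proj p0 p n f"
  shows "inner_L2w p g g \<le> inner_L2w p f f"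
proof -
  have g: "g \<in> L2w p" unfolding g_def by (rule laguerre_proj_L2w[OF assms(1)])
  have coeff: "inner_L2w p (lag_L p0 p k) g = inner_L2w p (lag_L p0 p k) f" if "k < n" for k
  proof -
    have "inner_L2w p (lag_L p0 p k) g = (\<Sum>i<n. inner_L2w p (lag_L p0 p i) f * of_bool (i = k))"
      unfolding inner_L2w_commute[of p _ g] unfolding g_def
      by (simp add: inner_L2w_laguerre_proj[OF assms(1) lag_L_L2w[OF assms(1)]] lag_L_orthonormal[OF assms(1)])
    also have "\<dots> = (\<Sum>i<n. if i = k then inner_L2w p (lag_L p0 p k) f else 0)"
      by (intro sum.cong) auto
    finally show ?thesis using that by simp
  qed
  have "inner_L2w p g g = inner_L2w p g f"
    using coeff unfolding g_def
    by (simp add: inner_L2w_laguerre_proj[OF assms(1) g[unfolded g_def]] inner_L2w_laguerre_proj[OF assms(1) f])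
  moreover have "0 \<le> inner_L2w p (\<lambda>\<xi>. f \<xi> - g \<xi>) (\<lambda>\<xi>. f \<xi> - g \<xi>)"
    by (rule inner_L2w_nonneg)
  ultimately show ?thesis
    using f g L2w_diff[OF f g] by (simp add: inner_L2w_diff_left inner_L2w_diff_right inner_L2w_commute[of p f g])
qed

section \<open>History segments and their Laguerre coordinates\<close>

lemma inner_L2w_nn_integral:
  assumes "f \<in> L2w p"
  shows "ennreal (inner_L2w p f f) = (\<integral>\<^sup>+\<xi>\<in>{..0}. ennreal ((f \<xi>)\<^sup>2 * exp (p * \<xi>)) \<partial>lborel)"
proof -
  have "(\<integral>\<^sup>+\<xi>. ennreal (indicator {..0} \<xi> *\<^sub>R (f \<xi> * f \<xi> * exp (p * \<xi>))) \<partial>lborel) = ennreal (inner_L2w p f f)"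
    unfolding inner_L2w_def set_lebesgue_integral_def
    using inner_L2w_integrable[OF assms assms] unfolding set_integrable_def
    by (intro nn_integral_eq_integral) (auto simp: indicator_def)
  moreover have "(\<integral>\<^sup>+\<xi>. ennreal (indicator {..0} \<xi> *\<^sub>R (f \<xi> * f \<xi> * exp (p * \<xi>))) \<partial>lborel)
      = (\<integral>\<^sup>+\<xi>\<in>{..0}. ennreal ((f \<xi>)\<^sup>2 * exp (p * \<xi>)) \<partial>lborel)"
    by (intro nn_integral_cong) (auto simp: indicator_def power2_eq_square)
  ultimately show ?thesis by simp
qed

lemma bounded_set_integrable:
  fixes f :: "real \<Rightarrow> real"
  assumes [measurable]: "f \<in> borel_measurable borel" and C: "\<And>r. r \<in> {0..t} \<Longrightarrow> \<bar>f r\<bar> \<le> C"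
  shows "set_integrable lborel {0..t} f"
proof (rule set_integrable_bound)
  show "set_integrable lborel {0..t} (\<lambda>_. \<bar>C\<bar>)"
    unfolding set_integrable_def
    by (intro integrable_scaleR_left integrable_real_indicator) (auto simp: emeasure_lborel_Icc_eq)
  show "set_borel_measurable lborel {0..t} f"
    unfolding set_borel_measurable_def by measurable
  show "AE x in lborel. x \<in> {0..t} \<longrightarrow> norm (f x) \<le> norm \<bar>C\<bar>"
    using C by (intro AE_I2) fastforce
qed

text \<open>One path together with its past; no probability enters. The past agrees with the
  representative \<open>f\<close> only strictly before 0, because \<open>y 0\<close> is the real
  component of the initial datum and is unrelated to \<open>f 0\<close>.\<close>

locale history_path =
  fixes p :: real and f y :: "real \<Rightarrow> real"
  assumes f: "f \<in> L2w p" and past: "\<And>r. r < 0 \<Longrightarrow> y r = f r" and cont: "continuous_on {0..} y"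
begin

lemma y_measurable [measurable]: "y \<in> borel_measurable borel"
proof -
  have [measurable]: "(\<lambda>r. indicator {..0} r * f r) \<in> borel_measurable borel"
    by (rule L2w_cut_measurable[OF f])
  have [measurable]: "(\<lambda>r. y (max 0 r)) \<in> borel_measurable borel"
    by (intro borel_measurable_continuous_onI continuous_on_compose2[OF cont] continuous_intros) auto
  have "y = (\<lambda>r. if r < 0 then indicator {..0} r * f r else y (max 0 r))"
    by (auto simp: past)
  also have "\<dots> \<in> borel_measurable borel"
    by measurable
  finally show ?thesis .
qed

lemma y_bounded: "\<exists>C\<ge>0. \<forall>r\<in>{0..t}. \<bar>y r\<bar> \<le> C"
proof -
  have "bounded (y ` {0..t})"
    by (intro compact_imp_bounded compact_continuous_image continuous_on_subset[OF cont]) auto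
  then obtain C where "\<forall>r\<in>{0..t}. \<bar>y r\<bar> \<le> C"
    by (auto simp: bounded_iff)
  then show ?thesis by (intro exI[of _ "\<bar>C\<bar>"]) force
qed

text \<open>After the substitution \<open>r = t + \<xi>\<close> the integral splits at 0 into the
  initial segment and the part travelled since. \<open>exp (\<bar>p\<bar> * T)\<close> bounds the
  effect of the shift on the weight for both signs of \<open>p\<close>. The time integral on the
  right is the form that Gronwall's lemma can absorb.\<close>

lemma shift_nn_integral_le:
  assumes t: "0 \<le> t" "t \<le> T"
  shows "(\<integral>\<^sup>+\<xi>\<in>{..0}. ennreal ((y (t + \<xi>))\<^sup>2 * exp (p * \<xi>)) \<partial>lborel)
    \<le> ennreal (exp (\<bar>p\<bar> * T)) * (ennreal (inner_L2w p f f) + (\<integral>\<^sup>+r\<in>{0..t}. ennreal ((y r)\<^sup>2) \<partial>lborel))"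
proof -
  let ?E = "exp (\<bar>p\<bar> * T)"
  have [measurable]: "(\<lambda>r. indicator {..0} r * f r) \<in> borel_measurable borel"
    by (rule L2w_cut_measurable[OF f])
  have exp_le: "exp (p * r) \<le> ?E" if "\<bar>r\<bar> \<le> T" for r
  proof -
    have "p * r \<le> \<bar>p\<bar> * \<bar>r\<bar>"
      by (metis abs_ge_self abs_mult)
    also have "\<dots> \<le> \<bar>p\<bar> * T" using that by (intro mult_left_mono) auto
    finally show ?thesis by simp
  qed
  have "(\<integral>\<^sup>+\<xi>\<in>{..0}. ennreal ((y (t + \<xi>))\<^sup>2 * exp (p * \<xi>)) \<partial>lborel)
      = (\<integral>\<^sup>+r\<in>{..t}. ennreal ((y r)\<^sup>2 * exp (p * (r - t))) \<partial>lborel)"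
    by (subst nn_integral_real_affine[where c = 1 and t = t and f = "\<lambda>r. ennreal ((y r)\<^sup>2 * exp (p * (r - t))) * indicator {..t} r"])
       (auto intro!: nn_integral_cong simp: indicator_def)
  also have "\<dots> \<le> (\<integral>\<^sup>+r. ennreal ?E * (ennreal ((indicator {..0} r * f r)\<^sup>2 * exp (p * r)))
      + ennreal ?E * (ennreal ((y r)\<^sup>2) * indicator {0..t} r) \<partial>lborel)"
  proof (rule nn_integral_mono)
    fix r
    consider "r < 0" | "0 \<le> r" "r \<le> t" | "t < r" "0 < r" using t by linarith
    then show "ennreal ((y r)\<^sup>2 * exp (p * (r - t))) * indicator {..t} r
        \<le> ennreal ?E * (ennreal ((indicator {..0} r * f r)\<^sup>2 * exp (p * r)))
          + ennreal ?E * (ennreal ((y r)\<^sup>2) * indicator {0..t} r)"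
    proof cases
      case 1
      have "exp (p * (r - t)) = exp (p * (- t)) * exp (p * r)"
        by (simp add: exp_add[symmetric] algebra_simps)
      also have "\<dots> \<le> ?E * exp (p * r)"
        using t by (intro mult_right_mono exp_le) auto
      finally have "(y r)\<^sup>2 * exp (p * (r - t)) \<le> (y r)\<^sup>2 * (?E * exp (p * r))"
        by (rule mult_left_mono) simp
      then have "ennreal ((y r)\<^sup>2 * exp (p * (r - t))) \<le> ennreal (?E * ((f r)\<^sup>2 * exp (p * r)))"
        using past[OF 1] by (intro ennreal_leI) (simp add: mult_ac)
      then show ?thesis using 1 t by (simp add: ennreal_mult)
    next
      case 2
      have "(y r)\<^sup>2 * exp (p * (r - t)) \<le> (y r)\<^sup>2 * ?E"
        using 2 t by (intro mult_left_mono exp_le) auto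
      then have "ennreal ((y r)\<^sup>2 * exp (p * (r - t))) \<le> ennreal (?E * (y r)\<^sup>2)"
        by (intro ennreal_leI) (simp add: mult_ac)
      also have "\<dots> = ennreal ?E * ennreal ((y r)\<^sup>2)"
        by (simp add: ennreal_mult)
      finally show ?thesis using 2 by (simp add: add_increasing)
    qed simp
  qed
  also have "\<dots> = ennreal ?E * (\<integral>\<^sup>+r. ennreal ((indicator {..0} r * f r)\<^sup>2 * exp (p * r)) \<partial>lborel)
      + ennreal ?E * (\<integral>\<^sup>+r\<in>{0..t}. ennreal ((y r)\<^sup>2) \<partial>lborel)"
    by (simp add: nn_integral_add nn_integral_cmult)
  also have "(\<integral>\<^sup>+r. ennreal ((indicator {..0} r * f r)\<^sup>2 * exp (p * r)) \<partial>lborel) = ennreal (inner_L2w p f f)"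
    unfolding inner_L2w_nn_integral[OF f] by (intro nn_integral_cong) (auto simp: indicator_def)
  finally show ?thesis by (simp add: distrib_left)
qed

lemma shift_L2w:
  assumes t: "0 \<le> t"
  shows "(\<lambda>\<xi>. y (t + \<xi>)) \<in> L2w p"
proof -
  obtain C where C: "\<And>r. r \<in> {0..t} \<Longrightarrow> \<bar>y r\<bar> \<le> C"
    using y_bounded by blast
  have "(\<integral>\<^sup>+r\<in>{0..t}. ennreal ((y r)\<^sup>2) \<partial>lborel) \<le> (\<integral>\<^sup>+r\<in>{0..t}. ennreal (C\<^sup>2) \<partial>lborel)"
    using C by (intro nn_integral_mono) (force simp: indicator_def abs_le_square_iff[symmetric] intro!: ennreal_leI)
  also have "\<dots> < \<infinity>"
    using t by (simp add: nn_integral_cmult_indicator ennreal_mult_less_top)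
  finally have "ennreal (exp (\<bar>p\<bar> * t)) * (ennreal (inner_L2w p f f) + (\<integral>\<^sup>+r\<in>{0..t}. ennreal ((y r)\<^sup>2) \<partial>lborel)) < \<infinity>"
    by (simp add: ennreal_mult_less_top)
  then have fin: "(\<integral>\<^sup>+\<xi>\<in>{..0}. ennreal ((y (t + \<xi>))\<^sup>2 * exp (p * \<xi>)) \<partial>lborel) < \<infinity>"
    using shift_nn_integral_le[OF t order_refl] by (rule order_le_less_trans[rotated])
  have "set_integrable lborel {..0} (\<lambda>\<xi>. (y (t + \<xi>))\<^sup>2 * exp (p * \<xi>))"
    unfolding set_integrable_def
  proof (rule integrableI_bounded)
    show "(\<integral>\<^sup>+\<xi>. ennreal (norm (indicator {..0} \<xi> *\<^sub>R ((y (t + \<xi>))\<^sup>2 * exp (p * \<xi>)))) \<partial>lborel) < \<infinity>"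
      by (rule order_le_less_trans[OF _ fin]) (auto intro!: nn_integral_mono simp: indicator_def)
  qed measurable
  then show ?thesis
    by (simp add: L2w_def set_borel_measurable_def)
qed

lemma shift_inner_L2w_le:
  assumes "0 \<le> t" "t \<le> T"
  shows "ennreal (inner_L2w p (\<lambda>\<xi>. y (t + \<xi>)) (\<lambda>\<xi>. y (t + \<xi>)))
    \<le> ennreal (exp (\<bar>p\<bar> * T)) * (ennreal (inner_L2w p f f) + (\<integral>\<^sup>+r\<in>{0..t}. ennreal ((y r)\<^sup>2) \<partial>lborel))"
  using shift_nn_integral_le[OF assms] by (simp add: inner_L2w_nn_integral[OF shift_L2w[OF assms(1)]])

lemma shift_inner_L2w_bounded:
  assumes "0 \<le> T"
  shows "\<exists>C\<ge>0. \<forall>t\<in>{0..T}. inner_L2w p (\<lambda>\<xi>. y (t + \<xi>)) (\<lambda>\<xi>. y (t + \<xi>)) \<le> C"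
proof -
  obtain C where C: "\<And>r. r \<in> {0..T} \<Longrightarrow> \<bar>y r\<bar> \<le> C"
    using y_bounded by blast
  have "inner_L2w p (\<lambda>\<xi>. y (t + \<xi>)) (\<lambda>\<xi>. y (t + \<xi>)) \<le> exp (\<bar>p\<bar> * T) * (inner_L2w p f f + C\<^sup>2 * T)" if t: "t \<in> {0..T}" for t
  proof -
    have "(\<integral>\<^sup>+r\<in>{0..t}. ennreal ((y r)\<^sup>2) \<partial>lborel) \<le> (\<integral>\<^sup>+r\<in>{0..T}. ennreal (C\<^sup>2) \<partial>lborel)"
      using C t by (intro nn_integral_mono) (force simp: indicator_def abs_le_square_iff[symmetric] intro!: ennreal_leI)
    also have "\<dots> = ennreal (C\<^sup>2 * T)"
      using assms by (simp add: nn_integral_cmult_indicator ennreal_mult)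
    finally have "ennreal (inner_L2w p (\<lambda>\<xi>. y (t + \<xi>)) (\<lambda>\<xi>. y (t + \<xi>)))
        \<le> ennreal (exp (\<bar>p\<bar> * T)) * (ennreal (inner_L2w p f f) + ennreal (C\<^sup>2 * T))"
      using t by (intro order_trans[OF shift_inner_L2w_le[of t T]] mult_left_mono add_left_mono) auto
    also have "\<dots> = ennreal (exp (\<bar>p\<bar> * T) * (inner_L2w p f f + C\<^sup>2 * T))"
      using assms by (simp add: ennreal_mult ennreal_plus inner_L2w_nonneg)
    finally show ?thesis
      using assms by (subst (asm) ennreal_le_iff) (auto intro!: mult_nonneg_nonneg add_nonneg_nonneg inner_L2w_nonneg)
  qed
  then show ?thesis
    using assms by (intro exI[of _ "exp (\<bar>p\<bar> * T) * (inner_L2w p f f + C\<^sup>2 * T)"])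
      (auto intro!: mult_nonneg_nonneg add_nonneg_nonneg inner_L2w_nonneg)
qed

lemma inner_L2w_shift_measurable:
  assumes [measurable]: "g \<in> borel_measurable borel"
  shows "(\<lambda>t. inner_L2w p g (\<lambda>\<xi>. y (t + \<xi>))) \<in> borel_measurable borel"
  unfolding inner_L2w_def set_lebesgue_integral_def by measurable

text \<open>Together with measurability in \<open>t\<close> this yields integrability of the
  coordinates over \<open>{0..T}\<close>, without a continuity statement for the segments in the
  weighted norm.\<close>

lemma inner_L2w_shift_bounded:
  assumes "g \<in> L2w p" "0 \<le> T"
  shows "\<exists>C\<ge>0. \<forall>t\<in>{0..T}. \<bar>inner_L2w p g (\<lambda>\<xi>. y (t + \<xi>))\<bar> \<le> C"
proof -
  obtain C where C: "0 \<le> C" "\<And>t. t \<in> {0..T} \<Longrightarrow> inner_L2w p (\<lambda>\<xi>. y (t + \<xi>)) (\<lambda>\<xi>. y (t + \<xi>)) \<le> C"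
    using shift_inner_L2w_bounded[OF assms(2)] by blast
  have "\<bar>inner_L2w p g (\<lambda>\<xi>. y (t + \<xi>))\<bar> \<le> sqrt (inner_L2w p g g * C)" if t: "t \<in> {0..T}" for t
  proof -
    have "(inner_L2w p g (\<lambda>\<xi>. y (t + \<xi>)))\<^sup>2 \<le> inner_L2w p g g * C"
      using t by (intro order_trans[OF inner_L2w_Cauchy_Schwarz[OF assms(1) shift_L2w]] mult_left_mono C inner_L2w_nonneg) auto
    then show ?thesis
      using real_le_rsqrt by (metis abs_le_iff power2_minus real_le_rsqrt minus_le_iff)
  qed
  then show ?thesis
    using C(1) by (intro exI[of _ "sqrt (inner_L2w p g g * C)"]) (auto intro!: mult_nonneg_nonneg inner_L2w_nonneg)
qed

text \<open>The derivative of \<open>t \<mapsto> L\<^sub>k(r - t) w(r - t)\<close> is integrated over the triangle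
  \<open>0 \<le> \<tau> \<le> t\<close>, \<open>r \<le> \<tau>\<close> in both orders.\<close>

lemma laguerre_ode:
  assumes p0: "0 < p0" and t: "0 \<le> t"
  shows "inner_L2w p (lag_L p0 p k) (\<lambda>\<xi>. y (t + \<xi>)) = inner_L2w p (lag_L p0 p k) f +
    (LINT r:{0..t}|lborel. sqrt (2 * p0) * y r - 2 * p0 * (\<Sum>i<k. inner_L2w p (lag_L p0 p i) (\<lambda>\<xi>. y (r + \<xi>)))
      - (p0 + p / 2) * inner_L2w p (lag_L p0 p k) (\<lambda>\<xi>. y (r + \<xi>)))"
proof -
  \<comment> \<open>\<open>q\<close> times the weight is the derivative of
    \<open>lag_L p0 p k\<close> times the weight. It lies in the span of the first
    \<open>k + 1\<close> Laguerre functions, which closes the system; its coefficient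
    \<open>p0 + p / 2\<close> is the damping rate in \<open>laguerre_system\<close>.\<close>
  define q where "q \<xi> = 2 * p0 * (\<Sum>i<k. lag_L p0 p i \<xi>) + (p0 + p / 2) * lag_L p0 p k \<xi>" for \<xi>
  define g where "g \<xi> = lag_L p0 p k \<xi> * exp (p * \<xi>)" for \<xi>
  define g' where "g' \<xi> = q \<xi> * exp (p * \<xi>)" for \<xi>
  define K where "K \<tau> r = indicator {0..t} \<tau> * (indicator {..0} (r - \<tau>) * (g' (r - \<tau>) * y r))" for \<tau> r
  have q: "q \<in> L2w p" and [measurable]: "q \<in> borel_measurable borel"
    unfolding q_def by (intro L2w_add L2w_cmult L2w_sum lag_L_L2w p0) measurable
  have [measurable]: "g \<in> borel_measurable borel" "g' \<in> borel_measurable borel"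
    unfolding g_def g'_def by measurable
  have dg: "(g has_real_derivative g' \<xi>) (at \<xi>)" for \<xi>
    unfolding g_def g'_def q_def by (rule lag_L_weighted_has_derivative)
  have cont_g': "continuous_on UNIV g'"
    unfolding g'_def q_def by (intro continuous_intros lag_L_continuous)
  have inner: "integrable lborel (\<lambda>r. indicator {..0} (r - \<tau>) * (u (r - \<tau>) * exp (p * (r - \<tau>)) * y r))"
      "(\<integral>r. indicator {..0} (r - \<tau>) * (u (r - \<tau>) * exp (p * (r - \<tau>)) * y r) \<partial>lborel) = inner_L2w p u (\<lambda>\<xi>. y (\<tau> + \<xi>))"
    if \<tau>: "0 \<le> \<tau>" and u: "u \<in> L2w p" for \<tau> u
  proof -
    let ?h = "\<lambda>r. indicator {..0} (r - \<tau>) * (u (r - \<tau>) * exp (p * (r - \<tau>)) * y r)"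
    have eq: "?h (\<tau> + 1 * \<xi>) = indicator {..0} \<xi> *\<^sub>R (u \<xi> * y (\<tau> + \<xi>) * exp (p * \<xi>))" for \<xi>
      by (simp add: mult_ac)
    show "integrable lborel ?h"
      using lborel_integrable_real_affine_iff[of 1 ?h \<tau>] inner_L2w_integrable[OF u shift_L2w[OF \<tau>]]
      unfolding eq set_integrable_def by simp
    show "(\<integral>r. ?h r \<partial>lborel) = inner_L2w p u (\<lambda>\<xi>. y (\<tau> + \<xi>))"
      using lborel_integral_real_affine[of 1 ?h \<tau>]
      unfolding eq inner_L2w_def set_lebesgue_integral_def by simp
  qed
  note gy = inner[OF t lag_L_L2w[OF p0, of p k], folded g_def]
  have K_int_r: "integrable lborel (K \<tau>)"
      "(\<integral>r. K \<tau> r \<partial>lborel) = indicator {0..t} \<tau> * inner_L2w p q (\<lambda>\<xi>. y (\<tau> + \<xi>))" for \<tau>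
    using inner[of \<tau> q, OF _ q] unfolding K_def g'_def by (auto simp: indicator_def[of "{0..t}"])
  have [measurable]: "(\<lambda>(\<tau>, r). K \<tau> r) \<in> borel_measurable (lborel \<Otimes>\<^sub>M lborel)"
    unfolding K_def by measurable
  have K_int: "integrable (lborel \<Otimes>\<^sub>M lborel) (\<lambda>(\<tau>, r). K \<tau> r)"
  proof (rule lborel_pair.Fubini_integrable)
    obtain C where C: "0 \<le> C" "\<And>\<tau>. \<tau> \<in> {0..t} \<Longrightarrow> inner_L2w p (\<lambda>\<xi>. y (\<tau> + \<xi>)) (\<lambda>\<xi>. y (\<tau> + \<xi>)) \<le> C"
      using shift_inner_L2w_bounded[OF t] by blast
    \<comment> \<open>Fubini's theorem asks for a bound that is integrable in \<open>\<tau>\<close>: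
      the product is dominated by the sum of squares, and the norms of the segments are bounded on
      \<open>{0..t}\<close>.\<close>
    have norm_le: "(\<integral>r. norm (K \<tau> r) \<partial>lborel) \<le> inner_L2w p q q + C" if \<tau>: "\<tau> \<in> {0..t}" for \<tau>
    proof -
      let ?s = "\<lambda>\<xi>. y (\<tau> + \<xi>)"
      have \<tau>0: "0 \<le> \<tau>" using \<tau> by simp
      have int: "set_integrable lborel {..0} (\<lambda>\<xi>. \<bar>q \<xi> * ?s \<xi> * exp (p * \<xi>)\<bar>)"
        by (intro set_integrable_abs inner_L2w_integrable q shift_L2w \<tau>0)
      have "(\<integral>r. norm (K \<tau> r) \<partial>lborel) = (\<integral>\<xi>. norm (K \<tau> (\<tau> + 1 * \<xi>)) \<partial>lborel)"
        using lborel_integral_real_affine[of 1 "\<lambda>r. norm (K \<tau> r)" \<tau>] by simp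
      also have "\<dots> = (LINT \<xi>:{..0}|lborel. \<bar>q \<xi> * ?s \<xi> * exp (p * \<xi>)\<bar>)"
        unfolding set_lebesgue_integral_def using \<tau>
        by (intro Bochner_Integration.integral_cong) (auto simp: K_def g'_def indicator_def abs_mult)
      also have "\<dots> \<le> (LINT \<xi>:{..0}|lborel. q \<xi> * q \<xi> * exp (p * \<xi>) + ?s \<xi> * ?s \<xi> * exp (p * \<xi>))"
      proof (rule set_integral_mono[OF int])
        show "set_integrable lborel {..0} (\<lambda>\<xi>. q \<xi> * q \<xi> * exp (p * \<xi>) + ?s \<xi> * ?s \<xi> * exp (p * \<xi>))"
          by (intro set_integral_add inner_L2w_integrable q shift_L2w \<tau>0)
        fix \<xi>
        have "0 \<le> (\<bar>q \<xi>\<bar> - \<bar>?s \<xi>\<bar>)\<^sup>2" by simp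
        then have "2 * \<bar>q \<xi> * ?s \<xi>\<bar> \<le> q \<xi> * q \<xi> + ?s \<xi> * ?s \<xi>"
          by (simp add: power2_diff abs_mult flip: power2_eq_square)
        then have "\<bar>q \<xi> * ?s \<xi>\<bar> \<le> q \<xi> * q \<xi> + ?s \<xi> * ?s \<xi>"
          using abs_ge_zero[of "q \<xi> * ?s \<xi>"] by linarith
        then have "\<bar>q \<xi> * ?s \<xi>\<bar> * exp (p * \<xi>) \<le> (q \<xi> * q \<xi> + ?s \<xi> * ?s \<xi>) * exp (p * \<xi>)"
          by (rule mult_right_mono) simp
        then show "\<bar>q \<xi> * ?s \<xi> * exp (p * \<xi>)\<bar> \<le> q \<xi> * q \<xi> * exp (p * \<xi>) + ?s \<xi> * ?s \<xi> * exp (p * \<xi>)"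
          by (simp add: abs_mult distrib_right)
      qed
      also have "\<dots> = inner_L2w p q q + inner_L2w p ?s ?s"
        unfolding inner_L2w_def by (intro set_integral_add(2) inner_L2w_integrable q shift_L2w \<tau>0)
      finally show ?thesis using C(2)[OF \<tau>] by linarith
    qed
    have "set_integrable lborel {0..t} (\<lambda>\<tau>. \<integral>r. norm (K \<tau> r) \<partial>lborel)"
    proof (rule bounded_set_integrable)
      show "(\<lambda>\<tau>. \<integral>r. norm (K \<tau> r) \<partial>lborel) \<in> borel_measurable borel"
        by measurable
      show "\<bar>\<integral>r. norm (K \<tau> r) \<partial>lborel\<bar> \<le> inner_L2w p q q + C" if "\<tau> \<in> {0..t}" for \<tau>
        using norm_le[OF that] by (subst abs_of_nonneg) (auto intro!: integral_nonneg_AE)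
    qed
    moreover have "(\<lambda>\<tau>. \<integral>r. norm (K \<tau> r) \<partial>lborel) = (\<lambda>\<tau>. indicator {0..t} \<tau> *\<^sub>R (\<integral>r. norm (K \<tau> r) \<partial>lborel))"
      by (auto simp: K_def indicator_def)
    ultimately show "integrable lborel (\<lambda>\<tau>. \<integral>r. norm (case (\<tau>, r) of (\<tau>, r) \<Rightarrow> K \<tau> r) \<partial>lborel)"
      unfolding set_integrable_def by simp
  qed (use K_int_r(1) in auto)
  have K_int_\<tau>: "(\<integral>\<tau>. K \<tau> r \<partial>lborel)
      = indicator {..<0} r * (g r * y r) + g 0 * (indicator {0..t} r * y r) - indicator {..0} (r - t) * (g (r - t) * y r)" for r
  proof (cases "r \<le> t")
    case True
    \<comment> \<open>For fixed \<open>r\<close> the section of the triangle runs from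
      \<open>max r 0\<close> to \<open>t\<close>. Its lower end contributes \<open>g r\<close> for
      the past, which becomes the initial coordinate, and \<open>g 0\<close> from time 0 on, which
      becomes the input \<open>sqrt (2 * p0) * y r\<close>.\<close>
    define m where "m = max r 0"
    have m: "m \<le> t" using True t by (simp add: m_def)
    have "(\<integral>\<tau>. - g' (r - \<tau>) * indicator {m..t} \<tau> \<partial>lborel) = g (r - t) - g (r - m)"
    proof (rule integral_FTC_Icc_real[OF m])
      show "((\<lambda>\<tau>. g (r - \<tau>)) has_real_derivative - g' (r - \<tau>)) (at \<tau>)" for \<tau>
      proof -
        have "((\<lambda>\<tau>. r - \<tau>) has_real_derivative - 1) (at \<tau>)"
          by (auto intro!: derivative_eq_intros)
        then have "((\<lambda>\<tau>. g (r - \<tau>)) has_real_derivative g' (r - \<tau>) * - 1) (at \<tau>)"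
          by (rule DERIV_chain2[where f = g and g = "\<lambda>\<tau>. r - \<tau>", OF dg])
        then show ?thesis by simp
      qed
      show "isCont (\<lambda>\<tau>. - g' (r - \<tau>)) \<tau>" for \<tau>
        using continuous_on_compose2[OF cont_g', of UNIV "\<lambda>\<tau>. r - \<tau>"]
        by (auto simp: continuous_on_eq_continuous_at intro!: continuous_intros)
    qed
    then have "(\<integral>\<tau>. g' (r - \<tau>) * indicator {m..t} \<tau> \<partial>lborel) = g (r - m) - g (r - t)"
      by simp
    moreover have "(\<integral>\<tau>. K \<tau> r \<partial>lborel) = (\<integral>\<tau>. y r * (g' (r - \<tau>) * indicator {m..t} \<tau>) \<partial>lborel)"
      by (intro Bochner_Integration.integral_cong) (auto simp: K_def m_def indicator_def)
    ultimately have "(\<integral>\<tau>. K \<tau> r \<partial>lborel) = y r * (g (r - m) - g (r - t))"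
      by simp
    then show ?thesis
      using True by (cases "r < 0") (auto simp: m_def algebra_simps)
  next
    case False
    then have "K \<tau> r = 0" for \<tau> by (auto simp: K_def indicator_def)
    then show ?thesis using False t by auto
  qed
  have "(LINT \<tau>:{0..t}|lborel. inner_L2w p q (\<lambda>\<xi>. y (\<tau> + \<xi>))) = (\<integral>\<tau>. \<integral>r. K \<tau> r \<partial>lborel \<partial>lborel)"
    by (simp add: K_int_r(2) set_lebesgue_integral_def)
  also have "\<dots> = (\<integral>r. \<integral>\<tau>. K \<tau> r \<partial>lborel \<partial>lborel)"
    by (rule lborel_pair.Fubini_integral[OF K_int, symmetric])
  also have "\<dots> = (\<integral>r. indicator {..<0} r * (g r * y r) \<partial>lborel) + g 0 * (\<integral>r. indicator {0..t} r * y r \<partial>lborel)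
      - inner_L2w p (lag_L p0 p k) (\<lambda>\<xi>. y (t + \<xi>))"
  proof -
    have 1: "integrable lborel (\<lambda>r. indicator {..<0} r * (g r * y r))"
    proof (rule Bochner_Integration.integrable_bound)
      show "integrable lborel (\<lambda>r. indicator {..0} r *\<^sub>R (lag_L p0 p k r * f r * exp (p * r)))"
        using inner_L2w_integrable[OF lag_L_L2w[OF p0] f] by (simp add: set_integrable_def)
    qed (auto simp: indicator_def g_def past abs_mult)
    have 2: "integrable lborel (\<lambda>r. indicator {0..t} r * y r)"
    proof -
      obtain C where "\<And>r. r \<in> {0..t} \<Longrightarrow> \<bar>y r\<bar> \<le> C" using y_bounded by blast
      then have "set_integrable lborel {0..t} y" by (intro bounded_set_integrable) auto
      then show ?thesis by (simp add: set_integrable_def)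
    qed
    show ?thesis
      unfolding K_int_\<tau> using 1 2 gy by simp
  qed
  also have "(\<integral>r. indicator {..<0} r * (g r * y r) \<partial>lborel) = inner_L2w p (lag_L p0 p k) f"
    unfolding inner_L2w_def set_lebesgue_integral_def
  \<comment> \<open>\<open>y\<close> and \<open>f\<close> agree only for \<open>r < 0\<close>; the
    point 0 is a null set.\<close>
  proof (rule Bochner_Integration.integral_cong_AE)
    show "AE r in lborel. indicator {..<0} r * (g r * y r)
        = indicator {..0} r *\<^sub>R (lag_L p0 p k r * f r * exp (p * r))"
      using AE_lborel_singleton[of "0 :: real"]
      by eventually_elim (auto simp: indicator_def g_def past)
    show "(\<lambda>r. indicator {..0} r *\<^sub>R (lag_L p0 p k r * f r * exp (p * r))) \<in> borel_measurable lborel"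
      using inner_L2w_integrable[OF lag_L_L2w[OF p0, of p k] f] unfolding set_integrable_def
      by (rule borel_measurable_integrable)
  qed measurable
  also have "g 0 = sqrt (2 * p0)"
    by (simp add: g_def lag_L_0)
  also have "(\<integral>r. indicator {0..t} r * y r \<partial>lborel) = (LINT r:{0..t}|lborel. y r)"
    by (simp add: set_lebesgue_integral_def)
  finally have main: "inner_L2w p (lag_L p0 p k) (\<lambda>\<xi>. y (t + \<xi>)) = inner_L2w p (lag_L p0 p k) f
      + (sqrt (2 * p0) * (LINT r:{0..t}|lborel. y r) - (LINT \<tau>:{0..t}|lborel. inner_L2w p q (\<lambda>\<xi>. y (\<tau> + \<xi>))))"
    by simp
  have q_eq: "inner_L2w p q (\<lambda>\<xi>. y (r + \<xi>)) = 2 * p0 * (\<Sum>i<k. inner_L2w p (lag_L p0 p i) (\<lambda>\<xi>. y (r + \<xi>)))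
      + (p0 + p / 2) * inner_L2w p (lag_L p0 p k) (\<lambda>\<xi>. y (r + \<xi>))" if "0 \<le> r" for r
    unfolding q_def using shift_L2w[OF that]
    by (simp add: inner_L2w_add_left inner_L2w_cmult_left inner_L2w_sum_left L2w_cmult L2w_sum lag_L_L2w p0)
  have y_int: "set_integrable lborel {0..t} y"
  proof -
    obtain C where "\<And>r. r \<in> {0..t} \<Longrightarrow> \<bar>y r\<bar> \<le> C" using y_bounded by blast
    then show ?thesis by (intro bounded_set_integrable) auto
  qed
  have q_int: "set_integrable lborel {0..t} (\<lambda>r. inner_L2w p q (\<lambda>\<xi>. y (r + \<xi>)))"
  proof -
    obtain C where "\<And>r. r \<in> {0..t} \<Longrightarrow> \<bar>inner_L2w p q (\<lambda>\<xi>. y (r + \<xi>))\<bar> \<le> C"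
      using inner_L2w_shift_bounded[OF q t] by blast
    then show ?thesis by (intro bounded_set_integrable inner_L2w_shift_measurable) auto
  qed
  have "sqrt (2 * p0) * (LINT r:{0..t}|lborel. y r) - (LINT \<tau>:{0..t}|lborel. inner_L2w p q (\<lambda>\<xi>. y (\<tau> + \<xi>)))
      = (LINT r:{0..t}|lborel. sqrt (2 * p0) * y r - inner_L2w p q (\<lambda>\<xi>. y (r + \<xi>)))"
    using y_int q_int by (simp add: set_integral_diff p0)
  also have "\<dots> = (LINT r:{0..t}|lborel. sqrt (2 * p0) * y r - 2 * p0 * (\<Sum>i<k. inner_L2w p (lag_L p0 p i) (\<lambda>\<xi>. y (r + \<xi>)))
      - (p0 + p / 2) * inner_L2w p (lag_L p0 p k) (\<lambda>\<xi>. y (r + \<xi>)))"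
    by (intro set_lebesgue_integral_cong) (auto simp: q_eq)
  finally show ?thesis using main by simp
qed

end

section \<open>Identification of the coordinates and estimates of delay terms\<close>

context history_path
begin

text \<open>The system is triangular: once the coordinates below \<open>k\<close> are identified,
  the difference \<open>d\<close> in coordinate \<open>k\<close> equals \<open>- a\<close> times its
  own time integral, and Gronwall's lemma with zero forcing gives \<open>d = 0\<close>. The shift to
  \<open>k - 1\<close> arises because coordinate 0 is the present value.\<close>

lemma laguerre_unique:
  fixes X :: "nat \<Rightarrow> real \<Rightarrow> real"
  assumes p0: "0 < p0"
    and X0: "\<And>r. 0 \<le> r \<Longrightarrow> X 0 r = y r"
    and Xc: "\<And>k. k \<in> {1..n} \<Longrightarrow> continuous_on {0..} (X k)"
    and X: "\<And>k t. k \<in> {1..n} \<Longrightarrow> 0 \<le> t \<Longrightarrow> X k t = inner_L2w p (lag_L p0 p (k - 1)) f +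
      (LINT r:{0..t}|lborel. sqrt (2 * p0) * X 0 r - 2 * p0 * (\<Sum>i=1..<k. X i r) - (p0 + p / 2) * X k r)"
  shows "k \<in> {1..n} \<Longrightarrow> 0 \<le> t \<Longrightarrow> X k t = inner_L2w p (lag_L p0 p (k - 1)) (\<lambda>\<xi>. y (t + \<xi>))"
proof (induction k arbitrary: t rule: less_induct)
  case (less k)
  define x where "x i r = inner_L2w p (lag_L p0 p i) (\<lambda>\<xi>. y (r + \<xi>))" for i r
  define a where "a = p0 + p / 2"
  define h where "h r = sqrt (2 * p0) * y r - 2 * p0 * (\<Sum>i<k - 1. x i r)" for r
  define d where "d r = X k (max 0 r) - x (k - 1) (max 0 r)" for r
  have x_meas [measurable]: "x i \<in> borel_measurable borel" for i
    unfolding x_def by (intro inner_L2w_shift_measurable lag_L_measurable)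
  have [measurable]: "h \<in> borel_measurable borel"
    unfolding h_def by measurable
  have X_meas [measurable]: "(\<lambda>r. X k (max 0 r)) \<in> borel_measurable borel"
    by (intro borel_measurable_continuous_onI continuous_on_compose2[OF Xc[OF less.prems(1)]] continuous_intros) auto
  have [measurable]: "d \<in> borel_measurable borel"
    unfolding d_def by measurable
  have x_bounded: "\<exists>C\<ge>0. \<forall>r\<in>{0..t}. \<bar>x i r\<bar> \<le> C" for i
    unfolding x_def using less.prems(2) by (intro inner_L2w_shift_bounded lag_L_L2w p0)
  have X_bounded: "\<exists>C. \<forall>r\<in>{0..t}. \<bar>X k r\<bar> \<le> C"
  proof -
    have "bounded (X k ` {0..t})"
      by (intro compact_imp_bounded compact_continuous_image continuous_on_subset[OF Xc[OF less.prems(1)]]) auto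
    then show ?thesis by (auto simp: bounded_iff)
  qed
  have int_x: "set_integrable lborel {0..s} (x i)" if "s \<in> {0..t}" for i s
  proof -
    obtain C where "\<And>r. r \<in> {0..t} \<Longrightarrow> \<bar>x i r\<bar> \<le> C" using x_bounded by blast
    then show ?thesis using that by (intro bounded_set_integrable[of _ _ C]) auto
  qed
  have int_X: "set_integrable lborel {0..s} (X k)" if s: "s \<in> {0..t}" for s
  proof -
    obtain C where "\<And>r. r \<in> {0..t} \<Longrightarrow> \<bar>X k r\<bar> \<le> C" using X_bounded by blast
    then have "set_integrable lborel {0..s} (\<lambda>r. X k (max 0 r))"
      using s by (intro bounded_set_integrable[of _ _ C]) auto
    then show ?thesis
      by (rule set_integrable_cong[THEN iffD1, rotated -1]) (auto simp: max_def)
  qed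
  have int_h: "set_integrable lborel {0..s} h" if s: "s \<in> {0..t}" for s
  proof -
    obtain C where "\<And>r. r \<in> {0..t} \<Longrightarrow> \<bar>y r\<bar> \<le> C" using y_bounded by blast
    then have "set_integrable lborel {0..s} y"
      using s by (intro bounded_set_integrable[of _ _ C]) auto
    moreover have "set_integrable lborel {0..s} (\<lambda>r. \<Sum>i<k - 1. x i r)"
      using int_x[OF s] unfolding set_integrable_def scaleR_sum_right
      by (intro Bochner_Integration.integrable_sum) simp
    ultimately show ?thesis
      unfolding h_def using p0 by (intro set_integral_diff set_integrable_mult_right) auto
  qed
  have d_eq: "d s = (LINT r:{0..s}|lborel. - a * d r)" if s: "s \<in> {0..t}" for s
  proof -
    have "X k s = inner_L2w p (lag_L p0 p (k - 1)) f + (LINT r:{0..s}|lborel. h r - a * X k r)"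
    proof -
      have "(\<Sum>i=1..<k. X i r) = (\<Sum>i<k - 1. x i r)" if "0 \<le> r" for r
      proof -
        have "(\<Sum>i=1..<k. X i r) = (\<Sum>i=1..<k. x (i - 1) r)"
          unfolding x_def using less.prems(1) that by (intro sum.cong refl less.IH) auto
        also have "\<dots> = (\<Sum>i<k - 1. x i r)"
          by (rule sum.reindex_bij_witness[of _ Suc "\<lambda>i. i - 1"]) auto
        finally show ?thesis .
      qed
      then have "(LINT r:{0..s}|lborel. sqrt (2 * p0) * X 0 r - 2 * p0 * (\<Sum>i=1..<k. X i r) - (p0 + p / 2) * X k r)
          = (LINT r:{0..s}|lborel. h r - a * X k r)"
        by (intro set_lebesgue_integral_cong) (auto simp: h_def a_def X0)
      then show ?thesis using X[OF less.prems(1), of s] s by simp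
    qed
    moreover have "x (k - 1) s = inner_L2w p (lag_L p0 p (k - 1)) f + (LINT r:{0..s}|lborel. h r - a * x (k - 1) r)"
      using laguerre_ode[OF p0, of s "k - 1"] s by (simp add: x_def h_def a_def)
    ultimately have "d s = (LINT r:{0..s}|lborel. h r - a * X k r) - (LINT r:{0..s}|lborel. h r - a * x (k - 1) r)"
      using s by (simp add: d_def max_def)
    also have "\<dots> = (LINT r:{0..s}|lborel. (h r - a * X k r) - (h r - a * x (k - 1) r))"
    proof -
      have "set_integrable lborel {0..s} (\<lambda>r. h r - a * X k r)" "set_integrable lborel {0..s} (\<lambda>r. h r - a * x (k - 1) r)"
        using int_h[OF s] int_X[OF s] int_x[OF s] by (cases "a = 0"; auto)+
      then show ?thesis by (rule set_integral_diff(2)[symmetric])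
    qed
    also have "\<dots> = (LINT r:{0..s}|lborel. - a * d r)"
      by (intro set_lebesgue_integral_cong) (auto simp: d_def max_def algebra_simps)
    finally show ?thesis .
  qed
  \<comment> \<open>Only \<open>0 < p0\<close> is known here, so the sign of \<open>a\<close> is
    open and its absolute value serves as the Gronwall rate.\<close>
  have d_le: "ennreal \<bar>d s\<bar> \<le> 0 + ennreal \<bar>a\<bar> * (\<integral>\<^sup>+r\<in>{0..s}. ennreal \<bar>d r\<bar> \<partial>lborel)" if s: "s \<in> {0..t}" for s
  proof -
    have "set_integrable lborel {0..s} (\<lambda>r. - a * d r)"
    proof -
      have "set_integrable lborel {0..s} d"
        using set_integral_diff(1)[OF int_X[OF s] int_x[OF s, of "k - 1"]]
        by (rule set_integrable_cong[THEN iffD1, rotated -1]) (auto simp: d_def max_def)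
      then show ?thesis by (intro set_integrable_mult_right)
    qed
    then have "ennreal \<bar>d s\<bar> \<le> (\<integral>\<^sup>+r. ennreal (norm (indicator {0..s} r *\<^sub>R (- a * d r))) \<partial>lborel)"
      using integral_norm_bound_ennreal[of lborel "\<lambda>r. indicator {0..s} r *\<^sub>R (- a * d r)"] d_eq[OF s]
      unfolding set_lebesgue_integral_def set_integrable_def by simp
    also have "\<dots> = (\<integral>\<^sup>+r. ennreal \<bar>a\<bar> * (ennreal \<bar>d r\<bar> * indicator {0..s} r) \<partial>lborel)"
      by (intro nn_integral_cong) (auto simp: indicator_def abs_mult ennreal_mult)
    also have "\<dots> = ennreal \<bar>a\<bar> * (\<integral>\<^sup>+r\<in>{0..s}. ennreal \<bar>d r\<bar> \<partial>lborel)"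
      by (simp add: nn_integral_cmult)
    finally show ?thesis by simp
  qed
  have "d t = 0"
  proof (cases "t = 0")
    case True
    then show ?thesis
      using d_le[of 0] by (simp add: nn_integral_indicator_singleton)
  next
    case False
    obtain C1 where C1: "\<And>r. r \<in> {0..t} \<Longrightarrow> \<bar>x (k - 1) r\<bar> \<le> C1" using x_bounded by blast
    obtain C2 where C2: "\<And>r. r \<in> {0..t} \<Longrightarrow> \<bar>X k r\<bar> \<le> C2" using X_bounded by blast
    have "ennreal \<bar>d t\<bar> \<le> 2 * 0 * ennreal (exp (2 * \<bar>a\<bar> * t))"
    proof (rule gronwall_ennreal[where f = "\<lambda>r. ennreal \<bar>d r\<bar>" and K = "C2 + C1"])
      show "ennreal \<bar>d s\<bar> \<le> ennreal (C2 + C1)" if "s \<in> {0<..t}" for s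
        using C1[of s] C2[of s] that by (intro ennreal_leI) (auto simp: d_def max_def)
      show "ennreal \<bar>d s\<bar> \<le> 0 + ennreal \<bar>a\<bar> * (\<integral>\<^sup>+r\<in>{0..s}. ennreal \<bar>d r\<bar> \<partial>lborel)" if "s \<in> {0<..t}" for s
        using that by (intro d_le) auto
    qed (use False less.prems in auto)
    then show ?thesis by simp
  qed
  then show ?case
    using less.prems by (simp add: d_def x_def max_def)
qed

text \<open>Cauchy--Schwarz separates the kernel from the segment; the segment bound then gives the
  shape required by \<open>stochastic_gronwall\<close>.\<close>

lemma delay_growth:
  assumes a: "a \<in> L2w p" and t: "0 \<le> t" "t \<le> T"
  shows "ennreal ((inner_L2w p a (\<lambda>\<xi>. y (t + \<xi>)))\<^sup>2) \<le> ennreal (inner_L2w p a a * exp (\<bar>p\<bar> * T))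
    * (ennreal (inner_L2w p f f) + (\<integral>\<^sup>+r\<in>{0..t}. ennreal ((y r)\<^sup>2) \<partial>lborel))"
proof -
  let ?s = "\<lambda>\<xi>. y (t + \<xi>)"
  have "ennreal ((inner_L2w p a ?s)\<^sup>2) \<le> ennreal (inner_L2w p a a) * ennreal (inner_L2w p ?s ?s)"
    using inner_L2w_Cauchy_Schwarz[OF a shift_L2w[OF t(1)]]
    by (simp add: ennreal_mult[symmetric] inner_L2w_nonneg ennreal_leI)
  also have "\<dots> \<le> ennreal (inner_L2w p a a) * (ennreal (exp (\<bar>p\<bar> * T))
      * (ennreal (inner_L2w p f f) + (\<integral>\<^sup>+r\<in>{0..t}. ennreal ((y r)\<^sup>2) \<partial>lborel)))"
    by (intro mult_left_mono shift_inner_L2w_le t) auto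
  finally show ?thesis
    by (simp add: ennreal_mult inner_L2w_nonneg mult.assoc)
qed

end

lemma square_sum2_ennreal:
  fixes x y :: real
  shows "ennreal ((x + y)\<^sup>2) \<le> 2 * ennreal (x\<^sup>2) + 2 * ennreal (y\<^sup>2)"
proof -
  have "0 \<le> (x - y)\<^sup>2" by simp
  then have "(x + y)\<^sup>2 \<le> 2 * x\<^sup>2 + 2 * y\<^sup>2"
    by (simp add: power2_eq_square algebra_simps)
  from ennreal_leI[OF this] show ?thesis by (simp add: ennreal_mult)
qed

text \<open>The difference is split into \<open>a - a'\<close> paired with the segment of
  \<open>y\<close> and \<open>a'\<close> paired with the segment of \<open>y - z\<close>. In this
  order the truncation error meets only \<open>y\<close>, later the exact solution, and Bessel's
  inequality replaces the norm of \<open>a'\<close> by that of \<open>a\<close>.\<close>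

lemma delay_error:
  fixes n :: nat
  assumes p0: "0 < p0" and a: "a \<in> L2w p"
    and y: "history_path p f y" and z: "history_path p f z" and t: "0 \<le> t" "t \<le> T"
  defines "a' \<equiv> laguerre_proj p0 p n a"
  shows "ennreal ((inner_L2w p a (\<lambda>\<xi>. y (t + \<xi>)) - inner_L2w p a' (\<lambda>\<xi>. z (t + \<xi>)))\<^sup>2)
    \<le> 2 * (ennreal (inner_L2w p (\<lambda>\<xi>. a \<xi> - a' \<xi>) (\<lambda>\<xi>. a \<xi> - a' \<xi>) * exp (\<bar>p\<bar> * T))
        * (ennreal (inner_L2w p f f) + (\<integral>\<^sup>+r\<in>{0..t}. ennreal ((y r)\<^sup>2) \<partial>lborel)))
      + 2 * (ennreal (inner_L2w p a a * exp (\<bar>p\<bar> * T)) * (\<integral>\<^sup>+r\<in>{0..t}. ennreal ((y r - z r)\<^sup>2) \<partial>lborel))"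
proof -
  interpret y: history_path p f y by (rule y)
  interpret z: history_path p f z by (rule z)
  \<comment> \<open>Both paths have the same past, so the difference has past zero and its growth
    bound contains only the time integral.\<close>
  interpret d: history_path p "\<lambda>_. 0" "\<lambda>r. y r - z r"
    by unfold_locales (auto simp: L2w_zero y.past z.past intro: continuous_on_diff y.cont z.cont)
  have a': "a' \<in> L2w p" unfolding a'_def by (rule laguerre_proj_L2w[OF p0])
  note sh = y.shift_L2w[OF t(1)] z.shift_L2w[OF t(1)]
  have "inner_L2w p a (\<lambda>\<xi>. y (t + \<xi>)) - inner_L2w p a' (\<lambda>\<xi>. z (t + \<xi>))
      = inner_L2w p (\<lambda>\<xi>. a \<xi> - a' \<xi>) (\<lambda>\<xi>. y (t + \<xi>)) + inner_L2w p a' (\<lambda>\<xi>. y (t + \<xi>) - z (t + \<xi>))"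
    by (simp add: inner_L2w_diff_left[OF a a' sh(1)] inner_L2w_diff_right[OF sh a'])
  then have "ennreal ((inner_L2w p a (\<lambda>\<xi>. y (t + \<xi>)) - inner_L2w p a' (\<lambda>\<xi>. z (t + \<xi>)))\<^sup>2)
      \<le> 2 * ennreal ((inner_L2w p (\<lambda>\<xi>. a \<xi> - a' \<xi>) (\<lambda>\<xi>. y (t + \<xi>)))\<^sup>2)
        + 2 * ennreal ((inner_L2w p a' (\<lambda>\<xi>. y (t + \<xi>) - z (t + \<xi>)))\<^sup>2)"
    using square_sum2_ennreal by simp
  also have "\<dots> \<le> 2 * (ennreal (inner_L2w p (\<lambda>\<xi>. a \<xi> - a' \<xi>) (\<lambda>\<xi>. a \<xi> - a' \<xi>) * exp (\<bar>p\<bar> * T))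
        * (ennreal (inner_L2w p f f) + (\<integral>\<^sup>+r\<in>{0..t}. ennreal ((y r)\<^sup>2) \<partial>lborel)))
      + 2 * (ennreal (inner_L2w p a a * exp (\<bar>p\<bar> * T)) * (\<integral>\<^sup>+r\<in>{0..t}. ennreal ((y r - z r)\<^sup>2) \<partial>lborel))"
  proof (intro add_mono mult_left_mono)
    show "ennreal ((inner_L2w p (\<lambda>\<xi>. a \<xi> - a' \<xi>) (\<lambda>\<xi>. y (t + \<xi>)))\<^sup>2)
        \<le> ennreal (inner_L2w p (\<lambda>\<xi>. a \<xi> - a' \<xi>) (\<lambda>\<xi>. a \<xi> - a' \<xi>) * exp (\<bar>p\<bar> * T))
        * (ennreal (inner_L2w p f f) + (\<integral>\<^sup>+r\<in>{0..t}. ennreal ((y r)\<^sup>2) \<partial>lborel))"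
      by (rule y.delay_growth[OF L2w_diff[OF a a'] t])
    have "ennreal ((inner_L2w p a' (\<lambda>\<xi>. y (t + \<xi>) - z (t + \<xi>)))\<^sup>2)
        \<le> ennreal (inner_L2w p a' a' * exp (\<bar>p\<bar> * T)) * (\<integral>\<^sup>+r\<in>{0..t}. ennreal ((y r - z r)\<^sup>2) \<partial>lborel)"
      using d.delay_growth[OF a' t] by simp
    also have "\<dots> \<le> ennreal (inner_L2w p a a * exp (\<bar>p\<bar> * T)) * (\<integral>\<^sup>+r\<in>{0..t}. ennreal ((y r - z r)\<^sup>2) \<partial>lborel)"
      unfolding a'_def by (intro mult_right_mono ennreal_leI bessel p0 a) auto
    finally show "ennreal ((inner_L2w p a' (\<lambda>\<xi>. y (t + \<xi>) - z (t + \<xi>)))\<^sup>2)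
        \<le> ennreal (inner_L2w p a a * exp (\<bar>p\<bar> * T)) * (\<integral>\<^sup>+r\<in>{0..t}. ennreal ((y r - z r)\<^sup>2) \<partial>lborel)" .
  qed auto
  finally show ?thesis .
qed

section \<open>Coordinates and truncation in the product space\<close>

lemma coord_w_0: "coord_w p0 p (a0, a) 0 = a0"
  by (simp add: coord_w_def basis_w_def inner_w_inner_L2w)

lemma coord_w_Suc: "coord_w p0 p (a0, a) (Suc j) = inner_L2w p (lag_L p0 p j) a"
  by (simp add: coord_w_def basis_w_def inner_w_inner_L2w)

lemma norm_w_square: "(norm_w p (a0, a))\<^sup>2 = a0\<^sup>2 + inner_L2w p a a"
  by (simp add: norm_w_def inner_w_inner_L2w inner_L2w_nonneg power2_eq_square)

lemma trunc_w_eq: "trunc_w p0 p n (a0, a) = (a0, laguerre_proj p0 p n a)"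
proof -
  have "(\<Sum>k\<le>n. coord_w p0 p (a0, a) k * fst (basis_w p0 p k)) = a0"
    by (subst sum.atMost_shift) (simp add: coord_w_0 basis_w_def)
  moreover have "(\<Sum>k\<le>n. coord_w p0 p (a0, a) k * snd (basis_w p0 p k) \<xi>) = laguerre_proj p0 p n a \<xi>" for \<xi>
    by (subst sum.atMost_shift) (simp add: coord_w_Suc basis_w_def laguerre_proj_def)
  ultimately show ?thesis by (simp add: trunc_w_def)
qed

text \<open>The real component is a coordinate of its own and is reproduced exactly by every
  truncation, so it leaves no error.\<close>

lemma norm_w_diff_trunc:
  "(norm_w p (diff_w (a0, a) (trunc_w p0 p n (a0, a))))\<^sup>2
    = inner_L2w p (\<lambda>\<xi>. a \<xi> - laguerre_proj p0 p n a \<xi>) (\<lambda>\<xi>. a \<xi> - laguerre_proj p0 p n a \<xi>)"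
  by (simp add: trunc_w_eq diff_w_def norm_w_square)

text \<open>Pairing finitely many coordinates is pairing with the projection. This turns the sums in
  the coefficients of the diffusion into delay terms with projected kernels; \<open>a0\<close> is
  free because the output kernel has a real component as well.\<close>

lemma sum_coord_w:
  assumes p0: "0 < p0" and g: "g \<in> L2w p"
    and X: "\<And>k. k \<in> {1..n} \<Longrightarrow> X k = inner_L2w p (lag_L p0 p (k - 1)) g"
  shows "(\<Sum>k=1..n. coord_w p0 p (a0, a) k * X k) = inner_L2w p (laguerre_proj p0 p n a) g"
proof -
  have coord: "coord_w p0 p (a0, a) k = inner_L2w p (lag_L p0 p (k - 1)) a" if "k \<in> {1..n}" for k
    using coord_w_Suc[of p0 p a0 a "k - 1"] that by simp
  have "(\<Sum>k=1..n. coord_w p0 p (a0, a) k * X k)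
      = (\<Sum>j<n. inner_L2w p (lag_L p0 p j) a * inner_L2w p (lag_L p0 p j) g)"
    by (rule sum.reindex_bij_witness[of _ Suc "\<lambda>k. k - 1"]) (auto simp: X coord)
  then show ?thesis by (simp add: inner_L2w_laguerre_proj[OF p0 g])
qed

section \<open>Error estimate\<close>

lemma ito_process_zero: "ito_process M W 0 (\<lambda>_ _. 0) (\<lambda>_ _. 0) (\<lambda>_ _. 0)"
proof -
  define G :: "'a elementary" where "G = (0, \<lambda>_. 0, \<lambda>_ _. 0)"
  have "ito_integral M W (\<lambda>_ _. 0) (\<lambda>_ _. 0)"
    unfolding ito_integral_def
  proof (intro conjI allI impI exI[of _ "\<lambda>_. G"])
    show "measurable_process M (\<lambda>_ _. 0 :: real)"
      unfolding measurable_process_def by measurable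
  qed (auto simp: G_def adapted_def set_integrable_def continuous_paths_def elementary_process_def
      elementary_val_def elementary_int_def tendsto_zero_in_prob_def)
  moreover have "measurable_process M (\<lambda>_ _. 0 :: real)"
    unfolding measurable_process_def by measurable
  ultimately show ?thesis
    by (auto simp: ito_process_def adapted_def set_integrable_def continuous_paths_def
        intro!: exI[of _ "\<lambda>_ _. 0"])
qed

lemma nn_integral_square_le_SUP:
  fixes y :: "real \<Rightarrow> real"
  assumes t: "0 \<le> t" "t \<le> T" and T: "0 < T" and cont: "continuous_on {0..} y"
  shows "(\<integral>\<^sup>+r\<in>{0..t}. ennreal ((y r)\<^sup>2) \<partial>lborel)
    \<le> ennreal T * (SUP r\<in>\<rat> \<inter> {0..T}. ennreal ((y r)\<^sup>2))"
proof -
  let ?V = "SUP r\<in>\<rat> \<inter> {0..T}. ennreal ((y r)\<^sup>2)"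
  have "continuous_on {0..T} (\<lambda>r. (y r)\<^sup>2)"
    by (intro continuous_on_power continuous_on_subset[OF cont]) auto
  note eq = SUP_rats_eq[OF T this]
  have "ennreal ((y r)\<^sup>2) \<le> ?V" if "r \<in> {0..T}" for r
    unfolding eq[symmetric] using that by (intro SUP_upper)
  then have "(\<integral>\<^sup>+r\<in>{0..t}. ennreal ((y r)\<^sup>2) \<partial>lborel) \<le> (\<integral>\<^sup>+r\<in>{0..T}. ?V \<partial>lborel)"
    using t by (intro nn_integral_mono) (auto split: split_indicator)
  also have "\<dots> = ennreal T * ?V"
    using T unfolding mult.commute[of "ennreal T"] by (simp add: nn_integral_cmult_indicator)
  finally show ?thesis .
qed

section \<open>Explicit constants\<close>

text \<open>The arguments are norms: \<open>r1\<close> of the initial datum, \<open>r2\<close>,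
  \<open>r3\<close>, \<open>r4\<close> of \<alpha>, \<beta>, \<gamma>. The factor 3 comes from
  squaring \<open>1 + \<bar>x\<bar> + \<bar>z\<bar>\<close>; the sum of \<open>r2\<close> and
  \<open>r3\<close> squared serves drift and diffusion at once.\<close>

definition growth_rate :: "real \<Rightarrow> real \<Rightarrow> real \<Rightarrow> real \<Rightarrow> real \<Rightarrow> real" where
  "growth_rate C2 p T r2 r3 = 3 * C2\<^sup>2 * (1 + (r2\<^sup>2 + r3\<^sup>2) * exp (\<bar>p\<bar> * T))"

text \<open>Bounds the expected supremum of the square of \<open>S\<close> over
  \<open>{0..T}\<close>. The square of \<open>r1\<close> dominates both the initial value and the
  initial segment.\<close>

definition state_bound :: "real \<Rightarrow> real \<Rightarrow> real \<Rightarrow> real \<Rightarrow> real \<Rightarrow> real \<Rightarrow> real" where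
  "state_bound C2 p T r1 r2 r3 =
     gronwall_const (growth_rate C2 p T r2 r3) T * (r1\<^sup>2 + growth_rate C2 p T r2 r3 * (1 + r1\<^sup>2))"

text \<open>The outer 2 comes from squaring \<open>\<bar>x\<bar> + \<bar>z\<bar>\<close>, the inner
  one from the split in \<open>delay_error\<close>.\<close>

definition error_rate :: "real \<Rightarrow> real \<Rightarrow> real \<Rightarrow> real \<Rightarrow> real \<Rightarrow> real" where
  "error_rate C1 p T r2 r3 = 2 * C1\<^sup>2 * (1 + 2 * ((r2\<^sup>2 + r3\<^sup>2) * exp (\<bar>p\<bar> * T)))"

text \<open>The factor in front of the truncation errors of \<alpha> and \<beta> in the bound for
  \<open>S - S^n\<close>. The 4 is the product of the two factors 2 in \<open>error_rate\<close>;
  the last factor bounds the history of \<open>S\<close>.\<close>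

definition error_bound :: "real \<Rightarrow> real \<Rightarrow> real \<Rightarrow> real \<Rightarrow> real \<Rightarrow> real \<Rightarrow> real \<Rightarrow> real" where
  "error_bound C1 C2 p T r1 r2 r3 = gronwall_const (error_rate C1 p T r2 r3) T *
     (4 * C1\<^sup>2 * exp (\<bar>p\<bar> * T) * (r1\<^sup>2 + T * state_bound C2 p T r1 r2 r3))"

text \<open>The first summand is the propagated state error, the second the truncation of \<gamma>
  acting on the history of \<open>S\<close>. Adding them lets one constant multiply all three
  errors.\<close>

definition output_bound :: "real \<Rightarrow> real \<Rightarrow> real \<Rightarrow> real \<Rightarrow> real \<Rightarrow> real \<Rightarrow> real \<Rightarrow> real \<Rightarrow> real" where
  "output_bound C1 C2 p T r1 r2 r3 r4 =
     (2 + 4 * T * exp (\<bar>p\<bar> * T)) * r4\<^sup>2 * error_bound C1 C2 p T r1 r2 r3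
     + 4 * exp (\<bar>p\<bar> * T) * (r1\<^sup>2 + T * state_bound C2 p T r1 r2 r3)"

lemma growth_rate_nonneg: "0 \<le> growth_rate C2 p T r2 r3"
  by (simp add: growth_rate_def)

lemma error_rate_nonneg: "0 \<le> error_rate C1 p T r2 r3"
  by (simp add: error_rate_def)

lemma state_bound_nonneg: "0 \<le> T \<Longrightarrow> 0 \<le> state_bound C2 p T r1 r2 r3"
  unfolding state_bound_def
  by (intro mult_nonneg_nonneg add_nonneg_nonneg growth_rate_nonneg less_imp_le[OF gronwall_const_pos]) auto

lemma error_bound_nonneg: "0 \<le> T \<Longrightarrow> 0 \<le> error_bound C1 C2 p T r1 r2 r3"
  unfolding error_bound_def
  by (intro mult_nonneg_nonneg add_nonneg_nonneg state_bound_nonneg error_rate_nonneg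
      less_imp_le[OF gronwall_const_pos]) auto

lemma output_bound_nonneg: "0 \<le> T \<Longrightarrow> 0 \<le> output_bound C1 C2 p T r1 r2 r3 r4"
  unfolding output_bound_def
  by (intro mult_nonneg_nonneg add_nonneg_nonneg state_bound_nonneg error_bound_nonneg) auto

section \<open>Pointwise estimates of the coefficients and of the output\<close>

lemma square_mono_ennreal: "\<bar>u\<bar> \<le> v \<Longrightarrow> ennreal (u\<^sup>2) \<le> ennreal (v\<^sup>2)" for u v :: real
  by (intro ennreal_leI) (metis abs_ge_zero abs_le_square_iff abs_of_nonneg order_trans)

text \<open>In \<open>growth_step\<close>, \<open>Q\<close> is the time integral of \<open>S\<^sup>2\<close>; in \<open>error_step\<close>, \<open>V\<close> dominates that
  integral and \<open>Q\<close> is the time integral of \<open>(S - S\<^sup>n)\<^sup>2\<close>.\<close>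

lemma growth_step:
  fixes Q :: ennreal
  assumes h: "\<bar>h\<bar> \<le> C2 * (1 + \<bar>x\<bar> + \<bar>z\<bar>)"
    and z: "ennreal (z\<^sup>2) \<le> ennreal (A * E) * (ennreal s + Q)"
    and A: "A \<le> R" and nonneg: "0 \<le> E" "0 \<le> s" "0 \<le> C2" "0 \<le> R"
  shows "ennreal (h\<^sup>2) \<le> ennreal (3 * C2\<^sup>2 * (1 + R * E) * (1 + s))
    + ennreal (3 * C2\<^sup>2 * (1 + R * E)) * (ennreal (x\<^sup>2) + Q)"
proof -
  let ?k = "ennreal (3 * C2\<^sup>2)" and ?r = "ennreal (R * E)"
  \<comment> \<open>\<open>1 + R * E\<close> dominates the coefficients of the constant, of the
    value and of the delay term, so one rate serves all three.\<close>
  have r: "1 \<le> ennreal (1 + R * E)" "?r \<le> ennreal (1 + R * E)"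
    using nonneg by (auto simp: ennreal_leI simp flip: ennreal_1 simp del: ennreal_plus)
  have "ennreal (h\<^sup>2) \<le> ennreal ((C2 * (1 + \<bar>x\<bar> + \<bar>z\<bar>))\<^sup>2)"
    by (rule square_mono_ennreal[OF h])
  also have "\<dots> = ennreal (C2\<^sup>2) * ennreal ((1 + \<bar>x\<bar> + \<bar>z\<bar>)\<^sup>2)"
    by (simp add: power_mult_distrib ennreal_mult)
  also have "\<dots> \<le> ennreal (C2\<^sup>2) * (3 * (ennreal (1\<^sup>2) + (ennreal (\<bar>x\<bar>\<^sup>2) + ennreal (\<bar>z\<bar>\<^sup>2))))"
    by (intro mult_left_mono square_sum3_ennreal) simp
  also have "\<dots> = ?k * (1 + (ennreal (x\<^sup>2) + ennreal (z\<^sup>2)))"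
  proof -
    have "?k = ennreal (C2\<^sup>2) * 3"
      by (simp add: ennreal_mult mult.commute)
    then show ?thesis by (simp only: mult.assoc power_one power2_abs ennreal_1)
  qed
  also have "\<dots> \<le> ?k * (1 + (ennreal (x\<^sup>2) + ?r * (ennreal s + Q)))"
  proof (intro mult_left_mono add_left_mono)
    have "ennreal (A * E) \<le> ?r"
      using A nonneg by (intro ennreal_leI mult_right_mono) auto
    then show "ennreal (z\<^sup>2) \<le> ?r * (ennreal s + Q)"
      by (rule order_trans[OF z mult_right_mono]) simp
  qed simp
  also have "\<dots> \<le> ?k * (ennreal (1 + R * E) * 1 + (ennreal (1 + R * E) * ennreal (x\<^sup>2) + ennreal (1 + R * E) * (ennreal s + Q)))"
  proof (intro mult_left_mono add_mono)
    show "ennreal (x\<^sup>2) \<le> ennreal (1 + R * E) * ennreal (x\<^sup>2)"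
      using mult_right_mono[OF r(1), of "ennreal (x\<^sup>2)"] by simp
    show "?r * (ennreal s + Q) \<le> ennreal (1 + R * E) * (ennreal s + Q)"
      by (rule mult_right_mono[OF r(2)]) simp
  qed (use r(1) in auto)
  also have "\<dots> = ?k * ennreal (1 + R * E) * (1 + ennreal s) + ?k * ennreal (1 + R * E) * (ennreal (x\<^sup>2) + Q)"
  proof -
    have "k * (c * 1 + (c * u + c * (v + w))) = k * c * (1 + v) + k * c * (u + w)" for k c u v w :: ennreal
      by (simp only: distrib_left mult_1_right ac_simps)
    then show ?thesis .
  qed
  also have "?k * ennreal (1 + R * E) = ennreal (3 * C2\<^sup>2 * (1 + R * E))"
    using nonneg by (intro ennreal_mult[symmetric]) auto
  also have "ennreal (3 * C2\<^sup>2 * (1 + R * E)) * (1 + ennreal s) = ennreal (3 * C2\<^sup>2 * (1 + R * E) * (1 + s))"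
    using nonneg by (subst ennreal_mult[of _ "1 + s"]) auto
  finally show ?thesis .
qed

lemma error_step:
  fixes Q V :: ennreal
  assumes h: "\<bar>h\<bar> \<le> C1 * (\<bar>x\<bar> + \<bar>z\<bar>)"
    and z: "ennreal (z\<^sup>2) \<le> 2 * (ennreal (e * E) * (ennreal s + V)) + 2 * (ennreal (A * E) * Q)"
    and le: "A \<le> R" "e \<le> \<epsilon>" and nonneg: "0 \<le> E" "0 \<le> s" "0 \<le> R" "0 \<le> \<epsilon>"
  shows "ennreal (h\<^sup>2) \<le> ennreal (4 * C1\<^sup>2 * E * \<epsilon>) * (ennreal s + V)
    + ennreal (2 * C1\<^sup>2 * (1 + 2 * (R * E))) * (ennreal (x\<^sup>2) + Q)"
proof -
  let ?k = "ennreal (C1\<^sup>2)"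
  have "ennreal (h\<^sup>2) \<le> ennreal ((C1 * (\<bar>x\<bar> + \<bar>z\<bar>))\<^sup>2)"
    by (rule square_mono_ennreal[OF h])
  also have "\<dots> = ?k * ennreal ((\<bar>x\<bar> + \<bar>z\<bar>)\<^sup>2)"
    by (simp add: power_mult_distrib ennreal_mult)
  also have "\<dots> \<le> ?k * (2 * ennreal (\<bar>x\<bar>\<^sup>2) + 2 * ennreal (\<bar>z\<bar>\<^sup>2))"
    by (intro mult_left_mono square_sum2_ennreal) simp
  also have "\<dots> \<le> ?k * (2 * ennreal (x\<^sup>2) + 2 * (2 * (ennreal (E * \<epsilon>) * (ennreal s + V)) + 2 * (ennreal (R * E) * Q)))"
  proof -
    have "ennreal (e * E) \<le> ennreal (E * \<epsilon>)" "ennreal (A * E) \<le> ennreal (R * E)"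
      using le nonneg by (auto intro!: ennreal_leI mult_right_mono simp: mult.commute[of E])
    then have "2 * (ennreal (e * E) * (ennreal s + V)) + 2 * (ennreal (A * E) * Q)
        \<le> 2 * (ennreal (E * \<epsilon>) * (ennreal s + V)) + 2 * (ennreal (R * E) * Q)"
      by (intro add_mono mult_left_mono mult_right_mono) auto
    from order_trans[OF z this] show ?thesis
      by (simp only: power2_abs) (intro mult_left_mono add_left_mono; simp)
  qed
  also have "\<dots> = ?k * (4 * ennreal (E * \<epsilon>)) * (ennreal s + V) + ?k * 2 * (ennreal (x\<^sup>2) + (2 * ennreal (R * E)) * Q)"
  proof -
    have four: "(4 :: ennreal) = 2 * 2" by simp
    have "k * (2 * u + 2 * (2 * (v * w) + 2 * (r * q))) = k * (4 * v) * w + k * 2 * (u + 2 * r * q)"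
      for k u v w r q :: ennreal
      unfolding four by (simp only: distrib_left mult.assoc ac_simps)
    then show ?thesis .
  qed
  also have "\<dots> \<le> ?k * (4 * ennreal (E * \<epsilon>)) * (ennreal s + V)
      + ?k * 2 * (ennreal (1 + 2 * (R * E)) * ennreal (x\<^sup>2) + ennreal (1 + 2 * (R * E)) * Q)"
  proof (intro add_left_mono mult_left_mono add_mono)
    have "ennreal 1 * ennreal (x\<^sup>2) \<le> ennreal (1 + 2 * (R * E)) * ennreal (x\<^sup>2)"
      using nonneg by (intro mult_right_mono ennreal_leI) auto
    then show "ennreal (x\<^sup>2) \<le> ennreal (1 + 2 * (R * E)) * ennreal (x\<^sup>2)" by simp
    have "ennreal (2 * (R * E)) * Q \<le> ennreal (1 + 2 * (R * E)) * Q"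
      by (intro mult_right_mono ennreal_leI) auto
    then show "2 * ennreal (R * E) * Q \<le> ennreal (1 + 2 * (R * E)) * Q"
      using nonneg by (simp add: ennreal_mult)
  qed auto
  also have "\<dots> = ?k * (4 * ennreal (E * \<epsilon>)) * (ennreal s + V)
      + ?k * 2 * ennreal (1 + 2 * (R * E)) * (ennreal (x\<^sup>2) + Q)"
    by (simp only: distrib_left mult.assoc)
  also have "?k * (4 * ennreal (E * \<epsilon>)) = ennreal (4 * C1\<^sup>2 * E * \<epsilon>)"
  proof -
    have "4 * ennreal (E * \<epsilon>) = ennreal (4 * (E * \<epsilon>))"
      using nonneg by (subst ennreal_mult) auto
    then show ?thesis
      using nonneg by (simp add: ennreal_mult'[symmetric] mult_ac)
  qed
  also have "?k * 2 * ennreal (1 + 2 * (R * E)) = ennreal (2 * C1\<^sup>2 * (1 + 2 * (R * E)))"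
  proof -
    have "?k * 2 = ennreal (2 * C1\<^sup>2)"
      by (simp add: ennreal_mult mult.commute)
    then show ?thesis
      by (simp only: ennreal_mult'[symmetric] zero_le_power2 mult_nonneg_nonneg zero_le_numeral)
  qed
  finally show ?thesis .
qed

text \<open>\<open>c * x\<close> is the error through the present value, \<open>z\<close> the error
  of the delay term. Both \<open>c^2\<close> and \<open>A\<close> are at most \<open>\<rho>\<close>,
  later the squared norm of \<gamma>, hence the combined factor
  \<open>2 + 4 * T * E\<close>.\<close>

lemma output_step:
  fixes V Q :: ennreal
  assumes x: "ennreal (x\<^sup>2) \<le> V" and c: "c\<^sup>2 \<le> \<rho>" "A \<le> \<rho>"
    and z: "ennreal (z\<^sup>2) \<le> 2 * (ennreal (e * E) * (ennreal s + Q)) + 2 * (ennreal (A * E) * (ennreal T * V))"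
    and nonneg: "0 \<le> E" "0 \<le> T" "0 \<le> e" "0 \<le> \<rho>"
  shows "ennreal ((c * x + z)\<^sup>2) \<le> ennreal ((2 + 4 * T * E) * \<rho>) * V + ennreal (4 * E * e) * (ennreal s + Q)"
proof -
  let ?Z = "2 * (ennreal (e * E) * (ennreal s + Q)) + 2 * (ennreal (\<rho> * E) * (ennreal T * V))"
  have "ennreal ((c * x + z)\<^sup>2) \<le> 2 * ennreal ((c * x)\<^sup>2) + 2 * ennreal (z\<^sup>2)"
    by (rule square_sum2_ennreal)
  also have "\<dots> \<le> 2 * (ennreal \<rho> * V) + 2 * ?Z"
  proof (intro add_mono mult_left_mono)
    have "ennreal ((c * x)\<^sup>2) = ennreal (c\<^sup>2) * ennreal (x\<^sup>2)"
      by (simp add: power_mult_distrib ennreal_mult)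
    also have "\<dots> \<le> ennreal \<rho> * V"
      by (intro mult_mono ennreal_leI c x) auto
    finally show "ennreal ((c * x)\<^sup>2) \<le> ennreal \<rho> * V" .
    have "ennreal (A * E) \<le> ennreal (\<rho> * E)"
      using c nonneg by (intro ennreal_leI mult_right_mono) auto
    then have "2 * (ennreal (e * E) * (ennreal s + Q)) + 2 * (ennreal (A * E) * (ennreal T * V)) \<le> ?Z"
      by (intro add_mono mult_left_mono mult_right_mono) auto
    with z show "ennreal (z\<^sup>2) \<le> ?Z" by (rule order_trans)
  qed auto
  also have "\<dots> = (2 * ennreal \<rho> + 4 * (ennreal \<rho> * ennreal E * ennreal T)) * V + 4 * (ennreal e * ennreal E) * (ennreal s + Q)"
  proof -
    have four: "(4 :: ennreal) = 2 * 2" by simp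
    have "2 * (r * v) + 2 * (2 * (k * w) + 2 * ((r * E) * (t * v))) = (2 * r + 4 * (r * E * t)) * v + 4 * k * w"
      for r v k w E t :: ennreal
      unfolding four by (simp only: distrib_left distrib_right ac_simps)
    then show ?thesis
      using nonneg by (simp only: ennreal_mult)
  qed
  also have "2 * ennreal \<rho> + 4 * (ennreal \<rho> * ennreal E * ennreal T) = ennreal ((2 + 4 * T * E) * \<rho>)"
  proof -
    have "ennreal ((2 + 4 * T * E) * \<rho>) = ennreal (2 * \<rho> + 4 * (\<rho> * E * T))"
      by (simp add: algebra_simps)
    also have "\<dots> = 2 * ennreal \<rho> + 4 * (ennreal \<rho> * ennreal E * ennreal T)"
      using nonneg by (simp add: ennreal_mult)
    finally show ?thesis by simp
  qed
  also have "4 * (ennreal e * ennreal E) = ennreal (4 * E * e)"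
    using nonneg by (simp add: ennreal_mult mult.assoc mult.commute[of "ennreal e"])
  finally show ?thesis .
qed

section \<open>Moment bound, state error and output error\<close>

context brownian_space
begin

text \<open>The output error is bounded pathwise by the suprema \<open>V\<close> of the square of
  \<open>S\<close> and \<open>VD\<close> of the square of \<open>S - S^n\<close>, so only their
  expectations have to be bounded; the forcing in the estimate of \<open>VD\<close> is again
  expressed through \<open>V\<close>.\<close>

lemma laguerre_approximation:
  fixes b \<sigma> :: "real \<Rightarrow> real \<Rightarrow> real ^ 'd::finite \<Rightarrow> real" and U :: "(real ^ 'd) set" and X :: "nat \<Rightarrow> real \<Rightarrow> 'w \<Rightarrow> real"
  assumes p0: "0 < p0" and C: "0 \<le> C1" "0 \<le> C2" and T: "0 < T"
    and lip: "\<And>x x' y y' v. v \<in> U \<Longrightarrow>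
      \<bar>b x y v - b x' y' v\<bar> + \<bar>\<sigma> x y v - \<sigma> x' y' v\<bar> \<le> C1 * (\<bar>x - x'\<bar> + \<bar>y - y'\<bar>)"
    and growth: "\<And>x y v. v \<in> U \<Longrightarrow> \<bar>b x y v\<bar> + \<bar>\<sigma> x y v\<bar> \<le> C2 * (1 + \<bar>x\<bar> + \<bar>y\<bar>)"
    and L2: "s1 \<in> L2w p" "\<alpha> \<in> L2w p" "\<beta> \<in> L2w p" "\<gamma> \<in> L2w p"
    and u: "admissible_control M W U u"
    and S: "delay_solution M W p b \<sigma> \<alpha> \<beta> (s0, s1) u S"
    and X: "laguerre_system M W p0 p b \<sigma> \<alpha> \<beta> (s0, s1) u n X"
  defines "\<epsilon> \<equiv> \<lambda>a. inner_L2w p (\<lambda>\<xi>. a \<xi> - laguerre_proj p0 p n a \<xi>) (\<lambda>\<xi>. a \<xi> - laguerre_proj p0 p n a \<xi>)"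
  shows "(\<integral>\<^sup>+\<omega>. (SUP t\<in>{0..T}.
      ennreal (\<bar>delay_output p c \<gamma> S t \<omega> - (\<Sum>k=0..n. coord_w p0 p (c, \<gamma>) k * X k t \<omega>)\<bar>\<^sup>2)) \<partial>M)
    \<le> ennreal (output_bound C1 C2 p T (norm_w p (s0, s1)) (norm_w p (0, \<alpha>)) (norm_w p (0, \<beta>)) (norm_w p (c, \<gamma>))
        * (\<epsilon> \<alpha> + \<epsilon> \<beta> + \<epsilon> \<gamma>))"
proof -
  define r1 where "r1 = norm_w p (s0, s1)"
  define r2 where "r2 = norm_w p (0, \<alpha>)"
  define r3 where "r3 = norm_w p (0, \<beta>)"
  define r4 where "r4 = norm_w p (c, \<gamma>)"
  define E where "E = exp (\<bar>p\<bar> * T)"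
  define R where "R = r2\<^sup>2 + r3\<^sup>2"
  define sb where "sb = state_bound C2 p T r1 r2 r3"
  define eb where "eb = error_bound C1 C2 p T r1 r2 r3"
  have r: "r1\<^sup>2 = s0\<^sup>2 + inner_L2w p s1 s1" "r2\<^sup>2 = inner_L2w p \<alpha> \<alpha>" "r3\<^sup>2 = inner_L2w p \<beta> \<beta>" "r4\<^sup>2 = c\<^sup>2 + inner_L2w p \<gamma> \<gamma>"
    by (simp_all add: r1_def r2_def r3_def r4_def norm_w_square)
  have R: "inner_L2w p \<alpha> \<alpha> \<le> R" "inner_L2w p \<beta> \<beta> \<le> R" "0 \<le> R"
    by (auto simp: R_def r[symmetric])
  have E: "0 \<le> E" by (simp add: E_def)
  have \<epsilon>_nonneg: "0 \<le> \<epsilon> a" for a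
    unfolding \<epsilon>_def by (rule inner_L2w_nonneg)
  have sb: "0 \<le> sb" and eb: "0 \<le> eb"
    using T by (simp_all add: sb_def eb_def state_bound_nonneg error_bound_nonneg)
  have uU: "u t \<omega> \<in> U" if "0 \<le> t" "\<omega> \<in> space M" for t \<omega>
    using u that by (auto simp: admissible_control_def)
  have S_ito: "ito_process M W s0 (\<lambda>t \<omega>. b (S t \<omega>) (delay_int p \<alpha> S t \<omega>) (u t \<omega>))
      (\<lambda>t \<omega>. \<sigma> (S t \<omega>) (delay_int p \<beta> S t \<omega>) (u t \<omega>)) S"
    and S_past: "\<And>\<omega> r. \<omega> \<in> space M \<Longrightarrow> r < 0 \<Longrightarrow> S r \<omega> = s1 r"
    using S by (auto simp: delay_solution_def)
  have X_ito: "ito_process M W s0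
      (\<lambda>t \<omega>. b (X 0 t \<omega>) (\<Sum>k=1..n. coord_w p0 p (0, \<alpha>) k * X k t \<omega>) (u t \<omega>))
      (\<lambda>t \<omega>. \<sigma> (X 0 t \<omega>) (\<Sum>k=1..n. coord_w p0 p (0, \<beta>) k * X k t \<omega>) (u t \<omega>)) (X 0)"
    using X by (simp add: laguerre_system_def)
  define D where "D t \<omega> = S t \<omega> - X 0 t \<omega>" for t \<omega>
  define V where "V \<omega> = (SUP r\<in>\<rat> \<inter> {0..T}. ennreal ((S r \<omega>)\<^sup>2))" for \<omega>
  define VD where "VD \<omega> = (SUP r\<in>\<rat> \<inter> {0..T}. ennreal ((D r \<omega>)\<^sup>2))" for \<omega>
  have S_cont: "continuous_on {0..} (\<lambda>t. S t \<omega>)" and X_cont: "continuous_on {0..} (\<lambda>t. X 0 t \<omega>)"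
    if "\<omega> \<in> space M" for \<omega>
    using S_ito X_ito that by (auto simp: ito_process_def continuous_paths_def)
  have D_cont: "continuous_on {0..} (\<lambda>t. D t \<omega>)" if "\<omega> \<in> space M" for \<omega>
    unfolding D_def by (intro continuous_on_diff S_cont X_cont that)
  have SM: "S t \<in> borel_measurable M" "X 0 t \<in> borel_measurable M" if "0 \<le> t" for t
    using S_ito X_ito that by (auto simp: ito_process_def intro: adapted_measurable)
  have [measurable]: "V \<in> borel_measurable M"
    unfolding V_def using SM by (intro borel_measurable_SUP countable_Rats_Int) auto
  have [measurable]: "VD \<in> borel_measurable M"
    unfolding VD_def D_def using SM by (intro borel_measurable_SUP countable_Rats_Int) auto
  \<comment> \<open>\<open>X 0\<close> is prescribed only from time 0 on; \<open>z\<close> attaches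
    the initial segment to it, so that the delay functionals can be evaluated on the approximating
    state.\<close>
  define z where "z \<omega> r = (if r < 0 then s1 r else X 0 r \<omega>)" for \<omega> r
  have yS: "history_path p s1 (\<lambda>r. S r \<omega>)" if "\<omega> \<in> space M" for \<omega>
    by unfold_locales (use L2 S_past S_cont that in auto)
  have zN: "history_path p s1 (z \<omega>)" if "\<omega> \<in> space M" for \<omega>
  proof unfold_locales
    show "continuous_on {0..} (z \<omega>)"
      using X_cont[OF that] by (rule continuous_on_cong[THEN iffD1, rotated 2]) (auto simp: z_def)
  qed (use L2 in \<open>auto simp: z_def\<close>)
  have QS: "(\<integral>\<^sup>+r\<in>{0..t}. ennreal ((S r \<omega>)\<^sup>2) \<partial>lborel) \<le> ennreal T * V \<omega>"
    if "\<omega> \<in> space M" "t \<in> {0..T}" for t \<omega>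
    unfolding V_def using that T S_cont by (intro nn_integral_square_le_SUP) auto
  have QD: "(\<integral>\<^sup>+r\<in>{0..t}. ennreal ((D r \<omega>)\<^sup>2) \<partial>lborel) \<le> ennreal T * VD \<omega>"
    if "\<omega> \<in> space M" "t \<in> {0..T}" for t \<omega>
    unfolding VD_def using that T D_cont by (intro nn_integral_square_le_SUP) auto
  have D_le: "ennreal ((D t \<omega>)\<^sup>2) \<le> VD \<omega>" if "\<omega> \<in> space M" "t \<in> {0..T}" for t \<omega>
  proof -
    have "continuous_on {0..T} (\<lambda>t. (D t \<omega>)\<^sup>2)"
      by (intro continuous_on_power continuous_on_subset[OF D_cont[OF that(1)]]) auto
    then show ?thesis
      unfolding VD_def SUP_rats_eq[OF T, of "\<lambda>t. (D t \<omega>)\<^sup>2", symmetric]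
      using SUP_rats_eq[OF T, of "\<lambda>t. (D t \<omega>)\<^sup>2"] SUP_upper[OF that(2), of "\<lambda>t. ennreal ((D t \<omega>)\<^sup>2)"] by simp
  qed
  \<comment> \<open>The quantifiers over \<open>t\<close>, \<open>a0\<close> and \<open>a\<close>
    stand inside, so one null set serves both coefficients and the output.\<close>
  have coords: "AE \<omega> in M. \<forall>t\<ge>0. \<forall>a0. \<forall>a. (\<Sum>k=1..n. coord_w p0 p (a0, a) k * X k t \<omega>)
      = inner_L2w p (laguerre_proj p0 p n a) (\<lambda>\<xi>. z \<omega> (t + \<xi>))"
  proof -
    have "AE \<omega> in M. \<forall>k\<in>{1..n}. \<forall>t\<ge>0. X k t \<omega> = coord_w p0 p (s0, s1) k +
        (LINT r:{0..t}|lborel. sqrt (2 * p0) * X 0 r \<omega> - 2 * p0 * (\<Sum>i=1..<k. X i r \<omega>) - (p0 + p / 2) * X k r \<omega>)"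
      using X by (subst AE_finite_all) (auto simp: laguerre_system_def)
    then show ?thesis
      using AE_space
    proof eventually_elim
      case (elim \<omega>)
      interpret z: history_path p s1 "z \<omega>" by (rule zN[OF elim(2)])
      have "X k t \<omega> = inner_L2w p (lag_L p0 p (k - 1)) (\<lambda>\<xi>. z \<omega> (t + \<xi>))" if "k \<in> {1..n}" "0 \<le> t" for k t
      proof (rule z.laguerre_unique[where X = "\<lambda>k t. X k t \<omega>", OF p0 _ _ _ that])
        show "continuous_on {0..} (\<lambda>t. X k t \<omega>)" if "k \<in> {1..n}" for k
          using X that elim(2) by (auto simp: laguerre_system_def continuous_paths_def)
        show "X k t \<omega> = inner_L2w p (lag_L p0 p (k - 1)) s1 +
            (LINT r:{0..t}|lborel. sqrt (2 * p0) * X 0 r \<omega> - 2 * p0 * (\<Sum>i=1..<k. X i r \<omega>) - (p0 + p / 2) * X k r \<omega>)"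
          if "k \<in> {1..n}" "0 \<le> t" for k t
          using elim(1) that coord_w_Suc[of p0 p s0 s1 "k - 1"] by simp
      qed (simp add: z_def)
      then show ?case
        using z.shift_L2w by (intro allI impI sum_coord_w p0) auto
    qed
  qed
  have delay_z: "ennreal ((delay_int p a S t \<omega> - inner_L2w p (laguerre_proj p0 p n a) (\<lambda>\<xi>. z \<omega> (t + \<xi>)))\<^sup>2)
      \<le> 2 * (ennreal (\<epsilon> a * E) * (ennreal (r1\<^sup>2) + ennreal T * V \<omega>))
        + 2 * (ennreal (inner_L2w p a a * E) * (\<integral>\<^sup>+r\<in>{0..t}. ennreal ((D r \<omega>)\<^sup>2) \<partial>lborel))"
    if a: "a \<in> L2w p" and \<omega>: "\<omega> \<in> space M" and t: "t \<in> {0..T}" for a \<omega> t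
  proof -
    have "(\<integral>\<^sup>+r\<in>{0..t}. ennreal ((S r \<omega> - z \<omega> r)\<^sup>2) \<partial>lborel) = (\<integral>\<^sup>+r\<in>{0..t}. ennreal ((D r \<omega>)\<^sup>2) \<partial>lborel)"
      by (intro nn_integral_cong) (auto simp: z_def D_def indicator_def)
    then have "ennreal ((delay_int p a S t \<omega> - inner_L2w p (laguerre_proj p0 p n a) (\<lambda>\<xi>. z \<omega> (t + \<xi>)))\<^sup>2)
        \<le> 2 * (ennreal (\<epsilon> a * E) * (ennreal (inner_L2w p s1 s1) + (\<integral>\<^sup>+r\<in>{0..t}. ennreal ((S r \<omega>)\<^sup>2) \<partial>lborel)))
          + 2 * (ennreal (inner_L2w p a a * E) * (\<integral>\<^sup>+r\<in>{0..t}. ennreal ((D r \<omega>)\<^sup>2) \<partial>lborel))"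
      using delay_error[OF p0 a yS[OF \<omega>] zN[OF \<omega>], of t T n] t
      by (simp add: delay_int_def inner_L2w_def[of p a "\<lambda>\<xi>. S (t + \<xi>) \<omega>", symmetric] \<epsilon>_def E_def)
    also have "\<dots> \<le> 2 * (ennreal (\<epsilon> a * E) * (ennreal (r1\<^sup>2) + ennreal T * V \<omega>))
          + 2 * (ennreal (inner_L2w p a a * E) * (\<integral>\<^sup>+r\<in>{0..t}. ennreal ((D r \<omega>)\<^sup>2) \<partial>lborel))"
      by (intro add_mono mult_left_mono QS \<omega> t ennreal_leI) (auto simp: r)
    finally show ?thesis .
  qed
  have state: "(\<integral>\<^sup>+\<omega>. V \<omega> \<partial>M) \<le> ennreal sb"
  proof -
    let ?c = "growth_rate C2 p T r2 r3"
    have c_eq: "?c = 3 * C2\<^sup>2 * (1 + R * E)"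
      by (simp add: growth_rate_def R_def E_def)
    have "(\<integral>\<^sup>+\<omega>. (SUP t\<in>{0..T}. ennreal ((S t \<omega> - 0)\<^sup>2)) \<partial>M)
        \<le> ennreal (gronwall_const ?c T) * (ennreal ((s0 - 0)\<^sup>2) + (\<integral>\<^sup>+\<omega>. ennreal (?c * (1 + r1\<^sup>2)) \<partial>M))"
    proof (rule stochastic_gronwall[OF S_ito ito_process_zero T growth_rate_nonneg])
      show "AE \<omega> in M. \<forall>t\<in>{0<..T}.
        ennreal ((b (S t \<omega>) (delay_int p \<alpha> S t \<omega>) (u t \<omega>) - 0)\<^sup>2) \<le> ennreal (?c * (1 + r1\<^sup>2))
          + ennreal ?c * (ennreal ((S t \<omega> - 0)\<^sup>2) + (\<integral>\<^sup>+r\<in>{0..t}. ennreal ((S r \<omega> - 0)\<^sup>2) \<partial>lborel)) \<and>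
        ennreal ((\<sigma> (S t \<omega>) (delay_int p \<beta> S t \<omega>) (u t \<omega>) - 0)\<^sup>2) \<le> ennreal (?c * (1 + r1\<^sup>2))
          + ennreal ?c * (ennreal ((S t \<omega> - 0)\<^sup>2) + (\<integral>\<^sup>+r\<in>{0..t}. ennreal ((S r \<omega> - 0)\<^sup>2) \<partial>lborel))"
        (is "AE \<omega> in M. \<forall>t\<in>{0<..T}. ?P t \<omega>")
      proof (intro AE_I2 ballI)
        fix \<omega> t assume \<omega>: "\<omega> \<in> space M" and t: "t \<in> {0<..T}"
        let ?Q = "\<integral>\<^sup>+r\<in>{0..t}. ennreal ((S r \<omega>)\<^sup>2) \<partial>lborel"
        have z: "ennreal ((delay_int p a S t \<omega>)\<^sup>2) \<le> ennreal (inner_L2w p a a * E) * (ennreal (r1\<^sup>2) + ?Q)"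
          if "a \<in> L2w p" for a
        proof -
          have "ennreal ((delay_int p a S t \<omega>)\<^sup>2) \<le> ennreal (inner_L2w p a a * E) * (ennreal (inner_L2w p s1 s1) + ?Q)"
            using history_path.delay_growth[OF yS[OF \<omega>] that, of t T] t
            by (simp add: delay_int_def inner_L2w_def[of p a "\<lambda>\<xi>. S (t + \<xi>) \<omega>", symmetric] E_def)
          also have "\<dots> \<le> ennreal (inner_L2w p a a * E) * (ennreal (r1\<^sup>2) + ?Q)"
            by (intro mult_left_mono add_right_mono ennreal_leI) (auto simp: r)
          finally show ?thesis .
        qed
        have g: "\<bar>b (S t \<omega>) y (u t \<omega>)\<bar> \<le> C2 * (1 + \<bar>S t \<omega>\<bar> + \<bar>y\<bar>)"
          "\<bar>\<sigma> (S t \<omega>) y (u t \<omega>)\<bar> \<le> C2 * (1 + \<bar>S t \<omega>\<bar> + \<bar>y\<bar>)" for y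
          using growth[OF uU[of t \<omega>], of "S t \<omega>" y] \<omega> t by auto
        show "?P t \<omega>"
          unfolding c_eq diff_0_right
          using growth_step[OF g(1) z[OF L2(2)] R(1) E zero_le_power2 C(2) R(3)]
            growth_step[OF g(2) z[OF L2(3)] R(2) E zero_le_power2 C(2) R(3)] by blast
      qed
    qed simp
    also have "\<dots> \<le> ennreal (gronwall_const ?c T) * ennreal (r1\<^sup>2 + ?c * (1 + r1\<^sup>2))"
      using growth_rate_nonneg[of C2 p T r2 r3]
      by (intro mult_left_mono) (auto simp: emeasure_space_1 r inner_L2w_nonneg simp flip: ennreal_plus intro!: ennreal_leI)
    also have "\<dots> = ennreal sb"
      unfolding sb_def state_bound_def using gronwall_const_pos[OF growth_rate_nonneg, of T C2 p T r2 r3] T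
      by (intro ennreal_mult[symmetric]) (auto intro!: add_nonneg_nonneg mult_nonneg_nonneg growth_rate_nonneg)
    finally have "(\<integral>\<^sup>+\<omega>. (SUP t\<in>{0..T}. ennreal ((S t \<omega>)\<^sup>2)) \<partial>M) \<le> ennreal sb" by simp
    moreover have "(\<integral>\<^sup>+\<omega>. V \<omega> \<partial>M) \<le> (\<integral>\<^sup>+\<omega>. (SUP t\<in>{0..T}. ennreal ((S t \<omega>)\<^sup>2)) \<partial>M)"
      unfolding V_def by (intro nn_integral_mono SUP_subset_mono) auto
    ultimately show ?thesis by (rule order_trans[rotated])
  qed
  have EV: "(\<integral>\<^sup>+\<omega>. ennreal k * (ennreal (r1\<^sup>2) + ennreal T * V \<omega>) \<partial>M) \<le> ennreal (k * (r1\<^sup>2 + T * sb))" if "0 \<le> k" for k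
  proof -
    have "(\<integral>\<^sup>+\<omega>. ennreal k * (ennreal (r1\<^sup>2) + ennreal T * V \<omega>) \<partial>M)
        = ennreal k * (ennreal (r1\<^sup>2) + ennreal T * (\<integral>\<^sup>+\<omega>. V \<omega> \<partial>M))"
      by (simp add: nn_integral_cmult nn_integral_add emeasure_space_1)
    also have "\<dots> \<le> ennreal k * (ennreal (r1\<^sup>2) + ennreal T * ennreal sb)"
      by (intro mult_left_mono add_left_mono state) auto
    also have "\<dots> = ennreal (k * (r1\<^sup>2 + T * sb))"
      using that T sb by (simp add: ennreal_mult)
    finally show ?thesis .
  qed
  have error: "(\<integral>\<^sup>+\<omega>. VD \<omega> \<partial>M) \<le> ennreal (eb * (\<epsilon> \<alpha> + \<epsilon> \<beta>))"
  proof -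
    let ?c = "error_rate C1 p T r2 r3"
    let ?k = "4 * C1\<^sup>2 * E * (\<epsilon> \<alpha> + \<epsilon> \<beta>)"
    \<comment> \<open>The sum of both truncation errors serves drift and diffusion at once and
      multiplies the random history of \<open>S\<close>. The initial values agree, so this is the
      only source of error.\<close>
    let ?\<Gamma> = "\<lambda>\<omega>. ennreal ?k * (ennreal (r1\<^sup>2) + ennreal T * V \<omega>)"
    have c_eq: "?c = 2 * C1\<^sup>2 * (1 + 2 * (R * E))"
      by (simp add: error_rate_def R_def E_def)
    have "(\<integral>\<^sup>+\<omega>. (SUP t\<in>{0..T}. ennreal ((S t \<omega> - X 0 t \<omega>)\<^sup>2)) \<partial>M)
        \<le> ennreal (gronwall_const ?c T) * (ennreal ((s0 - s0)\<^sup>2) + (\<integral>\<^sup>+\<omega>. ?\<Gamma> \<omega> \<partial>M))"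
    proof (rule stochastic_gronwall[OF S_ito X_ito T error_rate_nonneg])
      show "AE \<omega> in M. \<forall>t\<in>{0<..T}.
        ennreal ((b (S t \<omega>) (delay_int p \<alpha> S t \<omega>) (u t \<omega>)
            - b (X 0 t \<omega>) (\<Sum>k=1..n. coord_w p0 p (0, \<alpha>) k * X k t \<omega>) (u t \<omega>))\<^sup>2) \<le> ?\<Gamma> \<omega>
          + ennreal ?c * (ennreal ((S t \<omega> - X 0 t \<omega>)\<^sup>2) + (\<integral>\<^sup>+r\<in>{0..t}. ennreal ((S r \<omega> - X 0 r \<omega>)\<^sup>2) \<partial>lborel)) \<and>
        ennreal ((\<sigma> (S t \<omega>) (delay_int p \<beta> S t \<omega>) (u t \<omega>)
            - \<sigma> (X 0 t \<omega>) (\<Sum>k=1..n. coord_w p0 p (0, \<beta>) k * X k t \<omega>) (u t \<omega>))\<^sup>2) \<le> ?\<Gamma> \<omega>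
          + ennreal ?c * (ennreal ((S t \<omega> - X 0 t \<omega>)\<^sup>2) + (\<integral>\<^sup>+r\<in>{0..t}. ennreal ((S r \<omega> - X 0 r \<omega>)\<^sup>2) \<partial>lborel))"
        (is "AE \<omega> in M. \<forall>t\<in>{0<..T}. ?P t \<omega>")
        using coords AE_space
      proof eventually_elim
        case (elim \<omega>)
        show ?case
        proof
          fix t assume t: "t \<in> {0<..T}"
          then have t': "t \<in> {0..T}" "0 \<le> t" by auto
          let ?a = "inner_L2w p (laguerre_proj p0 p n \<alpha>) (\<lambda>\<xi>. z \<omega> (t + \<xi>))"
          let ?b = "inner_L2w p (laguerre_proj p0 p n \<beta>) (\<lambda>\<xi>. z \<omega> (t + \<xi>))"
          have eq: "(\<Sum>k=1..n. coord_w p0 p (0, \<alpha>) k * X k t \<omega>) = ?a" "(\<Sum>k=1..n. coord_w p0 p (0, \<beta>) k * X k t \<omega>) = ?b"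
            using elim(1) t'(2) by blast+
          have l: "\<bar>b (S t \<omega>) y (u t \<omega>) - b (X 0 t \<omega>) y' (u t \<omega>)\<bar> \<le> C1 * (\<bar>D t \<omega>\<bar> + \<bar>y - y'\<bar>)"
            "\<bar>\<sigma> (S t \<omega>) y (u t \<omega>) - \<sigma> (X 0 t \<omega>) y' (u t \<omega>)\<bar> \<le> C1 * (\<bar>D t \<omega>\<bar> + \<bar>y - y'\<bar>)" for y y'
            using lip[OF uU[OF t'(2) elim(2)], of "S t \<omega>" y "X 0 t \<omega>" y'] by (auto simp: D_def)
          note d = delay_z[OF _ elim(2) t'(1)]
          have \<epsilon>_le: "\<epsilon> \<alpha> \<le> \<epsilon> \<alpha> + \<epsilon> \<beta>" "\<epsilon> \<beta> \<le> \<epsilon> \<alpha> + \<epsilon> \<beta>" "0 \<le> \<epsilon> \<alpha> + \<epsilon> \<beta>"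
            using \<epsilon>_nonneg[of \<alpha>] \<epsilon>_nonneg[of \<beta>] by auto
          show "?P t \<omega>"
            unfolding c_eq eq D_def[symmetric]
            using error_step[OF l(1) d[OF L2(2)] R(1) \<epsilon>_le(1) E zero_le_power2 R(3) \<epsilon>_le(3)]
              error_step[OF l(2) d[OF L2(3)] R(2) \<epsilon>_le(2) E zero_le_power2 R(3) \<epsilon>_le(3)] by blast
        qed
      qed
    qed measurable
    also have "\<dots> \<le> ennreal (gronwall_const ?c T) * ennreal (?k * (r1\<^sup>2 + T * sb))"
      using EV[of ?k] E \<epsilon>_nonneg by (intro mult_left_mono) auto
    also have "\<dots> = ennreal (eb * (\<epsilon> \<alpha> + \<epsilon> \<beta>))"
      unfolding eb_def error_bound_def sb_def[symmetric] E_def[symmetric]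
      using gronwall_const_pos[OF error_rate_nonneg, of T C1 p T r2 r3] T
      by (subst ennreal_mult'[symmetric]) (auto simp: mult_ac)
    finally have "(\<integral>\<^sup>+\<omega>. (SUP t\<in>{0..T}. ennreal ((D t \<omega>)\<^sup>2)) \<partial>M) \<le> ennreal (eb * (\<epsilon> \<alpha> + \<epsilon> \<beta>))"
      by (simp add: D_def)
    moreover have "(\<integral>\<^sup>+\<omega>. VD \<omega> \<partial>M) \<le> (\<integral>\<^sup>+\<omega>. (SUP t\<in>{0..T}. ennreal ((D t \<omega>)\<^sup>2)) \<partial>M)"
      unfolding VD_def by (intro nn_integral_mono SUP_subset_mono) auto
    ultimately show ?thesis by (rule order_trans[rotated])
  qed
  let ?P = "(2 + 4 * T * E) * r4\<^sup>2" and ?k = "4 * E * \<epsilon> \<gamma>"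
  have P: "0 \<le> ?P" using T E by (intro mult_nonneg_nonneg add_nonneg_nonneg) auto
  have "AE \<omega> in M. (SUP t\<in>{0..T}.
      ennreal (\<bar>delay_output p c \<gamma> S t \<omega> - (\<Sum>k=0..n. coord_w p0 p (c, \<gamma>) k * X k t \<omega>)\<bar>\<^sup>2))
      \<le> ennreal ?P * VD \<omega> + ennreal ?k * (ennreal (r1\<^sup>2) + ennreal T * V \<omega>)"
    using coords AE_space
  proof eventually_elim
    case (elim \<omega>)
    show ?case
    proof (rule SUP_least)
      fix t assume t: "t \<in> {0..T}"
      then have t0: "0 \<le> t" by simp
      let ?z = "delay_int p \<gamma> S t \<omega> - inner_L2w p (laguerre_proj p0 p n \<gamma>) (\<lambda>\<xi>. z \<omega> (t + \<xi>))"
      have "(\<Sum>k=0..n. coord_w p0 p (c, \<gamma>) k * X k t \<omega>)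
          = c * X 0 t \<omega> + (\<Sum>k=1..n. coord_w p0 p (c, \<gamma>) k * X k t \<omega>)"
        by (subst sum.atLeast_Suc_atMost) (auto simp: coord_w_0)
      also have "(\<Sum>k=1..n. coord_w p0 p (c, \<gamma>) k * X k t \<omega>) = inner_L2w p (laguerre_proj p0 p n \<gamma>) (\<lambda>\<xi>. z \<omega> (t + \<xi>))"
        using elim(1) t0 by blast
      finally have eq: "delay_output p c \<gamma> S t \<omega> - (\<Sum>k=0..n. coord_w p0 p (c, \<gamma>) k * X k t \<omega>) = c * D t \<omega> + ?z"
        by (simp add: delay_output_def D_def algebra_simps)
      have "ennreal (?z\<^sup>2) \<le> 2 * (ennreal (\<epsilon> \<gamma> * E) * (ennreal (r1\<^sup>2) + ennreal T * V \<omega>))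
          + 2 * (ennreal (inner_L2w p \<gamma> \<gamma> * E) * (ennreal T * VD \<omega>))"
        by (rule order_trans[OF delay_z[OF L2(4) elim(2) t]])
           (intro add_left_mono mult_left_mono QD elim(2) t; simp)
      then show "ennreal (\<bar>delay_output p c \<gamma> S t \<omega> - (\<Sum>k=0..n. coord_w p0 p (c, \<gamma>) k * X k t \<omega>)\<bar>\<^sup>2)
          \<le> ennreal ?P * VD \<omega> + ennreal ?k * (ennreal (r1\<^sup>2) + ennreal T * V \<omega>)"
        unfolding eq power2_abs using E T \<epsilon>_nonneg inner_L2w_nonneg[of p \<gamma>]
        by (intro output_step[OF D_le[OF elim(2) t]]) (auto simp: r)
    qed
  qed
  then have "(\<integral>\<^sup>+\<omega>. (SUP t\<in>{0..T}.
      ennreal (\<bar>delay_output p c \<gamma> S t \<omega> - (\<Sum>k=0..n. coord_w p0 p (c, \<gamma>) k * X k t \<omega>)\<bar>\<^sup>2)) \<partial>M)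
      \<le> (\<integral>\<^sup>+\<omega>. ennreal ?P * VD \<omega> + ennreal ?k * (ennreal (r1\<^sup>2) + ennreal T * V \<omega>) \<partial>M)"
    by (rule nn_integral_mono_AE)
  also have "\<dots> = ennreal ?P * (\<integral>\<^sup>+\<omega>. VD \<omega> \<partial>M) + (\<integral>\<^sup>+\<omega>. ennreal ?k * (ennreal (r1\<^sup>2) + ennreal T * V \<omega>) \<partial>M)"
    by (simp add: nn_integral_add nn_integral_cmult del: ennreal_plus)
  also have "\<dots> \<le> ennreal ?P * ennreal (eb * (\<epsilon> \<alpha> + \<epsilon> \<beta>)) + ennreal (?k * (r1\<^sup>2 + T * sb))"
    using E \<epsilon>_nonneg by (intro add_mono mult_left_mono error EV) auto
  also have "\<dots> = ennreal (?P * (eb * (\<epsilon> \<alpha> + \<epsilon> \<beta>)) + ?k * (r1\<^sup>2 + T * sb))"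
    unfolding ennreal_mult'[OF P, symmetric] using P E T sb eb \<epsilon>_nonneg
    by (intro ennreal_plus[symmetric] mult_nonneg_nonneg add_nonneg_nonneg) auto
  also have "\<dots> \<le> ennreal (output_bound C1 C2 p T r1 r2 r3 r4 * (\<epsilon> \<alpha> + \<epsilon> \<beta> + \<epsilon> \<gamma>))"
  proof (rule ennreal_leI)
    \<comment> \<open>The cross terms are nonnegative, so the two constants may be added instead of
      being kept with their own errors.\<close>
    have *: "x * (\<epsilon> \<alpha> + \<epsilon> \<beta>) + w * \<epsilon> \<gamma> \<le> (x + w) * (\<epsilon> \<alpha> + \<epsilon> \<beta> + \<epsilon> \<gamma>)" if "0 \<le> x" "0 \<le> w" for x w
      using that \<epsilon>_nonneg[of \<alpha>] \<epsilon>_nonneg[of \<beta>] \<epsilon>_nonneg[of \<gamma>] by (simp add: algebra_simps)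
    show "?P * (eb * (\<epsilon> \<alpha> + \<epsilon> \<beta>)) + ?k * (r1\<^sup>2 + T * sb)
        \<le> output_bound C1 C2 p T r1 r2 r3 r4 * (\<epsilon> \<alpha> + \<epsilon> \<beta> + \<epsilon> \<gamma>)"
      using *[of "?P * eb" "4 * E * (r1\<^sup>2 + T * sb)"] P eb sb E T
      unfolding output_bound_def eb_def[symmetric] sb_def[symmetric] E_def[symmetric]
      by (simp add: mult_ac)
  qed
  finally show ?thesis
    unfolding r1_def r2_def r3_def r4_def .
qed

end

theorem proposition4p7:
  fixes M :: "'w measure" and W :: "real \<Rightarrow> 'w \<Rightarrow> real"
    and p lam p0 C1 C2 T :: real
    and U :: "(real ^ 'd::finite) set"
    and b \<sigma> :: "real \<Rightarrow> real \<Rightarrow> real ^ 'd \<Rightarrow> real"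
  assumes "prob_space M" and "complete_measure M"
    and "brownian_motion M W"
    and "lam > max p (p / 2)" and "p0 = lam - p"
    and "C1 \<ge> 0" and "C2 \<ge> 0"
    and "\<And>x x' y y' v. v \<in> U \<Longrightarrow>
      \<bar>b x y v - b x' y' v\<bar> + \<bar>\<sigma> x y v - \<sigma> x' y' v\<bar> \<le> C1 * (\<bar>x - x'\<bar> + \<bar>y - y'\<bar>)"
    and "\<And>x y v. v \<in> U \<Longrightarrow> \<bar>b x y v\<bar> + \<bar>\<sigma> x y v\<bar> \<le> C2 * (1 + \<bar>x\<bar> + \<bar>y\<bar>)"
    and "T > 0"
  shows "\<exists>C :: real \<Rightarrow> real \<Rightarrow> real \<Rightarrow> real \<Rightarrow> real. (\<forall>r1 r2 r3 r4. 0 \<le> C r1 r2 r3 r4) \<and>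
    (\<forall>s\<in>Hw p. \<forall>\<alpha>1\<in>L2w p. \<forall>\<beta>1\<in>L2w p. \<forall>\<gamma>1\<in>L2w p. \<forall>\<gamma>0. \<forall>u S n X.
       admissible_control M W U u \<longrightarrow>
       delay_solution M W p b \<sigma> \<alpha>1 \<beta>1 s u S \<longrightarrow>
       laguerre_system M W p0 p b \<sigma> \<alpha>1 \<beta>1 s u n X \<longrightarrow>
       (let \<alpha> = (0, \<alpha>1); \<beta> = (0, \<beta>1); \<gamma> = (\<gamma>0, \<gamma>1) in
        (\<integral>\<^sup>+\<omega>. (SUP t\<in>{0..T}.
            ennreal (\<bar>delay_output p \<gamma>0 \<gamma>1 S t \<omega> - (\<Sum>k=0..n. coord_w p0 p \<gamma> k * X k t \<omega>)\<bar>\<^sup>2)) \<partial>M)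
        \<le> ennreal (C (norm_w p s) (norm_w p \<alpha>) (norm_w p \<beta>) (norm_w p \<gamma>) *
            ((norm_w p (diff_w \<alpha> (trunc_w p0 p n \<alpha>)))\<^sup>2
             + (norm_w p (diff_w \<beta> (trunc_w p0 p n \<beta>)))\<^sup>2
             + (norm_w p (diff_w \<gamma> (trunc_w p0 p n \<gamma>)))\<^sup>2))))"
proof -
  interpret brownian_space M W
    by (intro brownian_space.intro brownian_space_axioms.intro assms)
  have p0: "0 < p0" using assms(4,5) by simp
  show ?thesis
  \<comment> \<open>The witness is fixed before initial datum, kernels, control, \<open>n\<close>
    and solutions are introduced, and it sees them only through the four norms; this gives the
    uniformity in the control.\<close>
  proof (intro exI[of _ "output_bound C1 C2 p T"] conjI allI ballI impI)
    show "0 \<le> output_bound C1 C2 p T r1 r2 r3 r4" for r1 r2 r3 r4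
      using assms(10) by (simp add: output_bound_nonneg)
  next
    fix s \<alpha>1 \<beta>1 \<gamma>1 \<gamma>0 u S n X
    assume s: "s \<in> Hw p" and L2: "\<alpha>1 \<in> L2w p" "\<beta>1 \<in> L2w p" "\<gamma>1 \<in> L2w p"
      and u: "admissible_control M W U u"
      and S: "delay_solution M W p b \<sigma> \<alpha>1 \<beta>1 s u S"
      and X: "laguerre_system M W p0 p b \<sigma> \<alpha>1 \<beta>1 s u n X"
    obtain s0 s1 where s_eq: "s = (s0, s1)" and s1: "s1 \<in> L2w p"
      using s by (auto simp: Hw_def)
    show "let \<alpha> = (0, \<alpha>1); \<beta> = (0, \<beta>1); \<gamma> = (\<gamma>0, \<gamma>1) in
        (\<integral>\<^sup>+\<omega>. (SUP t\<in>{0..T}.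
            ennreal (\<bar>delay_output p \<gamma>0 \<gamma>1 S t \<omega> - (\<Sum>k=0..n. coord_w p0 p \<gamma> k * X k t \<omega>)\<bar>\<^sup>2)) \<partial>M)
        \<le> ennreal (output_bound C1 C2 p T (norm_w p s) (norm_w p \<alpha>) (norm_w p \<beta>) (norm_w p \<gamma>) *
            ((norm_w p (diff_w \<alpha> (trunc_w p0 p n \<alpha>)))\<^sup>2
             + (norm_w p (diff_w \<beta> (trunc_w p0 p n \<beta>)))\<^sup>2
             + (norm_w p (diff_w \<gamma> (trunc_w p0 p n \<gamma>)))\<^sup>2))"
      unfolding Let_def norm_w_diff_trunc s_eq
      by (rule laguerre_approximation[OF p0 assms(6,7,10,8,9) s1 L2 u S[unfolded s_eq] X[unfolded s_eq]])
  qed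
qed

end
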